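(* Let $A$ be a commutative ring, $R=A[\xi_i]_{i\ge1}$, let $\lambda$ be an $\infty$-composition on an index set $\mathcal{I}$ and $e$ a $\lambda$-reduced weighting on $\mathcal{I}$. Let $\mathcal{G}\subset R$ be the finite set $\{h_{\mu,d}:(\mu,d)\in\Psi_0\}$ defined in the context. Then the $\mathfrak{S}$-radical of the $\mathfrak{S}$-ideal generated by $\mathcal{G}$ is $\mathfrak{P}(\lambda,e)$.
   Context: $[\infty]=\{1,2,\ldots\}$; $\mathfrak{S}=\bigcup_{n\ge1}\mathfrak{S}_n$ is the group of permutations of $[\infty]$ moving finitely many elements, acting on $R$ by $A$-algebra automorphisms permuting the $\xi_i$. An $\mathfrak{S}$-ideal is an $\mathfrak{S}$-stable ideal; the $\mathfrak{S}$-ideal generated by a set is the ideal generated by the $\mathfrak{S}$-orbits of its elements. The $\mathfrak{S}$-radical of an $\mathfrak{S}$-ideal $\mathfrak{a}$ is the sum of all $\mathfrak{S}$-ideals $\mathfrak{b}$ with $\mathfrak{b}^n\subset\mathfrak{a}$ for some $n$. An $\infty$-composition on a finite index set $\mathcal{I}$ is a function $\lambda\colon\mathcal{I}\to\mathbf{Z}_{\ge1}\cup\{\infty\}$ taking the value $\infty$ at least once; $\mathcal{I}^\infty=\{\alpha:\lambda_\alpha=\infty\}$, $\mathcal{I}^{\mathrm f}=\mathcal{I}\setminus\mathcal{I}^\infty$. A weighting on $\mathcal{I}$ is a function $e\colon\mathcal{I}\to\mathbf{Z}_{\ge1}$ (with maximum value $e_{\max}$); it is ($\lambda$-)reduced if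 $e_\alpha=1$ for $\alpha\in\mathcal{I}^{\mathrm f}$. A partition of $[\infty]$ of type $\lambda$ is a family $\mathcal{U}=\{U_\alpha\}_{\alpha\in\mathcal{I}}$ of disjoint non-empty subsets covering $[\infty]$ with $\#U_\alpha=\lambda_\alpha$; $\pi\colon[\infty]\to\mathcal{I}$ is given by $i\in U_{\pi(i)}$. Let $\tilde{S}_{\mathcal{U},0}=A[t_\alpha]_{\alpha\in\mathcal{I}}[(t_\alpha-t_\beta)^{-1}]_{\alpha\ne\beta}$, $\mathbf{U}^{\mathcal{I}}=\operatorname{Spec}(\tilde{S}_{\mathcal{U},0})$, $\tilde{S}_{\mathcal{U}}=\tilde{S}_{\mathcal{U},0}[\epsilon_i]_{i\ge1}$. For $Z\subset\mathbf{U}^{\mathcal{I}}$ let $\mathfrak{I}_0(Z)\subset\tilde{S}_{\mathcal{U},0}$ be its radical ideal and $\mathfrak{Q}_{\mathcal{U}}(\lambda,e;Z)$ the ideal of $\tilde{S}_{\mathcal{U}}$ generated by $\mathfrak{I}_0(Z)$ and all $\epsilon_i^{e(\pi(i))}$. Let $\iota\colon R\to\tilde{S}_{\mathcal{U}}$ be the $A$-algebra map $\xi_i\mapsto t_{\pi(i)}+\epsilon_i$. Then $\mathfrak{P}(\lambda,e;Z)=\{f\in R:\iota(\sigma f)\in\mathfrak{Q}_{\mathcal{U}}(\lambda,e;Z)\text{ for all }\sigma\in\mathfrak{S}\}$ (independent of $\mathcal{U}$), and $\mathfrak{P}(\lambda,e)=\mathfrak{P}(\lambda,e;\mathbf{U}^{\mathcal{I}})$.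 $\Xi$ is the set of isomorphism classes of pairs $(\lambda,e)$ with $\lambda$ an $\infty$-composition on some finite index set and $e$ a reduced weighting (isomorphism: bijection of index sets preserving both functions). For $(\mu,d)$ on $\mathcal{K}$ and $(\lambda,e)$ on $\mathcal{I}$, write $(\mu,d)\preceq(\lambda,e)$ if there exist $\mathcal{E}\subset\mathcal{I}$ and $\phi\colon\mathcal{E}\to\mathcal{K}$ such that $\mu_\beta\le\sum_{\alpha\in\phi^{-1}(\beta)}\lambda_\alpha$ for all $\beta\in\mathcal{K}$, and $d_\beta\le\sum_{\alpha\in\phi^{-1}(\beta)\cap\mathcal{I}^\infty}e_\alpha$ for all $\beta\in\mathcal{K}^\infty$. This is a partial order on $\Xi$. Fix $(\lambda,e)$. Let $\Psi=\{(\mu,d)\in\Xi:(\mu,d)\not\preceq(\lambda,e)\}$ and let $\Psi_0$ be the set of minimal elements of $\Psi$ (it is finite). For $(\mu,d)\in\Psi_0$ with index set $\mathcal{K}$, the element $h_{\mu,d}\in R$ is defined as follows. Put $n=1+\sum_{\alpha\in\mathcal{I}^{\mathrm f}}\lambda_\alpha$ and $N=2e_{\max}-1$; for $\beta\in\mathcal{K}$ put $\tau_\beta=\mu_\beta$ if $\mu_\beta<\infty$ and $\tau_\beta=nd_\beta$ if $\mu_\beta=\infty$; put $m=\sum_{\beta\in\mathcal{K}}\tau_\beta$. Choose a partition of $[m]=\{1,\ldots,m\}$ into sets $\overline{U}_\beta$ ($\beta\in\mathcal{K}$) with $\#\overline{U}_\beta=\tau_\beta$, and for each $\beta\in\mathcal{K}^\infty$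 a partition $\overline{U}_\beta=\overline{U}_{\beta,1}\sqcup\cdots\sqcup\overline{U}_{\beta,n}$ into sets of size $d_\beta$. For a finite set $S\subset[\infty]$ let $\Delta_S=\prod_{i<j,\ i,j\in S}(\xi_i-\xi_j)$. Then $$h_{\mu,d}=\Big(\prod_{\beta\in\mathcal{K}^\infty}\prod_{k=1}^n\Delta_{\overline{U}_{\beta,k}}\Big)\cdot\prod(\xi_i-\xi_j)^N,$$ where the last product is over all pairs $1\le i<j\le m$ such that $i$ and $j$ lie in $\overline{U}_\beta$ and $\overline{U}_\gamma$ with $\beta\ne\gamma$. The set $\mathcal{G}$ depends on the choices made; the statement holds for any choices. *)

theory Defs
  imports
    "HOL-Library.Poly_Mapping"
    "HOL-Library.Extended_Nat"
    "HOL-Library.Disjoint_Sets"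
    "HOL-Combinatorics.Permutations"
begin

section \<open>Ideals of commutative rings\<close>

text \<open>Ideals are the submodules of the ring regarded as a module over itself. The locale is not
  interpreted globally, since its simp rules clash with those for multiplication.\<close>

definition is_ideal :: "'a::comm_ring_1 set \<Rightarrow> bool" where
  "is_ideal = module.subspace (*)"

definition ideal_gen :: "'a::comm_ring_1 set \<Rightarrow> 'a set" where
  "ideal_gen = module.span (*)"

lemma module_mult: "module ((*) :: 'a::comm_ring_1 \<Rightarrow> 'a \<Rightarrow> 'a)"
  by unfold_locales (simp_all add: algebra_simps)

definition ideal_prod :: "'a::comm_ring_1 set \<Rightarrow> 'a set \<Rightarrow> 'a set" where
  "ideal_prod I J = ideal_gen {x * y |x y. x \<in> I \<and> y \<in> J}"

primrec ideal_power :: "'a::comm_ring_1 set \<Rightarrow> nat \<Rightarrow> 'a set" where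
  "ideal_power I 0 = UNIV"
| "ideal_power I (Suc n) = ideal_prod I (ideal_power I n)"

definition is_prime_ideal :: "'a::comm_ring_1 set \<Rightarrow> bool" where
  "is_prime_ideal P \<longleftrightarrow> is_ideal P \<and> P \<noteq> UNIV \<and> (\<forall>x y. x * y \<in> P \<longrightarrow> x \<in> P \<or> y \<in> P)"

definition Spec :: "'a::comm_ring_1 set set" where
  "Spec = {P. is_prime_ideal P}"


section \<open>Polynomials in arbitrarily many variables\<close>

type_synonym ('x, 'a) mpoly = "('x \<Rightarrow>\<^sub>0 nat) \<Rightarrow>\<^sub>0 'a"

definition Const :: "'a::zero \<Rightarrow> ('x, 'a) mpoly" where
  "Const c = Poly_Mapping.single 0 c"

definition Var :: "'x \<Rightarrow> ('x, 'a::zero_neq_one) mpoly" where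
  "Var x = Poly_Mapping.single (Poly_Mapping.single x 1) 1"

text \<open>The ring homomorphism out of a polynomial ring that restricts to the ring homomorphism
  \<open>c\<close> on constants and sends the variable \<open>x\<close> to \<open>v x\<close>.\<close>

definition poly_hom :: "('a::comm_ring_1 \<Rightarrow> 'b::comm_ring_1) \<Rightarrow> ('x \<Rightarrow> 'b) \<Rightarrow> ('x, 'a) mpoly \<Rightarrow> 'b" where
  "poly_hom c v p =
     (\<Sum>m\<in>Poly_Mapping.keys p.
        c (Poly_Mapping.lookup p m) *
        (\<Prod>x\<in>Poly_Mapping.keys m. v x ^ Poly_Mapping.lookup m x))"


section \<open>The ring \<open>R\<close> with its action of the infinite symmetric group\<close>

text \<open>The countable set of indices \<open>1, 2, \<dots>\<close> is modelled by the type \<open>nat\<close>, the index \<open>i\<close> being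
  represented by \<open>i - 1\<close>; accordingly \<open>1, \<dots>, m\<close> becomes \<open>{..<m}\<close>.\<close>

type_synonym 'a R = "(nat, 'a) mpoly"

definition Sym_inf :: "(nat \<Rightarrow> nat) set" where
  "Sym_inf = {\<sigma>. \<exists>n. \<sigma> permutes {..<n}}"

definition act :: "(nat \<Rightarrow> nat) \<Rightarrow> 'a::comm_ring_1 R \<Rightarrow> 'a R" where
  "act \<sigma> = poly_hom Const (\<lambda>i. Var (\<sigma> i))"

definition is_S_ideal :: "'a::comm_ring_1 R set \<Rightarrow> bool" where
  "is_S_ideal J \<longleftrightarrow> is_ideal J \<and> (\<forall>\<sigma>\<in>Sym_inf. act \<sigma> ` J \<subseteq> J)"

definition S_ideal_gen :: "'a::comm_ring_1 R set \<Rightarrow> 'a R set" where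
  "S_ideal_gen G = ideal_gen (\<Union>\<sigma>\<in>Sym_inf. act \<sigma> ` G)"

text \<open>The sum of a family of ideals is the ideal generated by their union.\<close>

definition S_radical :: "'a::comm_ring_1 R set \<Rightarrow> 'a R set" where
  "S_radical J = ideal_gen (\<Union>{B. is_S_ideal B \<and> (\<exists>n. ideal_power B n \<subseteq> J)})"


section \<open>The localised polynomial ring\<close>

text \<open>The localisation of \<open>A[t\<^sub>\<alpha>]\<close> at the multiplicative set generated by all
  \<open>t\<^sub>\<alpha> - t\<^sub>\<beta>\<close> with \<open>\<alpha> \<noteq> \<beta>\<close>; the finite index set is a type \<open>'i\<close>.\<close>

inductive_set denoms :: "('i, 'a::comm_ring_1) mpoly set" where
  denoms_1: "1 \<in> denoms"
| denoms_step: "s \<in> denoms \<Longrightarrow> \<alpha> \<noteq> \<beta> \<Longrightarrow> (Var \<alpha> - Var \<beta>) * s \<in> denoms"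

lemma denoms_mult: "s \<in> denoms \<Longrightarrow> t \<in> denoms \<Longrightarrow> s * t \<in> denoms"
proof (induction rule: denoms.induct)
  case (denoms_step s \<alpha> \<beta>)
  then show ?case
    using denoms.denoms_step[of "s * t" \<alpha> \<beta>] by (simp add: mult.assoc)
qed simp

lemma lookup_Var_mult:
  "Poly_Mapping.lookup (Var x * p) m =
     (\<Sum>q. Poly_Mapping.lookup p q when m = Poly_Mapping.single x 1 + q)"
  for p :: "('x, 'a::comm_ring_1) mpoly"
  by (simp add: Var_def lookup_mult lookup_single when_mult)

lemma Var_diff_mult_eq_0:
  fixes p :: "('x, 'a::comm_ring_1) mpoly"
  assumes "\<alpha> \<noteq> \<beta>" "(Var \<alpha> - Var \<beta>) * p = 0"
  shows "p = 0"
proof (rule ccontr)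
  assume "p \<noteq> 0"
  define deg where "deg m = Poly_Mapping.lookup m \<alpha>" for m :: "'x \<Rightarrow>\<^sub>0 nat"
  have ne: "Poly_Mapping.keys p \<noteq> {}"
    using \<open>p \<noteq> 0\<close> by simp
  obtain m where m: "m \<in> Poly_Mapping.keys p"
    and max: "\<And>q. q \<in> Poly_Mapping.keys p \<Longrightarrow> deg q \<le> deg m"
    using obtains_MAX[OF finite_keys ne, of deg] Max_ge[of "deg ` Poly_Mapping.keys p"]
    by (metis finite_imageI finite_keys imageI)
  let ?k = "Poly_Mapping.single \<alpha> 1 + m"
  have "Poly_Mapping.lookup (Var \<alpha> * p) ?k = Poly_Mapping.lookup p m"
    by (simp add: lookup_Var_mult)
  moreover have "(Poly_Mapping.lookup p q when ?k = Poly_Mapping.single \<beta> 1 + q) = 0" for q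
  proof (cases "?k = Poly_Mapping.single \<beta> 1 + q")
    case True
    then have "deg ?k = deg (Poly_Mapping.single \<beta> 1 + q)"
      by simp
    then have "deg q = Suc (deg m)"
      using assms(1) by (simp add: deg_def lookup_add lookup_single)
    then have "q \<notin> Poly_Mapping.keys p"
      using max[of q] by auto
    then show ?thesis
      by (simp add: in_keys_iff)
  qed simp
  then have "Poly_Mapping.lookup (Var \<beta> * p) ?k = 0"
    by (simp add: lookup_Var_mult)
  moreover have "Poly_Mapping.lookup (Var \<alpha> * p) ?k = Poly_Mapping.lookup (Var \<beta> * p) ?k"
    using assms(2) by (simp add: left_diff_distrib)
  ultimately show False
    using m by (simp add: in_keys_iff)
qed

lemma denoms_nonzerodivisor: "s \<in> denoms \<Longrightarrow> s * p = 0 \<Longrightarrow> p = 0"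
proof (induction arbitrary: p rule: denoms.induct)
  case (denoms_step s \<alpha> \<beta>)
  have "(Var \<alpha> - Var \<beta>) * (s * p) = 0"
    using denoms_step.prems mult.assoc[of "Var \<alpha> - Var \<beta>" s p] by argo
  then have "s * p = 0"
    by (rule Var_diff_mult_eq_0[OF denoms_step.hyps(2)])
  then show ?case
    by (rule denoms_step.IH)
qed simp

definition loc_rel ::
  "('i, 'a::comm_ring_1) mpoly \<times> ('i, 'a) mpoly \<Rightarrow> ('i, 'a) mpoly \<times> ('i, 'a) mpoly \<Rightarrow> bool" where
  "loc_rel x y \<longleftrightarrow> snd x \<in> denoms \<and> snd y \<in> denoms \<and>
     (\<exists>u\<in>denoms. u * (fst x * snd y - fst y * snd x) = 0)"

lemma loc_rel_iff:
  "loc_rel x y \<longleftrightarrow> snd x \<in> denoms \<and> snd y \<in> denoms \<and> fst x * snd y = fst y * snd x"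
proof -
  have "(\<exists>u\<in>denoms. u * (fst x * snd y - fst y * snd x) = 0) \<longleftrightarrow>
      fst x * snd y - fst y * snd x = 0" (is "?P \<longleftrightarrow> ?d = 0")
  proof
    assume ?P
    then show "?d = 0"
      by (blast intro: denoms_nonzerodivisor)
  next
    assume "?d = 0"
    then show ?P
      using denoms_1 by (intro bexI[of _ 1]) (simp_all only: mult_1_left)
  qed
  then show ?thesis
    by (simp only: loc_rel_def right_minus_eq)
qed

lemma frac_trans:
  fixes a b :: "'r::comm_ring_1"
  assumes "a * b' = a' * b" "a' * b'' = a'' * b'"
  shows "b' * (a * b'' - a'' * b) = 0"
proof -
  have "b' * (a * b'' - a'' * b) = b'' * (a * b') - b * (a'' * b')"
    by (simp add: algebra_simps)
  also have "\<dots> = b'' * (a' * b) - b * (a' * b'')"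
    by (simp only: assms)
  also have "\<dots> = 0"
    by (simp add: algebra_simps)
  finally show ?thesis .
qed

lemma frac_add_cong:
  fixes a b :: "'r::comm_ring_1"
  assumes "a * b' = a' * b" "c * d' = c' * d"
  shows "(a * d + c * b) * (b' * d') = (a' * d' + c' * b') * (b * d)"
proof -
  have "(a * d + c * b) * (b' * d') = (a * b') * (d * d') + (c * d') * (b * b')"
    by (simp add: algebra_simps)
  also have "\<dots> = (a' * b) * (d * d') + (c' * d) * (b * b')"
    by (simp only: assms)
  also have "\<dots> = (a' * d' + c' * b') * (b * d)"
    by (simp add: algebra_simps)
  finally show ?thesis .
qed

lemma frac_mult_cong:
  fixes a b :: "'r::comm_ring_1"
  assumes "a * b' = a' * b" "c * d' = c' * d"
  shows "(a * c) * (b' * d') = (a' * c') * (b * d)"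
proof -
  have "(a * c) * (b' * d') = (a * b') * (c * d')"
    by (simp add: algebra_simps)
  also have "\<dots> = (a' * b) * (c' * d)"
    by (simp only: assms)
  also have "\<dots> = (a' * c') * (b * d)"
    by (simp add: algebra_simps)
  finally show ?thesis .
qed

lemma part_equivp_loc_rel:
  "part_equivp (loc_rel :: ('i, 'a::comm_ring_1) mpoly \<times> ('i, 'a) mpoly \<Rightarrow> _)"
proof (rule part_equivpI)
  show "\<exists>x :: ('i, 'a) mpoly \<times> ('i, 'a) mpoly. loc_rel x x"
    by (rule exI[of _ "(0, 1)"]) (simp add: loc_rel_iff denoms_1)
  show "symp (loc_rel :: ('i, 'a) mpoly \<times> ('i, 'a) mpoly \<Rightarrow> _)"
    by (auto simp: symp_def loc_rel_iff)
  show "transp (loc_rel :: ('i, 'a) mpoly \<times> ('i, 'a) mpoly \<Rightarrow> _)"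
  proof (rule transpI, unfold split_paired_all)
    fix a b a' b' a'' b'' :: "('i, 'a) mpoly"
    assume A: "loc_rel (a, b) (a', b')" and B: "loc_rel (a', b') (a'', b'')"
    then have d: "b \<in> denoms" "b' \<in> denoms" "b'' \<in> denoms"
      and eqs: "a * b' = a' * b" "a' * b'' = a'' * b'"
      by (simp_all only: loc_rel_iff fst_conv snd_conv)
    have "a * b'' - a'' * b = 0"
      using d(2) frac_trans[OF eqs] by (rule denoms_nonzerodivisor)
    then show "loc_rel (a, b) (a'', b'')"
      using d by (simp only: loc_rel_iff fst_conv snd_conv right_minus_eq)
  qed
qed

quotient_type (overloaded) ('i, 'a) S0 =
  "('i, 'a::comm_ring_1) mpoly \<times> ('i, 'a) mpoly" / partial: loc_rel
  by (rule part_equivp_loc_rel)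

instantiation S0 :: (type, comm_ring_1) comm_ring_1
begin

lift_definition zero_S0 :: "('a, 'b) S0" is "(0, 1)"
  by (simp add: loc_rel_iff denoms_1)

lift_definition one_S0 :: "('a, 'b) S0" is "(1, 1)"
  by (simp add: loc_rel_iff denoms_1)

lift_definition plus_S0 :: "('a, 'b) S0 \<Rightarrow> ('a, 'b) S0 \<Rightarrow> ('a, 'b) S0"
  is "\<lambda>x y. (fst x * snd y + fst y * snd x, snd x * snd y)"
proof -
  fix x x' y y' :: "('a, 'b) mpoly \<times> ('a, 'b) mpoly"
  assume "loc_rel x x'" "loc_rel y y'"
  then have d: "snd x \<in> denoms" "snd x' \<in> denoms" "snd y \<in> denoms" "snd y' \<in> denoms"
    and X: "fst x * snd x' = fst x' * snd x" and Y: "fst y * snd y' = fst y' * snd y"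
    by (auto simp: loc_rel_iff)
  show "loc_rel (fst x * snd y + fst y * snd x, snd x * snd y)
      (fst x' * snd y' + fst y' * snd x', snd x' * snd y')"
    using d frac_add_cong[OF X Y] by (simp only: loc_rel_iff denoms_mult fst_conv snd_conv)
qed

lift_definition uminus_S0 :: "('a, 'b) S0 \<Rightarrow> ('a, 'b) S0"
  is "\<lambda>x. (- fst x, snd x)"
  by (simp add: loc_rel_iff)

definition minus_S0 :: "('a, 'b) S0 \<Rightarrow> ('a, 'b) S0 \<Rightarrow> ('a, 'b) S0" where
  "minus_S0 x y = x + - y"

lift_definition times_S0 :: "('a, 'b) S0 \<Rightarrow> ('a, 'b) S0 \<Rightarrow> ('a, 'b) S0"
  is "\<lambda>x y. (fst x * fst y, snd x * snd y)"
proof -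
  fix x x' y y' :: "('a, 'b) mpoly \<times> ('a, 'b) mpoly"
  assume "loc_rel x x'" "loc_rel y y'"
  then have d: "snd x \<in> denoms" "snd x' \<in> denoms" "snd y \<in> denoms" "snd y' \<in> denoms"
    and X: "fst x * snd x' = fst x' * snd x" and Y: "fst y * snd y' = fst y' * snd y"
    by (auto simp: loc_rel_iff)
  show "loc_rel (fst x * fst y, snd x * snd y) (fst x' * fst y', snd x' * snd y')"
    using d frac_mult_cong[OF X Y] by (simp only: loc_rel_iff denoms_mult fst_conv snd_conv)
qed

instance
proof
  fix x y z :: "('a, 'b) S0"
  show "x * y * z = x * (y * z)"
    by transfer (simp add: loc_rel_iff denoms_mult algebra_simps)
  show "x * y = y * x"
    by transfer (simp add: loc_rel_iff denoms_mult algebra_simps)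
  show "1 * x = x"
    by transfer (simp add: loc_rel_iff)
  show "x + y + z = x + (y + z)"
    by transfer (simp add: loc_rel_iff denoms_mult algebra_simps)
  show "x + y = y + x"
    by transfer (simp add: loc_rel_iff denoms_mult algebra_simps)
  show "0 + x = x"
    by transfer (simp add: loc_rel_iff)
  show "- x + x = 0"
    by transfer (simp add: loc_rel_iff denoms_1 denoms_mult)
  show "x - y = x + - y"
    by (rule minus_S0_def)
  show "(x + y) * z = x * z + y * z"
    by transfer (simp add: loc_rel_iff denoms_mult algebra_simps)
  show "(0 :: ('a, 'b) S0) \<noteq> 1"
    by transfer (simp add: loc_rel_iff)
qed

end

definition to_S0 :: "('i, 'a::comm_ring_1) mpoly \<Rightarrow> ('i, 'a) S0" where
  "to_S0 p = abs_S0 (p, 1)"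


section \<open>\<open>\<infinity>\<close>-compositions, weightings and partitions\<close>

definition infinity_composition :: "'k set \<Rightarrow> ('k \<Rightarrow> enat) \<Rightarrow> bool" where
  "infinity_composition K \<mu> \<longleftrightarrow> finite K \<and> (\<forall>\<beta>\<in>K. 1 \<le> \<mu> \<beta>) \<and> (\<exists>\<beta>\<in>K. \<mu> \<beta> = \<infinity>)"

definition weighting :: "'k set \<Rightarrow> ('k \<Rightarrow> nat) \<Rightarrow> bool" where
  "weighting K d \<longleftrightarrow> (\<forall>\<beta>\<in>K. 1 \<le> d \<beta>)"

definition reduced :: "'k set \<Rightarrow> ('k \<Rightarrow> enat) \<Rightarrow> ('k \<Rightarrow> nat) \<Rightarrow> bool" where
  "reduced K \<mu> d \<longleftrightarrow> (\<forall>\<beta>\<in>K. \<mu> \<beta> \<noteq> \<infinity> \<longrightarrow> d \<beta> = 1)"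

definition esize :: "'x set \<Rightarrow> enat" where
  "esize X = (if finite X then enat (card X) else \<infinity>)"

definition partition_of_type :: "('i \<Rightarrow> enat) \<Rightarrow> ('i \<Rightarrow> nat set) \<Rightarrow> bool" where
  "partition_of_type l U \<longleftrightarrow> disjoint_family U \<and> (\<Union>\<alpha>. U \<alpha>) = UNIV \<and>
     (\<forall>\<alpha>. U \<alpha> \<noteq> {} \<and> esize (U \<alpha>) = l \<alpha>)"

definition block_index :: "('i \<Rightarrow> nat set) \<Rightarrow> nat \<Rightarrow> 'i" where
  "block_index U i = (THE \<alpha>. i \<in> U \<alpha>)"


section \<open>The ideals \<open>\<PP>(\<lambda>, e; Z)\<close>\<close>

text \<open>The variables \<open>\<epsilon>\<^sub>i\<close> are the polynomial variables over the coefficient ring \<open>S0\<close>.\<close>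

type_synonym ('i, 'a) Stilde = "(nat, ('i, 'a) S0) mpoly"

text \<open>The radical ideal of a set of points of the spectrum is the intersection of the
  corresponding primes; for \<open>Z = Spec\<close> it is the nilradical.\<close>

definition I0 :: "('i, 'a::comm_ring_1) S0 set set \<Rightarrow> ('i, 'a) S0 set" where
  "I0 Z = \<Inter>Z"

definition frakQ :: "('i \<Rightarrow> nat set) \<Rightarrow> ('i \<Rightarrow> nat) \<Rightarrow> ('i, 'a::comm_ring_1) S0 set set
    \<Rightarrow> ('i, 'a) Stilde set" where
  "frakQ U e Z = ideal_gen (Const ` I0 Z \<union> range (\<lambda>i. Var i ^ e (block_index U i)))"

definition iota :: "('i \<Rightarrow> nat set) \<Rightarrow> 'a::comm_ring_1 R \<Rightarrow> ('i, 'a) Stilde" where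
  "iota U = poly_hom (\<lambda>a. Const (to_S0 (Const a)))
              (\<lambda>i. Const (to_S0 (Var (block_index U i))) + Var i)"

text \<open>The type \<open>\<lambda>\<close> enters only through the partition \<open>U\<close> of type \<open>\<lambda>\<close>.\<close>

definition frakP :: "('i \<Rightarrow> nat set) \<Rightarrow> ('i \<Rightarrow> nat) \<Rightarrow> ('i, 'a::comm_ring_1) S0 set set
    \<Rightarrow> 'a R set" where
  "frakP U e Z = {f. \<forall>\<sigma>\<in>Sym_inf. iota U (act \<sigma> f) \<in> frakQ U e Z}"


section \<open>The partially ordered set \<open>\<Xi>\<close>\<close>

text \<open>A weighted composition \<open>(\<mu>, d)\<close> on an index set \<open>K\<close> is the triple \<open>(K, \<mu>, d)\<close>; the values
  of \<open>\<mu>\<close> and \<open>d\<close> outside \<open>K\<close> are irrelevant.\<close>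

type_synonym 'k wcomp = "'k set \<times> ('k \<Rightarrow> enat) \<times> ('k \<Rightarrow> nat)"

definition wcomps :: "'k wcomp set" where
  "wcomps = {(K, \<mu>, d). infinity_composition K \<mu> \<and> weighting K d \<and> reduced K \<mu> d}"

definition wcomp_iso :: "('k wcomp \<times> 'k wcomp) set" where
  "wcomp_iso = {((K, \<mu>, d), (L, \<nu>, c)). (K, \<mu>, d) \<in> wcomps \<and> (L, \<nu>, c) \<in> wcomps \<and>
     (\<exists>f. bij_betw f K L \<and> (\<forall>\<beta>\<in>K. \<nu> (f \<beta>) = \<mu> \<beta> \<and> c (f \<beta>) = d \<beta>))}"

text \<open>Every isomorphism class has representatives whose index set is a finite set of
  natural numbers.\<close>

definition Xi :: "nat wcomp set set" where
  "Xi = wcomps // wcomp_iso"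

definition wcomp_le :: "'k wcomp \<Rightarrow> 'i wcomp \<Rightarrow> bool"  (infix \<open>\<preceq>\<close> 50) where
  "x \<preceq> y \<longleftrightarrow> (case (x, y) of ((K, \<mu>, d), (I, l, e)) \<Rightarrow>
     \<exists>E \<phi>. E \<subseteq> I \<and> \<phi> ` E \<subseteq> K \<and>
       (\<forall>\<beta>\<in>K. \<mu> \<beta> \<le> (\<Sum>\<alpha>\<in>{\<alpha>\<in>E. \<phi> \<alpha> = \<beta>}. l \<alpha>)) \<and>
       (\<forall>\<beta>\<in>K. \<mu> \<beta> = \<infinity> \<longrightarrow> d \<beta> \<le> (\<Sum>\<alpha>\<in>{\<alpha>\<in>E. \<phi> \<alpha> = \<beta> \<and> l \<alpha> = \<infinity>}. e \<alpha>)))"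

definition Xi_le :: "nat wcomp set \<Rightarrow> nat wcomp set \<Rightarrow> bool" where
  "Xi_le c c' \<longleftrightarrow> (\<exists>x\<in>c. \<exists>y\<in>c'. x \<preceq> y)"

definition Psi :: "'i wcomp \<Rightarrow> nat wcomp set set" where
  "Psi y = {c \<in> Xi. \<not> (\<exists>x\<in>c. x \<preceq> y)}"

definition Psi0 :: "'i wcomp \<Rightarrow> nat wcomp set set" where
  "Psi0 y = {c \<in> Psi y. \<forall>c'\<in>Psi y. Xi_le c' c \<longrightarrow> c' = c}"


section \<open>The elements \<open>h\<^sub>\<mu>\<^sub>,\<^sub>d\<close>\<close>

definition par_n :: "'i wcomp \<Rightarrow> nat" where
  "par_n = (\<lambda>(I, l, e). 1 + (\<Sum>\<alpha>\<in>{\<alpha>\<in>I. l \<alpha> \<noteq> \<infinity>}. the_enat (l \<alpha>)))"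

definition par_N :: "'i wcomp \<Rightarrow> nat" where
  "par_N = (\<lambda>(I, l, e). 2 * Max (e ` I) - 1)"

definition par_tau :: "nat \<Rightarrow> ('k \<Rightarrow> enat) \<Rightarrow> ('k \<Rightarrow> nat) \<Rightarrow> 'k \<Rightarrow> nat" where
  "par_tau n \<mu> d \<beta> = (if \<mu> \<beta> = \<infinity> then n * d \<beta> else the_enat (\<mu> \<beta>))"

definition Delta :: "nat set \<Rightarrow> 'a::comm_ring_1 R" where
  "Delta S = (\<Prod>(i, j)\<in>{(i, j). i \<in> S \<and> j \<in> S \<and> i < j}. Var i - Var j)"

text \<open>\<open>W \<beta>\<close> and \<open>V \<beta> k\<close> (for \<open>k = 1, \<dots>, n\<close>) are the chosen blocks and sub-blocks.\<close>

definition block_choice :: "nat \<Rightarrow> 'k wcomp \<Rightarrow> ('k \<Rightarrow> nat set) \<Rightarrow> ('k \<Rightarrow> nat \<Rightarrow> nat set) \<Rightarrow> bool" where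
  "block_choice n = (\<lambda>(K, \<mu>, d) W V.
     disjoint_family_on W K \<and>
     (\<Union>\<beta>\<in>K. W \<beta>) = {..<(\<Sum>\<beta>\<in>K. par_tau n \<mu> d \<beta>)} \<and>
     (\<forall>\<beta>\<in>K. card (W \<beta>) = par_tau n \<mu> d \<beta>) \<and>
     (\<forall>\<beta>\<in>K. \<mu> \<beta> = \<infinity> \<longrightarrow>
        disjoint_family_on (V \<beta>) {1..n} \<and> (\<Union>k\<in>{1..n}. V \<beta> k) = W \<beta> \<and>
        (\<forall>k\<in>{1..n}. card (V \<beta> k) = d \<beta>)))"

definition h_elem :: "nat \<Rightarrow> nat \<Rightarrow> 'k wcomp \<Rightarrow> ('k \<Rightarrow> nat set) \<Rightarrow> ('k \<Rightarrow> nat \<Rightarrow> nat set)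
    \<Rightarrow> 'a::comm_ring_1 R" where
  "h_elem n N = (\<lambda>(K, \<mu>, d) W V.
     (\<Prod>\<beta>\<in>{\<beta>\<in>K. \<mu> \<beta> = \<infinity>}. \<Prod>k\<in>{1..n}. Delta (V \<beta> k)) *
     (\<Prod>(i, j)\<in>{(i, j). i < j \<and> (\<exists>\<beta>\<in>K. \<exists>\<gamma>\<in>K. \<beta> \<noteq> \<gamma> \<and> i \<in> W \<beta> \<and> j \<in> W \<gamma>)}.
        (Var i - Var j) ^ N))"

text \<open>All possible values of \<open>h\<^sub>\<mu>\<^sub>,\<^sub>d\<close>, over the choices of a representative \<open>x\<close> of the class \<open>c\<close>
  of \<open>(\<mu>, d)\<close> and of the partitions; \<open>y\<close> is \<open>(\<lambda>, e)\<close>.\<close>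

definition h_values :: "'i wcomp \<Rightarrow> nat wcomp set \<Rightarrow> 'a::comm_ring_1 R set" where
  "h_values y c = {h_elem (par_n y) (par_N y) x W V |x W V. x \<in> c \<and> block_choice (par_n y) x W V}"

end

theory Submission
  imports Defs
begin

text \<open>\<open>\<PP>(\<lambda>, e)\<close> is an intersection of \<open>\<SS>\<close>-primes, one for each point of \<open>Spec\<close>: permuting within the
  infinite blocks makes two given polynomials involve disjoint nilpotents. It contains \<open>h\<^sub>\<mu>\<^sub>,\<^sub>d\<close> when
  \<open>(\<mu>, d)\<close> is not below \<open>(\<lambda>, e)\<close>: for the factors \<open>(\<xi>\<^sub>i - \<xi>\<^sub>j)\<^sup>N\<close> and the Vandermonde factors to
  survive modulo the powers of the \<open>\<epsilon>\<^sub>i\<close>, the blocks must be matched as in the definition of the order.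

  Conversely, if \<open>f\<close> is not in the \<open>\<SS>\<close>-radical, Zorn's lemma gives an \<open>\<SS>\<close>-prime \<open>p\<close> containing all the
  \<open>h\<close> but not \<open>f\<close>. Since \<open>p\<close> contains a power of some discriminant, it can be written as the set of
  polynomials all of whose conjugates lie in an ideal \<open>q\<close> that is prime with respect to the permutations fixing a
  finite set \<open>W\<close>, and modulo \<open>q\<close> every variable is infinitely close to one of finitely many \<open>\<xi>\<^sub>w\<close>. Counting
  the variables near each of these points, and their nilpotency orders, yields a pair \<open>(\<mu>, d)\<close>. If it is not
  below \<open>(\<lambda>, e)\<close>, a conjugate of some \<open>h\<close> is nonzero modulo \<open>q\<close>, because a Vandermonde product divides the
  socle monomial up to sign. If it is below, \<open>\<PP>(\<lambda>, e)\<close> vanishes modulo \<open>q\<close>, since the vanishing of Newton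
  coefficients persists when the points \<open>t\<^sub>\<alpha>\<close> collide.\<close>

section \<open>Ideals, ring homomorphisms and equivariant primes\<close>

text \<open>Equivariant primes are weaker than primes: modulo them, differences of variables may
  still be nilpotent near a point, and these nilpotency orders are the weights to be recovered. Only
  elements fixed by the group behave as for an ordinary prime, which is the reason for freezing
  finitely many variables in \<open>W\<close>. As the base ring is arbitrary, chain conditions are
  replaced by the fact that an orbit is controlled by finitely many of its elements. The constants
  in h come from the first inclusion. A power of \<epsilon>_i - \<epsilon>_j vanishes once its
  exponent is at least the sum of the two weights minus 1, which gives \<open>N\<close>. Among
  \<open>n\<close> sub-blocks at least one avoids the n - 1 indices in finite blocks. A Vandermonde
  product on a sub-block vanishes as soon as more points than the weight share one t_\<alpha>. The
  obstacle in the other inclusion is that several t_\<alpha> may have to specialise to the same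
  \<xi>_a, where the denominators of \<open>S0\<close> become 0. Hence vanishing is first turned
  into nilpotency of coefficients lying in the polynomial ring in the t_\<alpha>, and only these are
  specialised.\<close>

lemma is_ideal_iff:
  "is_ideal I \<longleftrightarrow> 0 \<in> I \<and> (\<forall>x\<in>I. \<forall>y\<in>I. x + y \<in> I) \<and> (\<forall>r. \<forall>x\<in>I. r * x \<in> I)"
  unfolding is_ideal_def module.subspace_def[OF module_mult] by blast

lemma ideal_0: "is_ideal I \<Longrightarrow> 0 \<in> I"
  and ideal_add: "is_ideal I \<Longrightarrow> x \<in> I \<Longrightarrow> y \<in> I \<Longrightarrow> x + y \<in> I"
  and ideal_mult_left: "is_ideal I \<Longrightarrow> x \<in> I \<Longrightarrow> r * x \<in> I"
  by (auto simp: is_ideal_iff)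

lemma ideal_mult_right: "is_ideal I \<Longrightarrow> x \<in> I \<Longrightarrow> x * r \<in> I"
  using ideal_mult_left[of I x r] by (simp add: mult.commute)

lemma ideal_uminus: "is_ideal I \<Longrightarrow> x \<in> I \<Longrightarrow> - x \<in> I"
  using ideal_mult_left[of I x "-1"] by simp

lemma ideal_diff: "is_ideal I \<Longrightarrow> x \<in> I \<Longrightarrow> y \<in> I \<Longrightarrow> x - y \<in> I"
  using ideal_add[of I x "-y"] ideal_uminus[of I y] by simp

lemma ideal_sum: "is_ideal I \<Longrightarrow> (\<And>x. x \<in> S \<Longrightarrow> g x \<in> I) \<Longrightarrow> sum g S \<in> I"
  by (induction S rule: infinite_finite_induct) (auto intro: ideal_0 ideal_add)

lemma ideal_dvd: "is_ideal I \<Longrightarrow> x \<in> I \<Longrightarrow> x dvd y \<Longrightarrow> y \<in> I"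
  by (auto simp: dvd_def intro: ideal_mult_right)

lemma ideal_cong: "is_ideal I \<Longrightarrow> x - y \<in> I \<Longrightarrow> x \<in> I \<longleftrightarrow> y \<in> I"
  using ideal_add[of I "x - y" y] ideal_diff[of I x "x - y"] by auto

lemma is_ideal_gen: "is_ideal (ideal_gen S)"
  unfolding is_ideal_def ideal_gen_def by (rule module.subspace_span[OF module_mult])

lemma ideal_gen_base: "x \<in> S \<Longrightarrow> x \<in> ideal_gen S"
  unfolding ideal_gen_def by (rule module.span_base[OF module_mult])

lemma ideal_gen_least: "is_ideal I \<Longrightarrow> S \<subseteq> I \<Longrightarrow> ideal_gen S \<subseteq> I"
  unfolding is_ideal_def ideal_gen_def by (rule module.span_minimal[OF module_mult])

lemma is_ideal_colon: "is_ideal I \<Longrightarrow> is_ideal {x. x * y \<in> I}"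
  by (auto simp: is_ideal_iff distrib_right mult.assoc)

lemma is_ideal_Inter: "(\<And>I. I \<in> S \<Longrightarrow> is_ideal I) \<Longrightarrow> is_ideal (\<Inter>S)"
  by (auto simp: is_ideal_iff)

definition rhom :: "('a::comm_ring_1 \<Rightarrow> 'b::comm_ring_1) \<Rightarrow> bool" where
  "rhom c \<longleftrightarrow> c 1 = 1 \<and> (\<forall>x y. c (x + y) = c x + c y) \<and> (\<forall>x y. c (x * y) = c x * c y)"

lemma rhom_1: "rhom c \<Longrightarrow> c 1 = 1"
  and rhom_add: "rhom c \<Longrightarrow> c (x + y) = c x + c y"
  and rhom_mult: "rhom c \<Longrightarrow> c (x * y) = c x * c y"
  by (auto simp: rhom_def)

lemma rhom_0: "rhom c \<Longrightarrow> c 0 = 0"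
  using rhom_add[of c 0 0] by simp

lemma rhom_uminus: "rhom c \<Longrightarrow> c (- x) = - c x"
  using rhom_add[of c x "-x"] rhom_0[of c] by (simp add: eq_neg_iff_add_eq_0 add.commute)

lemma rhom_diff: "rhom c \<Longrightarrow> c (x - y) = c x - c y"
  using rhom_add[of c x "-y"] rhom_uminus[of c y] by simp

lemma rhom_sum: "rhom c \<Longrightarrow> c (sum g S) = (\<Sum>x\<in>S. c (g x))"
  by (induction S rule: infinite_finite_induct) (auto simp: rhom_0 rhom_add)

lemma rhom_prod: "rhom c \<Longrightarrow> c (prod g S) = (\<Prod>x\<in>S. c (g x))"
  by (induction S rule: infinite_finite_induct) (auto simp: rhom_1 rhom_mult)

lemma rhom_power: "rhom c \<Longrightarrow> c (x ^ n) = c x ^ n"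
  by (induction n) (auto simp: rhom_1 rhom_mult)

lemma rhom_id: "rhom (\<lambda>x. x)"
  by (simp add: rhom_def)

lemma rhom_comp: "rhom f \<Longrightarrow> rhom g \<Longrightarrow> rhom (\<lambda>x. f (g x))"
  by (simp add: rhom_def)

lemma is_ideal_vimage: "rhom c \<Longrightarrow> is_ideal I \<Longrightarrow> is_ideal {x. c x \<in> I}"
  by (auto simp: is_ideal_iff rhom_0 rhom_add rhom_mult)

text \<open>Groups are sets of ring maps rather than of permutations, so that one existence theorem
  covers the trivial group, giving ordinary primes, and the stabilisers
  \<open>fixing W\<close>.\<close>

definition aut_group :: "('r::comm_ring_1 \<Rightarrow> 'r) set \<Rightarrow> bool" where
  "aut_group H \<longleftrightarrow> (\<lambda>x. x) \<in> H \<and> (\<forall>\<sigma>\<in>H. rhom \<sigma>) \<and> (\<forall>\<sigma>\<in>H. \<forall>\<tau>\<in>H. (\<lambda>x. \<sigma> (\<tau> x)) \<in> H) \<and>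
     (\<forall>\<sigma>\<in>H. \<exists>\<tau>\<in>H. \<forall>x. \<sigma> (\<tau> x) = x)"

definition inv_ideal :: "('r::comm_ring_1 \<Rightarrow> 'r) set \<Rightarrow> 'r set \<Rightarrow> bool" where
  "inv_ideal H Q \<longleftrightarrow> is_ideal Q \<and> (\<forall>\<sigma>\<in>H. \<forall>x\<in>Q. \<sigma> x \<in> Q)"

text \<open>For an automorphism group \<open>H\<close> this is the elementwise form of: a product of
  two \<open>H\<close>-stable ideals lies in \<open>Q\<close> only if one of them does.\<close>

definition equi_prime :: "('r::comm_ring_1 \<Rightarrow> 'r) set \<Rightarrow> 'r set \<Rightarrow> bool" where
  "equi_prime H Q \<longleftrightarrow> inv_ideal H Q \<and> 1 \<notin> Q \<and>
     (\<forall>x y. (\<forall>\<sigma>\<in>H. x * \<sigma> y \<in> Q) \<longrightarrow> x \<in> Q \<or> y \<in> Q)"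

lemma equi_prime_ideal: "equi_prime H Q \<Longrightarrow> is_ideal Q"
  and equi_prime_inv: "equi_prime H Q \<Longrightarrow> \<sigma> \<in> H \<Longrightarrow> x \<in> Q \<Longrightarrow> \<sigma> x \<in> Q"
  by (auto simp: equi_prime_def inv_ideal_def)

lemma equi_primeD:
  assumes "equi_prime H Q" "x \<notin> Q" "y \<notin> Q"
  shows "\<exists>\<sigma>\<in>H. x * \<sigma> y \<notin> Q"
  using assms by (auto simp: equi_prime_def)

lemma inv_ideal_gen_orbit:
  assumes "aut_group H" "inv_ideal H Q"
  shows "inv_ideal H (ideal_gen (Q \<union> {\<sigma> x |\<sigma>. \<sigma> \<in> H}))" (is "inv_ideal H (ideal_gen ?G)")
  unfolding inv_ideal_def
proof (intro conjI ballI)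
  fix \<sigma> y assume \<sigma>: "\<sigma> \<in> H" and y: "y \<in> ideal_gen ?G"
  have "is_ideal {y. \<sigma> y \<in> ideal_gen ?G}"
    using assms(1) \<sigma> is_ideal_gen by (intro is_ideal_vimage) (auto simp: aut_group_def)
  moreover have "\<sigma> z \<in> ?G" if "z \<in> ?G" for z
    using that assms \<sigma> unfolding inv_ideal_def aut_group_def by auto
  then have "?G \<subseteq> {y. \<sigma> y \<in> ideal_gen ?G}"
    using ideal_gen_base by blast
  ultimately show "\<sigma> y \<in> ideal_gen ?G"
    using ideal_gen_least y by blast
qed (rule is_ideal_gen)

text \<open>On generators, \<open>\<sigma> x * \<tau> y\<close> is \<open>\<sigma>\<close> applied
  to \<open>x * \<rho> (\<tau> y)\<close> with \<open>\<rho>\<close> inverse to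
  \<open>\<sigma>\<close>; two colon ideals extend this to the generated ideals.\<close>

lemma orbit_ideals_product:
  assumes H: "aut_group H" and Q: "inv_ideal H Q" and xy: "\<forall>\<sigma>\<in>H. x * \<sigma> y \<in> Q"
    and u: "u \<in> ideal_gen (Q \<union> {\<sigma> x |\<sigma>. \<sigma> \<in> H})"
    and v: "v \<in> ideal_gen (Q \<union> {\<sigma> y |\<sigma>. \<sigma> \<in> H})"
  shows "u * v \<in> Q"
proof -
  have I: "is_ideal Q"
    using Q by (simp add: inv_ideal_def)
  have gens: "a * b \<in> Q" if a: "a \<in> Q \<union> {\<sigma> x |\<sigma>. \<sigma> \<in> H}" and b: "b \<in> Q \<union> {\<sigma> y |\<sigma>. \<sigma> \<in> H}" for a b
  proof (cases "a \<in> Q \<or> b \<in> Q")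
    case True
    then show ?thesis
      using I ideal_mult_left ideal_mult_right by blast
  next
    case False
    then obtain \<sigma> \<tau> where ab: "a = \<sigma> x" "\<sigma> \<in> H" "b = \<tau> y" "\<tau> \<in> H"
      using a b by blast
    obtain \<rho> where \<rho>: "\<rho> \<in> H" "\<forall>z. \<sigma> (\<rho> z) = z"
      using H ab unfolding aut_group_def by blast
    have "(\<lambda>z. \<rho> (\<tau> z)) \<in> H"
      using H \<rho> ab unfolding aut_group_def by blast
    then have "x * \<rho> (\<tau> y) \<in> Q"
      using bspec[OF xy] by fast
    then have "\<sigma> (x * \<rho> (\<tau> y)) \<in> Q"
      using Q ab unfolding inv_ideal_def by blast
    moreover have "rhom \<sigma>"
      using H ab unfolding aut_group_def by blast
    ultimately show ?thesis
      using ab \<rho> by (simp add: rhom_mult)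
  qed
  have "u * b \<in> Q" if "b \<in> Q \<union> {\<sigma> y |\<sigma>. \<sigma> \<in> H}" for b
    using ideal_gen_least[OF is_ideal_colon[OF I, of b]] gens[OF _ that] u by blast
  then have "Q \<union> {\<sigma> y |\<sigma>. \<sigma> \<in> H} \<subseteq> {b. b * u \<in> Q}"
    by (metis (no_types, lifting) mem_Collect_eq mult.commute subsetI)
  then show ?thesis
    using ideal_gen_least[OF is_ideal_colon[OF I, of u]] v by (metis (no_types, lifting) mem_Collect_eq mult.commute subsetD)
qed

text \<open>The analogue of avoiding a multiplicative set, with elements replaced by sets
  \<open>X\<close> that must not be swallowed. \<open>mul\<close> makes a maximal avoiding ideal
  prime. \<open>fin\<close> lets the union of a chain avoid \<open>X\<close>: although
  \<open>X\<close> may be infinite, a finite part of it decides whether an invariant ideal contains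
  it.\<close>

lemma exists_equi_prime:
  fixes H :: "('r::comm_ring_1 \<Rightarrow> 'r) set" and XX :: "'r set set"
  assumes H: "aut_group H" and Q0: "inv_ideal H Q0"
    and ne: "XX \<noteq> {}"
    and avoid: "\<And>X. X \<in> XX \<Longrightarrow> \<not> X \<subseteq> Q0"
    and fin: "\<And>X. X \<in> XX \<Longrightarrow> \<exists>F. finite F \<and> F \<subseteq> X \<and> (\<forall>K. inv_ideal H K \<longrightarrow> F \<subseteq> K \<longrightarrow> X \<subseteq> K)"
    and mul: "\<And>X Y. X \<in> XX \<Longrightarrow> Y \<in> XX \<Longrightarrow> \<exists>Z\<in>XX. Z \<subseteq> {x * y |x y. x \<in> X \<and> y \<in> Y}"
  shows "\<exists>Q. equi_prime H Q \<and> Q0 \<subseteq> Q \<and> (\<forall>X\<in>XX. \<not> X \<subseteq> Q)"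
proof -
  define A where "A = {K. inv_ideal H K \<and> Q0 \<subseteq> K \<and> (\<forall>X\<in>XX. \<not> X \<subseteq> K)}"
  have "\<exists>M\<in>A. \<forall>X\<in>A. M \<subseteq> X \<longrightarrow> X = M"
  proof (rule subset_Zorn_nonempty)
    show "A \<noteq> {}"
      using Q0 avoid by (auto simp: A_def)
  next
    fix C assume C: "C \<noteq> {}" "subset.chain A C"
    have sub: "C \<subseteq> A" and tot: "\<And>X Y. X \<in> C \<Longrightarrow> Y \<in> C \<Longrightarrow> X \<subseteq> Y \<or> Y \<subseteq> X"
      using C by (auto simp: subset_chain_def)
    have inv: "inv_ideal H X" if "X \<in> C" for X
      using that sub by (auto simp: A_def)
    have "inv_ideal H (\<Union>C)"
      unfolding inv_ideal_def is_ideal_iff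
    proof (intro conjI ballI allI)
      obtain X where "X \<in> C"
        using C(1) by blast
      then show "0 \<in> \<Union>C"
        using ideal_0[of X] inv[of X] by (auto simp: inv_ideal_def)
    next
      fix x y assume "x \<in> \<Union>C" "y \<in> \<Union>C"
      then obtain X Y where "x \<in> X" "y \<in> Y" "X \<in> C" "Y \<in> C" by auto
      then obtain Z where "x \<in> Z" "y \<in> Z" "Z \<in> C"
        using tot[of X Y] by blast
      then show "x + y \<in> \<Union>C"
        using ideal_add[of Z x y] inv[of Z] by (auto simp: inv_ideal_def)
    next
      fix r x assume "x \<in> \<Union>C"
      then obtain X where "x \<in> X" "X \<in> C" by auto
      then show "r * x \<in> \<Union>C"
        using ideal_mult_left[of X x r] inv[of X] by (auto simp: inv_ideal_def)
    next
      fix \<sigma> x assume "\<sigma> \<in> H" "x \<in> \<Union>C"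
      then obtain X where "x \<in> X" "X \<in> C" by auto
      then show "\<sigma> x \<in> \<Union>C"
        using \<open>\<sigma> \<in> H\<close> inv[of X] by (auto simp: inv_ideal_def)
    qed
    moreover have "Q0 \<subseteq> \<Union>C"
      using C(1) sub by (auto simp: A_def)
    moreover have "\<not> X \<subseteq> \<Union>C" if X: "X \<in> XX" for X
    proof
      assume XC: "X \<subseteq> \<Union>C"
      obtain F where F: "finite F" "F \<subseteq> X" "\<forall>K. inv_ideal H K \<longrightarrow> F \<subseteq> K \<longrightarrow> X \<subseteq> K"
        using fin[OF X] by blast
      obtain B where "B \<in> C" "F \<subseteq> B"
        using finite_subset_Union_chain[OF F(1) _ C] F(2) XC by blast
      then have "X \<subseteq> B"
        using F(3) inv by blast
      then show False
        using sub \<open>B \<in> C\<close> X by (auto simp: A_def)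
    qed
    ultimately show "\<Union>C \<in> A"
      by (auto simp: A_def)
  qed
  then obtain Q where Q: "Q \<in> A" and max: "\<And>K. K \<in> A \<Longrightarrow> Q \<subseteq> K \<Longrightarrow> K = Q"
    by blast
  have inv: "inv_ideal H Q" and "Q0 \<subseteq> Q" and av: "\<And>X. X \<in> XX \<Longrightarrow> \<not> X \<subseteq> Q"
    using Q by (auto simp: A_def)
  have I: "is_ideal Q"
    using inv by (simp add: inv_ideal_def)
  have bad: "\<exists>X\<in>XX. X \<subseteq> ideal_gen (Q \<union> {\<sigma> x |\<sigma>. \<sigma> \<in> H})" if "x \<notin> Q" for x
  proof (rule ccontr)
    let ?K = "ideal_gen (Q \<union> {\<sigma> x |\<sigma>. \<sigma> \<in> H})"
    assume "\<not> ?thesis"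
    moreover have QK: "Q \<subseteq> ?K"
      using ideal_gen_base by blast
    ultimately have "?K \<in> A"
      using inv_ideal_gen_orbit[OF H inv] \<open>Q0 \<subseteq> Q\<close> by (auto simp: A_def)
    then have "?K = Q"
      using max QK by blast
    moreover have "x \<in> ?K"
      using H by (intro ideal_gen_base UnI2 CollectI exI[of _ "\<lambda>x. x"]) (simp add: aut_group_def)
    ultimately show False
      using that by blast
  qed
  have "equi_prime H Q"
    unfolding equi_prime_def
  proof (intro conjI allI impI inv)
    obtain X where "X \<in> XX" using ne by blast
    then obtain x where "x \<notin> Q"
      using av by blast
    then show "1 \<notin> Q"
      using ideal_mult_left[OF I, of 1 x] by auto
  next
    fix x y assume xy: "\<forall>\<sigma>\<in>H. x * \<sigma> y \<in> Q"
    show "x \<in> Q \<or> y \<in> Q"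
    proof (rule ccontr)
      assume "\<not> (x \<in> Q \<or> y \<in> Q)"
      then have n: "x \<notin> Q" "y \<notin> Q"
        by auto
      obtain X where X: "X \<in> XX" "X \<subseteq> ideal_gen (Q \<union> {\<sigma> x |\<sigma>. \<sigma> \<in> H})"
        using bad[OF n(1)] by (rule bexE)
      obtain Y where Y: "Y \<in> XX" "Y \<subseteq> ideal_gen (Q \<union> {\<sigma> y |\<sigma>. \<sigma> \<in> H})"
        using bad[OF n(2)] by (rule bexE)
      obtain Z where Z: "Z \<in> XX" "Z \<subseteq> {x * y |x y. x \<in> X \<and> y \<in> Y}"
        using mul[OF X(1) Y(1)] by (rule bexE)
      have "Z \<subseteq> Q"
      proof
        fix z assume "z \<in> Z"
        then obtain a b where "z = a * b" "a \<in> X" "b \<in> Y"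
          using Z(2) by blast
        then show "z \<in> Q"
          using orbit_ideals_product[OF H inv xy subsetD[OF X(2)] subsetD[OF Y(2)]] by simp
      qed
      then show False
        using av Z(1) by blast
    qed
  qed
  then show ?thesis
    using \<open>Q0 \<subseteq> Q\<close> av by blast
qed

text \<open>The trivial group and the singletons \<open>{x ^ n}\<close> turn
  \<open>exists_equi_prime\<close> into the classical description of the nilradical.\<close>

lemma nilpotent_if_in_all_primes:
  fixes x :: "'r::comm_ring_1"
  assumes "\<And>P. is_prime_ideal P \<Longrightarrow> x \<in> P"
  shows "\<exists>n. x ^ n = 0"
proof (rule ccontr)
  assume no: "\<nexists>n. x ^ n = 0"
  let ?H = "{\<lambda>x::'r. x}"
  have H: "aut_group ?H"
    by (auto simp: aut_group_def rhom_id)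
  have "\<exists>Q. equi_prime ?H Q \<and> {0} \<subseteq> Q \<and> (\<forall>X\<in>{{x ^ n} |n. True}. \<not> X \<subseteq> Q)"
  proof (rule exists_equi_prime[OF H])
    show "inv_ideal ?H {0}"
      by (auto simp: inv_ideal_def is_ideal_iff)
    show "\<not> X \<subseteq> {0}" if "X \<in> {{x ^ n} |n. True}" for X
      using that no by auto
    show "\<exists>F. finite F \<and> F \<subseteq> X \<and> (\<forall>K. inv_ideal ?H K \<longrightarrow> F \<subseteq> K \<longrightarrow> X \<subseteq> K)"
      if "X \<in> {{x ^ n} |n. True}" for X
      using that by (intro exI[of _ X]) auto
    show "\<exists>Z\<in>{{x ^ n} |n. True}. Z \<subseteq> {x * y |x y. x \<in> X \<and> y \<in> Y}"
      if XY: "X \<in> {{x ^ n} |n. True}" "Y \<in> {{x ^ n} |n. True}" for X Y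
    proof -
      obtain m n where "X = {x ^ m}" "Y = {x ^ n}"
        using XY by auto
      then show ?thesis
        by (intro bexI[of _ "{x ^ (m + n)}"]) (auto simp: power_add intro!: exI[of _ "m + n"])
    qed
  qed auto
  then obtain Q where Q: "equi_prime ?H Q" "\<forall>X\<in>{{x ^ n} |n. True}. \<not> X \<subseteq> Q"
    by (elim exE conjE)
  then have "is_prime_ideal Q"
    unfolding is_prime_ideal_def equi_prime_def inv_ideal_def by blast
  then have "x \<in> Q"
    by (rule assms)
  moreover have "{x} \<in> {{x ^ n} |n. True}"
    by (auto intro!: exI[of _ 1])
  ultimately show False
    using Q(2) by blast
qed

section \<open>Polynomial rings\<close>

abbreviation (input) "lkp \<equiv> Poly_Mapping.lookup"
abbreviation (input) "kys \<equiv> Poly_Mapping.keys"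

lemma Const_0: "Const 0 = 0" and Const_1: "Const 1 = 1"
  and Const_add: "Const (a + b :: 'a::comm_ring_1) = Const a + Const b"
  and Const_mult: "Const (a * b :: 'a::comm_ring_1) = Const a * Const b"
  by (simp_all add: Const_def single_add mult_single)

lemma rhom_Const: "rhom (Const :: 'a::comm_ring_1 \<Rightarrow> ('x, 'a) mpoly)"
  by (simp add: rhom_def Const_1 Const_add Const_mult)

definition mono_val :: "('x \<Rightarrow> 'b::comm_ring_1) \<Rightarrow> ('x \<Rightarrow>\<^sub>0 nat) \<Rightarrow> 'b" where
  "mono_val v m = (\<Prod>x\<in>kys m. v x ^ lkp m x)"

lemma mono_val_superset:
  "finite T \<Longrightarrow> kys m \<subseteq> T \<Longrightarrow> mono_val v m = (\<Prod>x\<in>T. v x ^ lkp m x)"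
  unfolding mono_val_def by (rule prod.mono_neutral_left) (auto simp: in_keys_iff)

lemma mono_val_add: "mono_val v (m + m') = mono_val v m * mono_val v m'"
proof -
  let ?T = "kys m \<union> kys m'"
  have "kys (m + m') \<subseteq> ?T"
    by (rule keys_add)
  then show ?thesis
    by (simp add: mono_val_superset[of ?T] lookup_add power_add prod.distrib)
qed

lemma mono_val_0 [simp]: "mono_val v 0 = 1"
  by (simp add: mono_val_def)

lemma mono_val_single: "mono_val v (Poly_Mapping.single x k) = v x ^ k"
  by (cases "k = 0") (simp_all add: mono_val_def)

lemma poly_hom_superset:
  assumes "c 0 = 0" "finite S" "kys p \<subseteq> S"
  shows "poly_hom c v p = (\<Sum>m\<in>S. c (lkp p m) * mono_val v m)"
  unfolding poly_hom_def mono_val_def[symmetric] using assms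
  by (intro sum.mono_neutral_left) (auto simp: in_keys_iff)

lemma poly_hom_single:
  assumes "rhom c" shows "poly_hom c v (Poly_Mapping.single m a) = c a * mono_val v m"
  using assms by (subst poly_hom_superset[of c "{m}"]) (auto simp: rhom_0)

lemma poly_hom_add:
  assumes "rhom c" shows "poly_hom c v (p + q) = poly_hom c v p + poly_hom c v q"
proof -
  have "kys (p + q) \<subseteq> kys p \<union> kys q"
    by (rule keys_add)
  then show ?thesis
    using assms by (simp add: poly_hom_superset[of c "kys p \<union> kys q"] rhom_0 rhom_add lookup_add
        distrib_right sum.distrib)
qed

lemma mpoly_sum_singles: "p = (\<Sum>m\<in>kys p. Poly_Mapping.single m (lkp p m))"
  by (rule poly_mapping_eqI) (auto simp: lookup_sum lookup_single when_def in_keys_iff)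

lemma mpoly_induct_single:
  assumes "\<And>m a. P (Poly_Mapping.single m a)" "\<And>p q. P p \<Longrightarrow> P q \<Longrightarrow> P (p + q)"
  shows "P (p :: ('x, 'a::comm_ring_1) mpoly)"
proof -
  have "P 0"
    using assms(1)[of 0 0] by simp
  then have "P (\<Sum>m\<in>S. Poly_Mapping.single m (lkp p m))" for S
    by (induction S rule: infinite_finite_induct) (auto intro: assms)
  then show ?thesis
    using mpoly_sum_singles[of p] by metis
qed

lemma rhom_poly_hom:
  fixes c :: "'a::comm_ring_1 \<Rightarrow> 'b::comm_ring_1"
  assumes c: "rhom c" shows "rhom (poly_hom c v)"
  unfolding rhom_def
proof (intro conjI allI)
  show "poly_hom c v 1 = 1"
    using poly_hom_single[OF c, of v 0 1] c by (simp add: rhom_1)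
  show "poly_hom c v (p + q) = poly_hom c v p + poly_hom c v q" for p q
    by (rule poly_hom_add[OF c])
  show "poly_hom c v (p * q) = poly_hom c v p * poly_hom c v q" for p q
  proof (induction p rule: mpoly_induct_single)
    case (1 m a)
    show ?case
    proof (induction q rule: mpoly_induct_single)
      case (1 m' a')
      then show ?case
        using c by (simp add: mult_single poly_hom_single rhom_mult mono_val_add mult_ac)
    qed (simp add: distrib_left poly_hom_add[OF c])
  qed (simp add: distrib_right poly_hom_add[OF c])
qed

lemma poly_hom_Const: "rhom c \<Longrightarrow> poly_hom c v (Const a) = c a"
  by (simp add: Const_def poly_hom_single)

lemma poly_hom_Var: "rhom c \<Longrightarrow> poly_hom c v (Var x) = v x"
  by (simp add: Var_def poly_hom_single rhom_1 mono_val_single)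

lemma single_eq_mono_val:
  fixes m :: "'x \<Rightarrow>\<^sub>0 nat"
  shows "Poly_Mapping.single m (a :: 'a::comm_ring_1) = Const a * mono_val Var m"
proof -
  have "Var x ^ k = (Poly_Mapping.single (Poly_Mapping.single x k) 1 :: ('x, 'a) mpoly)" for x :: 'x and k
    by (induction k) (simp_all add: Var_def mult_single single_add[symmetric])
  moreover have "(\<Prod>x\<in>S. Poly_Mapping.single (g x) (1::'a)) = Poly_Mapping.single (sum g S) 1"
    for g :: "'x \<Rightarrow> 'x \<Rightarrow>\<^sub>0 nat" and S
    by (induction S rule: infinite_finite_induct) (simp_all add: mult_single)
  moreover have "(\<Sum>x\<in>kys m. Poly_Mapping.single x (lkp m x)) = m"
    by (rule poly_mapping_eqI) (auto simp: lookup_sum lookup_single when_def in_keys_iff)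
  ultimately show ?thesis
    by (simp add: mono_val_def Const_def mult_single)
qed

lemma mpoly_induct:
  assumes C: "\<And>a. P (Const a)" and V: "\<And>x. P (Var x)"
    and A: "\<And>p q. P p \<Longrightarrow> P q \<Longrightarrow> P (p + q)" and M: "\<And>p q. P p \<Longrightarrow> P q \<Longrightarrow> P (p * q)"
  shows "P (p :: ('x, 'a::comm_ring_1) mpoly)"
proof (induction p rule: mpoly_induct_single)
  case (1 m a)
  have 1: "P 1"
    using C[of 1] by (simp add: Const_1)
  then have "P (Var x ^ k)" for x k
    by (induction k) (auto intro: V M)
  with 1 have "P (\<Prod>x\<in>S. Var x ^ lkp m x)" for S
    by (induction S rule: infinite_finite_induct) (auto intro: M)
  then show ?case
    by (simp add: single_eq_mono_val mono_val_def C M)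
qed (rule A)

lemma rhom_eqI:
  fixes F G :: "('x, 'a::comm_ring_1) mpoly \<Rightarrow> 'b::comm_ring_1"
  assumes "rhom F" "rhom G" "\<And>a. F (Const a) = G (Const a)" "\<And>x. F (Var x) = G (Var x)"
  shows "F p = G p"
  by (induction p rule: mpoly_induct) (simp_all add: assms rhom_add[OF assms(1)]
      rhom_add[OF assms(2)] rhom_mult[OF assms(1)] rhom_mult[OF assms(2)])

definition vars :: "('x, 'a::zero) mpoly \<Rightarrow> 'x set" where
  "vars p = (\<Union>m\<in>kys p. kys m)"

lemma finite_vars [simp]: "finite (vars p)"
  by (simp add: vars_def)

lemma poly_hom_cong:
  assumes "\<And>x. x \<in> vars p \<Longrightarrow> v x = v' x"
  shows "poly_hom c v p = poly_hom c v' p"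
  unfolding poly_hom_def
  by (intro sum.cong arg_cong2[of _ _ _ _ "(*)"] prod.cong arg_cong2[of _ _ _ _ "(^)"] refl)
    (use assms in \<open>auto simp: vars_def\<close>)

lemma rhom_act: "rhom (act \<sigma>)"
  unfolding act_def by (rule rhom_poly_hom[OF rhom_Const])

lemma act_Const [simp]: "act \<sigma> (Const a) = Const a"
  and act_Var [simp]: "act \<sigma> (Var i) = Var (\<sigma> i)"
  unfolding act_def by (simp_all add: poly_hom_Const poly_hom_Var rhom_Const)

lemma act_1 [simp]: "act \<sigma> 1 = 1"
  and act_0 [simp]: "act \<sigma> 0 = 0"
  and act_add [simp]: "act \<sigma> (p + q) = act \<sigma> p + act \<sigma> q"
  and act_diff [simp]: "act \<sigma> (p - q) = act \<sigma> p - act \<sigma> q"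
  and act_mult [simp]: "act \<sigma> (p * q) = act \<sigma> p * act \<sigma> q"
  and act_power [simp]: "act \<sigma> (p ^ n) = act \<sigma> p ^ n"
  and act_prod [simp]: "act \<sigma> (prod g S) = (\<Prod>x\<in>S. act \<sigma> (g x))"
  by (rule rhom_1 rhom_0 rhom_add rhom_diff rhom_mult rhom_power rhom_prod, rule rhom_act)+

lemma act_act: "act \<sigma> (act \<tau> p) = act (\<sigma> \<circ> \<tau>) p"
  by (rule rhom_eqI) (auto intro: rhom_comp rhom_act)

lemma act_id: "act id p = p"
  by (rule rhom_eqI[of "act id" "\<lambda>x. x"]) (auto intro: rhom_id rhom_act)

lemma act_cong: "(\<And>i. i \<in> vars p \<Longrightarrow> \<sigma> i = \<tau> i) \<Longrightarrow> act \<sigma> p = act \<tau> p"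
  unfolding act_def by (rule poly_hom_cong) simp

section \<open>Finitary permutations and pointwise stabilisers\<close>

lemma Sym_inf_id: "id \<in> Sym_inf"
  by (auto simp: Sym_inf_def permutes_id)

lemma Sym_inf_permutesI: "finite A \<Longrightarrow> \<sigma> permutes A \<Longrightarrow> \<sigma> \<in> Sym_inf"
proof -
  assume "finite A" "\<sigma> permutes A"
  then obtain n where "\<forall>i\<in>A. i < n"
    using finite_nat_set_iff_bounded by blast
  then have "A \<subseteq> {..<n}"
    by blast
  with \<open>\<sigma> permutes A\<close> have "\<sigma> permutes {..<n}"
    by (rule permutes_subset)
  then show ?thesis
    by (auto simp: Sym_inf_def)
qed

lemma Sym_inf_comp: "\<sigma> \<in> Sym_inf \<Longrightarrow> \<tau> \<in> Sym_inf \<Longrightarrow> \<sigma> \<circ> \<tau> \<in> Sym_inf"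
proof -
  assume "\<sigma> \<in> Sym_inf" "\<tau> \<in> Sym_inf"
  then obtain m n where "\<sigma> permutes {..<m}" "\<tau> permutes {..<n}"
    by (auto simp: Sym_inf_def)
  then have "\<sigma> permutes {..<max m n}" "\<tau> permutes {..<max m n}"
    by (auto elim: permutes_subset)
  then show ?thesis
    using permutes_compose by (auto simp: Sym_inf_def)
qed

lemma Sym_inf_inv: "\<sigma> \<in> Sym_inf \<Longrightarrow> inv \<sigma> \<in> Sym_inf"
  using permutes_inv by (auto simp: Sym_inf_def)

lemma Sym_inf_bij: "\<sigma> \<in> Sym_inf \<Longrightarrow> bij \<sigma>"
  using permutes_bij by (auto simp: Sym_inf_def)

lemma Sym_inf_inj: "\<sigma> \<in> Sym_inf \<Longrightarrow> inj \<sigma>"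
  using Sym_inf_bij bij_is_inj by blast

lemma Sym_inf_extend:
  assumes T: "finite T" and f: "inj_on f T"
  shows "\<exists>\<sigma>\<in>Sym_inf. \<forall>i\<in>T. \<sigma> i = f i"
proof -
  define A where "A = T \<union> f ` T"
  have A: "finite A"
    using T by (simp add: A_def)
  have "card (A - T) = card (A - f ` T)"
    using T f by (subst (1 2) card_Diff_subset) (auto simp: A_def card_image)
  then obtain g where g: "bij_betw g (A - T) (A - f ` T)"
    using A finite_same_card_bij by blast
  define \<sigma> where "\<sigma> i = (if i \<in> T then f i else if i \<in> A then g i else i)" for i
  have "bij_betw \<sigma> (T \<union> (A - T)) (f ` T \<union> (A - f ` T))"
  proof (rule bij_betw_combine)
    show "bij_betw \<sigma> T (f ` T)"
      using f by (auto simp: bij_betw_def \<sigma>_def inj_on_def)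
    show "bij_betw \<sigma> (A - T) (A - f ` T)"
      using g by (rule bij_betw_cong[THEN iffD1, rotated]) (auto simp: \<sigma>_def)
  qed auto
  moreover have "T \<union> (A - T) = A" "f ` T \<union> (A - f ` T) = A"
    by (auto simp: A_def)
  ultimately have "\<sigma> permutes A"
    by (intro bij_imp_permutes) (auto simp: \<sigma>_def A_def)
  then have "\<sigma> \<in> Sym_inf"
    using A by (rule Sym_inf_permutesI[rotated])
  then show ?thesis
    by (intro bexI[of _ \<sigma>]) (auto simp: \<sigma>_def)
qed

text \<open>The stabiliser consists of the induced maps on polynomials, so that it is an
  \<open>aut_group\<close>; \<open>fixing {}\<close> is the full group.\<close>

definition fixing :: "nat set \<Rightarrow> ('a::comm_ring_1 R \<Rightarrow> 'a R) set" where
  "fixing W = {act \<sigma> |\<sigma>. \<sigma> \<in> Sym_inf \<and> (\<forall>w\<in>W. \<sigma> w = w)}"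

lemma fixingE:
  assumes "s \<in> fixing W"
  obtains \<sigma> where "s = act \<sigma>" "\<sigma> \<in> Sym_inf" "\<And>w. w \<in> W \<Longrightarrow> \<sigma> w = w"
  using assms by (auto simp: fixing_def)

lemma fixingI: "\<sigma> \<in> Sym_inf \<Longrightarrow> (\<And>w. w \<in> W \<Longrightarrow> \<sigma> w = w) \<Longrightarrow> act \<sigma> \<in> fixing W"
  by (auto simp: fixing_def)

lemma fixing_mono: "W \<subseteq> W' \<Longrightarrow> fixing W' \<subseteq> fixing W"
  by (auto simp: fixing_def)

lemma aut_group_fixing: "aut_group (fixing W :: ('a::comm_ring_1 R \<Rightarrow> 'a R) set)"
  unfolding aut_group_def
proof (intro conjI ballI)
  have "(\<lambda>x. x) = (act id :: 'a R \<Rightarrow> 'a R)"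
    by (auto simp: act_id)
  then show "(\<lambda>x. x) \<in> (fixing W :: ('a R \<Rightarrow> 'a R) set)"
    by (auto simp: intro!: fixingI Sym_inf_id)
  fix s :: "'a R \<Rightarrow> 'a R" assume "s \<in> fixing W"
  then obtain \<sigma> where \<sigma>: "s = act \<sigma>" "\<sigma> \<in> Sym_inf" "\<And>w. w \<in> W \<Longrightarrow> \<sigma> w = w"
    by (rule fixingE) blast
  show "rhom s"
    by (simp add: \<sigma> rhom_act)
  have b: "bij \<sigma>"
    using \<sigma> by (simp add: Sym_inf_bij)
  have "act (inv \<sigma>) \<in> fixing W"
    using \<sigma> b by (intro fixingI Sym_inf_inv) (auto simp: bij_is_inj inv_f_eq)
  moreover have "s (act (inv \<sigma>) x) = x" for x
    using b by (simp add: \<sigma> act_act surj_iff[THEN iffD1, OF bij_is_surj] act_id)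
  ultimately show "\<exists>\<tau>\<in>fixing W. \<forall>x. s (\<tau> x) = x"
    by blast
  fix t :: "'a R \<Rightarrow> 'a R" assume "t \<in> fixing W"
  then obtain \<tau> where \<tau>: "t = act \<tau>" "\<tau> \<in> Sym_inf" "\<And>w. w \<in> W \<Longrightarrow> \<tau> w = w"
    by (rule fixingE) blast
  have "(\<lambda>x. s (t x)) = act (\<sigma> \<circ> \<tau>)"
    by (auto simp: \<sigma> \<tau> act_act)
  then show "(\<lambda>x. s (t x)) \<in> fixing W"
    using \<sigma> \<tau> by (auto intro!: fixingI Sym_inf_comp)
qed

lemma is_S_ideal_iff: "is_S_ideal J \<longleftrightarrow> inv_ideal (fixing {}) J"
  by (auto simp: is_S_ideal_def inv_ideal_def fixing_def)

section \<open>Vandermonde products modulo powers\<close>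

text \<open>The points form an arbitrary family in any ring, because the product is also taken over
  images under \<open>iota\<close> and over nilpotent differences.\<close>

definition vand :: "(nat \<Rightarrow> 'r::comm_ring_1) \<Rightarrow> nat set \<Rightarrow> 'r" where
  "vand x S = (\<Prod>(i, j)\<in>{(i, j). i \<in> S \<and> j \<in> S \<and> i < j}. x i - x j)"

lemma Delta_eq_vand: "Delta S = vand Var S"
  by (simp add: Delta_def vand_def)

lemma vand_empty [simp]: "vand x {} = 1"
  by (simp add: vand_def)

lemma finite_pairs [simp]: "finite S \<Longrightarrow> finite {(i :: nat, j). i \<in> S \<and> j \<in> S \<and> i < j}"
  by (rule finite_subset[of _ "S \<times> S"]) auto

text \<open>A sign is only known to exist, which is enough since ideal membership does not see
  it.\<close>

lemma prod_signs:
  fixes a :: "'b \<Rightarrow> 'r::comm_ring_1"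
  assumes "\<And>j. j \<in> S \<Longrightarrow> b j = a j \<or> b j = - a j"
  shows "\<exists>s. (s = 1 \<or> s = -1) \<and> (\<Prod>j\<in>S. b j) = s * (\<Prod>j\<in>S. a j)"
  using assms
proof (induction S rule: infinite_finite_induct)
  case (insert j S)
  obtain s where s: "s = 1 \<or> s = -1" "(\<Prod>j\<in>S. b j) = s * (\<Prod>j\<in>S. a j)"
    using insert by auto
  obtain t where t: "t = 1 \<or> t = -1" "b j = t * a j"
    using insert.prems[of j] by fastforce
  have "(\<Prod>j\<in>insert j S. b j) = (t * s) * (\<Prod>j\<in>insert j S. a j)"
    using insert.hyps by (simp add: s(2) t(2) mult_ac)
  moreover have "t * s = 1 \<or> t * s = -1"
    using s(1) t(1) by auto
  ultimately show ?case
    by blast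
qed auto

text \<open>Factors are oriented by the order of the indices, so writing those of the new index with
  \<open>x i\<close> first costs a sign.\<close>

lemma vand_insert:
  assumes "finite S" "i \<notin> S"
  shows "\<exists>s. (s = 1 \<or> s = -1) \<and> vand x (insert i S) = s * (\<Prod>j\<in>S. x i - x j) * vand x S"
proof -
  let ?P = "{(k, j). k \<in> S \<and> j \<in> S \<and> k < j}"
  define f where "f j = (if i < j then (i, j) else (j, i))" for j
  define F where "F = (\<lambda>(i, j). x i - x j)"
  have un: "{(k, j). k \<in> insert i S \<and> j \<in> insert i S \<and> k < j} = f ` S \<union> ?P"
    using assms by (auto simp: f_def image_iff) (metis less_irrefl linorder_neqE)
  have disj: "f ` S \<inter> ?P = {}"
    using assms by (auto simp: f_def)
  have inj: "inj_on f S"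
    using assms by (auto simp: f_def inj_on_def split: if_splits)
  have "vand x (insert i S) = prod F (f ` S) * prod F ?P"
    unfolding vand_def un F_def[symmetric] using assms disj by (intro prod.union_disjoint) auto
  also have "prod F (f ` S) = (\<Prod>j\<in>S. F (f j))"
    using prod.reindex[OF inj, of F] by (simp add: o_def)
  finally have "vand x (insert i S) = (\<Prod>j\<in>S. F (f j)) * vand x S"
    by (simp add: vand_def F_def)
  moreover have "\<exists>s. (s = 1 \<or> s = -1) \<and> (\<Prod>j\<in>S. F (f j)) = s * (\<Prod>j\<in>S. x i - x j)"
    by (rule prod_signs) (auto simp: F_def f_def)
  ultimately show ?thesis
    by (metis (no_types))
qed

text \<open>The complete homogeneous symmetric polynomials; their divided differences (\<open>hsym_diff\<close> below) make the
  induction for \<open>vandl_hsym_in_ideal\<close> work.\<close>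

fun hsym :: "nat \<Rightarrow> 'r::comm_ring_1 list \<Rightarrow> 'r" where
  "hsym 0 xs = 1"
| "hsym (Suc k) [] = 0"
| "hsym (Suc k) (x # xs) = hsym (Suc k) xs + x * hsym k (x # xs)"

fun vandl :: "'r::comm_ring_1 list \<Rightarrow> 'r" where
  "vandl [] = 1"
| "vandl (x # xs) = (\<Prod>y\<leftarrow>xs. x - y) * vandl xs"

text \<open>The recursion of \<open>hsym\<close> removes the first entry; this is the same recursion
  at the second entry, and stands in for the symmetry of these polynomials.\<close>

lemma hsym_swap: "hsym (Suc k) (a # b # M) = hsym (Suc k) (a # M) + b * hsym k (a # b # M)"
proof (induction k)
  case (Suc k)
  have "hsym (Suc (Suc k)) (a # b # M) =
      hsym (Suc (Suc k)) M + b * hsym (Suc k) (b # M) + a * hsym (Suc k) (a # b # M)"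
    by simp
  also have "\<dots> = hsym (Suc (Suc k)) M + a * hsym (Suc k) (a # M)
      + b * (hsym (Suc k) (b # M) + a * hsym k (a # b # M))"
    unfolding Suc.IH by (simp add: algebra_simps)
  also have "hsym (Suc k) (b # M) + a * hsym k (a # b # M) = hsym (Suc k) (a # b # M)"
    by simp
  finally show ?case
    by simp
qed (simp add: algebra_simps)

lemma hsym_diff: "(a - b) * hsym k (a # b # M) = hsym (Suc k) (a # M) - hsym (Suc k) (b # M)"
proof -
  have "hsym (Suc k) (b # M) + a * hsym k (a # b # M) = hsym (Suc k) (a # M) + b * hsym k (a # b # M)"
    using hsym_swap[of k a b M] by simp
  then show ?thesis
    by (simp add: algebra_simps)
qed

text \<open>The case \<open>k = 0\<close> is the goal, but the induction trades one point for one
  degree: by \<open>hsym_diff\<close>, the factor \<open>a - b\<close> splits the expression into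
  those for \<open>a # M\<close> and \<open>b # M\<close> with \<open>Suc k\<close>. For a single
  point the expression is a pure power.\<close>

lemma vandl_hsym_in_ideal:
  assumes I: "is_ideal I"
  shows "length xs = Suc n \<Longrightarrow> (\<And>x. x \<in> set xs \<Longrightarrow> x ^ (k + n) \<in> I) \<Longrightarrow> vandl xs * hsym k xs \<in> I"
proof (induction n arbitrary: xs k)
  case 0
  then obtain x where xs: "xs = [x]"
    by (auto simp: length_Suc_conv)
  have "hsym j [x] = x ^ j" for j
    by (induction j) auto
  then show ?case
    using 0 xs by auto
next
  case (Suc n)
  then obtain a b M where xs: "xs = a # b # M"
    by (auto simp: length_Suc_conv)
  let ?p = "\<lambda>a. (\<Prod>y\<leftarrow>M. a - y)"
  have "vandl xs * hsym k xs = ?p a * ?p b * vandl M * ((a - b) * hsym k (a # b # M))"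
    by (simp add: xs mult_ac)
  also have "\<dots> = ?p b * (vandl (a # M) * hsym (Suc k) (a # M))
      - ?p a * (vandl (b # M) * hsym (Suc k) (b # M))"
    unfolding hsym_diff vandl.simps by (simp only: right_diff_distrib mult_ac)
  also have "\<dots> \<in> I"
  proof (rule ideal_diff[OF I]; rule ideal_mult_left[OF I])
    show "vandl (a # M) * hsym (Suc k) (a # M) \<in> I"
      using Suc.prems(1) Suc.prems(2)[unfolded xs] by (intro Suc.IH) (auto simp: xs)
    show "vandl (b # M) * hsym (Suc k) (b # M) \<in> I"
      using Suc.prems(1) Suc.prems(2)[unfolded xs] by (intro Suc.IH) (auto simp: xs)
  qed
  finally show ?case .
qed

lemma vand_vandl:
  assumes "finite S"
  shows "\<exists>s js. vand x S = s * vandl (map x js) \<and> distinct js \<and> set js = S"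
  using assms
proof (induction S rule: finite_induct)
  case empty
  then show ?case
    by (auto intro!: exI[of _ 1] exI[of _ "[]"])
next
  case (insert i S)
  then obtain s js where IH: "vand x S = s * vandl (map x js)" "distinct js" "set js = S"
    by blast
  obtain s' where s': "vand x (insert i S) = s' * (\<Prod>j\<in>S. x i - x j) * vand x S"
    using vand_insert[of S i x] insert.hyps by blast
  have "(\<Prod>j\<in>S. x i - x j) = (\<Prod>y\<leftarrow>map x js. x i - y)"
    using prod.distinct_set_conv_list[OF IH(2), of "\<lambda>j. x i - x j"] IH(3) by (simp add: o_def)
  then have "vand x (insert i S) = (s' * s) * vandl (map x (i # js))"
    by (simp add: s' IH(1) mult_ac)
  moreover have "distinct (i # js)" "set (i # js) = insert i S"
    using IH insert.hyps by auto
  ultimately show ?case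
    by blast
qed

text \<open>In the determinant expansion every term contains some \<open>x i\<close> to the power
  \<open>card S - 1\<close>, which is at least \<open>d\<close>. The case \<open>k = 0\<close> of
  \<open>vandl_hsym_in_ideal\<close> takes the place of the determinant.\<close>

lemma vand_in_ideal:
  assumes I: "is_ideal I" and "finite S" "d < card S" "\<And>i. i \<in> S \<Longrightarrow> x i ^ d \<in> I"
  shows "vand x S \<in> I"
proof -
  obtain s js where js: "vand x S = s * vandl (map x js)" "distinct js" "set js = S"
    using vand_vandl[OF assms(2)] by blast
  then have len: "length (map x js) = card S"
    by (auto simp: distinct_card)
  define n where "n = card S - 1"
  have "vandl (map x js) * hsym 0 (map x js) \<in> I"
  proof (rule vandl_hsym_in_ideal[OF I])
    show "length (map x js) = Suc n"
      using len assms(3) by (simp add: n_def)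
    fix y assume "y \<in> set (map x js)"
    then obtain i where "i \<in> S" "y = x i"
      using js by auto
    then have "y ^ d \<in> I"
      using assms by blast
    moreover have "y ^ d dvd y ^ (0 + n)"
      using assms(3) by (intro le_imp_power_dvd) (simp add: n_def)
    ultimately show "y ^ (0 + n) \<in> I"
      using ideal_dvd[OF I] by blast
  qed
  then show ?thesis
    using js(1) by (auto intro: ideal_mult_left[OF I])
qed

lemma prod_diff_expand:
  fixes a :: "'r::comm_ring_1"
  shows "\<exists>c. (\<Prod>j\<in>S. a - b j) = a * c + (\<Prod>j\<in>S. - b j)"
proof (induction S rule: infinite_finite_induct)
  case (insert j S)
  then obtain c where "(\<Prod>j\<in>S. a - b j) = a * c + (\<Prod>j\<in>S. - b j)"
    by blast
  then have "(\<Prod>j\<in>insert j S. a - b j) = (a - b j) * (a * c + (\<Prod>j\<in>S. - b j))"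
    using insert.hyps by simp
  also have "\<dots> = a * (a * c + (\<Prod>j\<in>S. - b j) - b j * c) + (\<Prod>j\<in>insert j S. - b j)"
    using insert.hyps by (simp add: algebra_simps)
  finally show ?case
    by blast
qed (auto intro: exI[of _ 0])

text \<open>Modulo the \<open>d\<close>-th powers, the Vandermonde product times a suitable monomial is, up to sign,
  the monomial with all exponents \<open>d - 1\<close>.\<close>

lemma vand_socle:
  assumes I: "is_ideal I"
  shows "finite S \<Longrightarrow> card S \<le> d \<Longrightarrow> vand x S * y \<in> I \<Longrightarrow> (\<And>i. i \<in> S \<Longrightarrow> x i ^ d * y \<in> I) \<Longrightarrow>
    (\<Prod>i\<in>S. x i ^ (d - 1)) * y \<in> I"
proof (induction S arbitrary: d y rule: finite_induct)
  case (insert i S)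
  define d' where "d' = d - 1"
  have d: "d = Suc d'" and card: "card S \<le> d'"
    using insert.prems(1) insert.hyps by (simp_all add: d'_def)
  obtain s where s: "s = 1 \<or> s = -1" "vand x (insert i S) = s * (\<Prod>j\<in>S. x i - x j) * vand x S"
    using vand_insert[OF insert.hyps] by blast
  obtain t where t: "t = 1 \<or> t = -1" "(\<Prod>j\<in>S. - x j) = t * (\<Prod>j\<in>S. x j)"
    using prod_signs[of S "\<lambda>j. - x j" x] by auto
  obtain c where c: "(\<Prod>j\<in>S. x i - x j) = x i * c + (\<Prod>j\<in>S. - x j)"
    using prod_diff_expand by blast
  \<comment> \<open>Times \<open>x i ^ d'\<close>, the product of the \<open>x i - x j\<close>
    reduces to that of the \<open>- x j\<close>, because \<open>x i ^ d * y\<close> lies in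
    \<open>I\<close>. So \<open>y'\<close> carries the same problem for \<open>S\<close> and
    \<open>d'\<close>.\<close>
  define y' where "y' = (\<Prod>j\<in>S. x j) * (x i ^ d' * y)"
  have st: "s * s = 1" "t * t = 1"
    using s(1) t(1) by auto
  have "vand x S * y' = (s * s) * (t * t) * (vand x S * y')"
    by (simp add: st)
  also have "\<dots> = s * t * x i ^ d' * (vand x (insert i S) * y) - s * s * t * c * vand x S * (x i ^ d * y)"
    unfolding s(2) c t(2) y'_def d power_Suc by (simp add: algebra_simps)
  also have "\<dots> \<in> I"
    by (rule ideal_diff[OF I ideal_mult_left[OF I insert.prems(2)] ideal_mult_left[OF I insert.prems(3)]]) simp
  finally have 1: "vand x S * y' \<in> I" .
  have 2: "x j ^ d' * y' \<in> I" if j: "j \<in> S" for j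
  proof -
    have "x j dvd (\<Prod>j\<in>S. x j)"
      using j insert.hyps by (simp add: dvd_prodI)
    then obtain r where "(\<Prod>j\<in>S. x j) = x j * r"
      by (auto simp: dvd_def)
    then have "x j ^ d' * y' = (r * x i ^ d') * (x j ^ d * y)"
      by (simp add: y'_def d mult_ac)
    then show ?thesis
      using insert.prems(3) j ideal_mult_left[OF I] by auto
  qed
  have 3: "(\<Prod>i\<in>S. x i ^ (d' - 1)) * y' \<in> I"
    using insert.IH[OF card 1] 2 by blast
  have "(\<Prod>i\<in>S. x i ^ (d' - 1)) * (\<Prod>j\<in>S. x j) = (\<Prod>i\<in>S. x i ^ d')"
  \<comment> \<open>For \<open>d' = 0\<close> the truncated subtraction would spoil the exponents,
    but then the bound on \<open>card S\<close> leaves only the empty set.\<close>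
  proof (cases "S = {}")
    case False
    then have "0 < d'"
      using card insert.hyps by (cases d') auto
    then have "x i ^ (d' - 1) * x i = x i ^ d'" for i
      by (cases d') (auto simp: mult.commute)
    then show ?thesis
      by (simp add: prod.distrib[symmetric])
  qed auto
  then have "(\<Prod>i\<in>S. x i ^ d') * (x i ^ d' * y) = (\<Prod>i\<in>S. x i ^ (d' - 1)) * y'"
    unfolding y'_def by (simp only: mult.assoc[symmetric])
  moreover have "(\<Prod>i\<in>insert i S. x i ^ (d - 1)) * y = (\<Prod>i\<in>S. x i ^ d') * (x i ^ d' * y)"
    using insert.hyps by (simp add: d'_def mult_ac)
  ultimately have "(\<Prod>i\<in>insert i S. x i ^ (d - 1)) * y = (\<Prod>i\<in>S. x i ^ (d' - 1)) * y'"
    by simp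
  then show ?case
    using 3 by simp
qed simp

section \<open>Assignments of finite sets\<close>

text \<open>Greedy filling: \<open>x\<close> takes everything or exactly \<open>c x\<close> many
  elements, and what is left fits into the other capacities.\<close>

lemma exists_assignment:
  assumes "finite X"
  shows "finite S \<Longrightarrow> enat (card S) \<le> (\<Sum>x\<in>X. c x) \<Longrightarrow>
    \<exists>a. (\<forall>i\<in>S. a i \<in> X) \<and> (\<forall>x\<in>X. enat (card {i\<in>S. a i = x}) \<le> c x)"
  using assms
proof (induction X arbitrary: S rule: finite_induct)
  case empty
  then have "enat (card S) = 0"
    by auto
  then show ?case
    using empty by (auto simp: zero_enat_def)
next
  case (insert x X)
  show ?case
  proof (cases "enat (card S) \<le> c x")
    case True
    have "{i\<in>S. x = y} = (if x = y then S else {})" for y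
      by auto
    then show ?thesis
      using True insert.hyps by (intro exI[of _ "\<lambda>_. x"]) (auto simp: zero_enat_def[symmetric])
  next
    case False
    then obtain k where k: "c x = enat k" "k < card S"
      by (cases "c x") auto
    obtain S1 where S1: "S1 \<subseteq> S" "card S1 = k"
      using k obtain_subset_with_card_n[of k S] by auto
    have fin: "finite S1" "finite (S - S1)"
      using insert.prems S1 finite_subset by auto
    have "card (S - S1) = card S - k"
      using S1 fin card_Diff_subset[of S1 S] by auto
    moreover have "enat (card S) \<le> enat k + (\<Sum>x\<in>X. c x)"
      using insert.prems insert.hyps k by simp
    ultimately have "enat (card (S - S1)) \<le> (\<Sum>x\<in>X. c x)"
      by (cases "\<Sum>x\<in>X. c x") auto
    then obtain a where a: "\<forall>i\<in>S-S1. a i \<in> X" "\<forall>x\<in>X. enat (card {i\<in>S-S1. a i = x}) \<le> c x"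
      using insert.IH fin by blast
    define b where "b i = (if i \<in> S1 then x else a i)" for i
    have "{i\<in>S. b i = x} = S1"
      using S1 a insert.hyps by (auto simp: b_def)
    moreover have "{i\<in>S. b i = y} = {i\<in>S-S1. a i = y}" if "y \<in> X" for y
      using that insert.hyps by (auto simp: b_def)
    ultimately show ?thesis
      using a S1 k by (intro exI[of _ b]) (auto simp: b_def)
  qed
qed

text \<open>Each fibre of \<open>g\<close> injects into its target by counting; disjointness of the
  targets makes the union of these maps injective.\<close>

lemma exists_placement:
  fixes g :: "nat \<Rightarrow> 'b" and X :: "'b \<Rightarrow> nat set"
  assumes T: "finite T" and card: "\<And>b. b \<in> g ` T \<Longrightarrow> enat (card {i\<in>T. g i = b}) \<le> esize (X b)"
    and disj: "\<And>b c. b \<in> g ` T \<Longrightarrow> c \<in> g ` T \<Longrightarrow> b \<noteq> c \<Longrightarrow> X b \<inter> X c = {}"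
  shows "\<exists>h. inj_on h T \<and> (\<forall>i\<in>T. h i \<in> X (g i))"
proof -
  have "\<exists>h. inj_on h {i\<in>T. g i = b} \<and> h ` {i\<in>T. g i = b} \<subseteq> X b" if b: "b \<in> g ` T" for b
  proof -
    obtain Y where Y: "finite Y" "Y \<subseteq> X b" "card {i\<in>T. g i = b} \<le> card Y"
    proof (cases "finite (X b)")
      case True
      then show ?thesis
        using card[OF b] that[of "X b"] by (auto simp: esize_def)
    next
      case False
      then show ?thesis
        using infinite_arbitrarily_large[OF False, of "card {i\<in>T. g i = b}"] that by (metis order_refl)
    qed
    have "finite {i\<in>T. g i = b}"
      using T by simp
    then show ?thesis
      using card_le_inj[OF _ Y(1,3)] Y(2) by (meson order.trans)
  qed
  then have "\<forall>b\<in>g ` T. \<exists>h. inj_on h {i\<in>T. g i = b} \<and> h ` {i\<in>T. g i = b} \<subseteq> X b"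
    by (intro ballI)
  then obtain h where h: "\<And>b. b \<in> g ` T \<Longrightarrow> inj_on (h b) {i\<in>T. g i = b} \<and> h b ` {i\<in>T. g i = b} \<subseteq> X b"
    using bchoice[of "g ` T" "\<lambda>b h. inj_on h {i\<in>T. g i = b} \<and> h ` {i\<in>T. g i = b} \<subseteq> X b"] by blast
  have in_X: "h (g i) i \<in> X (g i)" if "i \<in> T" for i
    using h[of "g i"] that by auto
  have "inj_on (\<lambda>i. h (g i) i) T"
  proof (rule inj_onI)
    fix i j assume ij: "i \<in> T" "j \<in> T" "h (g i) i = h (g j) j"
    then have "g i = g j"
      using in_X[of i] in_X[of j] disj[of "g i" "g j"] by auto
    then show "i = j"
      using h[of "g i"] ij by (auto simp: inj_on_def)
  qed
  then show ?thesis
    using in_X by blast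
qed

section \<open>The ideals \<open>\<QQ>\<close> and \<open>\<PP>\<close>\<close>

lemma lookup_single_mult_add:
  fixes p :: "('x, 'a::comm_ring_1) mpoly"
  shows "lkp (Poly_Mapping.single m a * p) (m + q) = a * lkp p q"
  by (simp add: lookup_mult lookup_single when_mult)

lemma lookup_single_mult_eq_0:
  fixes p :: "('x, 'a::comm_ring_1) mpoly"
  assumes "\<And>q. n \<noteq> m + q"
  shows "lkp (Poly_Mapping.single m a * p) n = 0"
  using assms by (simp add: lookup_mult lookup_single when_mult)

lemma lookup_mult_unique:
  fixes p q :: "('x, 'a::comm_ring_1) mpoly"
  assumes "\<And>a b. a \<in> kys p \<Longrightarrow> b \<in> kys q \<Longrightarrow> a + b = m + n \<Longrightarrow> a = m"
  shows "lkp (p * q) (m + n) = lkp p m * lkp q n"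
proof -
  have "lkp p a * (\<Sum>b. lkp q b when m + n = a + b) = (lkp p m * lkp q n when a = m)" for a
  proof (cases "a = m")
    case False
    have "lkp p a = 0 \<or> (\<forall>b. (lkp q b when m + n = a + b) = 0)"
      using assms[of a] False by (auto simp: in_keys_iff when_def) metis
    then show ?thesis
      using False by auto
  qed simp
  then show ?thesis
    by (simp add: lookup_mult)
qed

text \<open>This is \<open>frakQ\<close> with a separate exponent for every variable. Extracting
  Newton coefficients requires exponents that may be smaller than the weights.\<close>

definition pow_ideal :: "(nat \<Rightarrow> nat) \<Rightarrow> 'b::comm_ring_1 set \<Rightarrow> 'b R set" where
  "pow_ideal E I = ideal_gen (Const ` I \<union> range (\<lambda>i. Var i ^ E i))"

lemma frakQ_eq_pow_ideal: "frakQ U e Z = pow_ideal (\<lambda>i. e (block_index U i)) (I0 Z)"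
  by (simp add: frakQ_def pow_ideal_def)

lemma is_ideal_pow_ideal: "is_ideal (pow_ideal E I)"
  unfolding pow_ideal_def by (rule is_ideal_gen)

lemma Var_power_eq_single:
  "Var x ^ k = (Poly_Mapping.single (Poly_Mapping.single x k) 1 :: ('x, 'a::comm_ring_1) mpoly)"
  by (simp add: single_eq_mono_val mono_val_single Const_1)

text \<open>The quotient is free over the coefficients modulo \<open>I\<close> on the monomials
  below \<open>E\<close>, so membership is a condition on these coefficients alone.\<close>

lemma pow_ideal_iff:
  fixes I :: "'b::comm_ring_1 set"
  assumes I: "is_ideal I"
  shows "g \<in> pow_ideal E I \<longleftrightarrow> (\<forall>m. (\<forall>i. lkp m i < E i) \<longrightarrow> lkp g m \<in> I)"
proof
  let ?J = "{g :: 'b R. \<forall>m. (\<forall>i. lkp m i < E i) \<longrightarrow> lkp g m \<in> I}"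
  have "is_ideal ?J"
    unfolding is_ideal_iff
  proof (intro conjI ballI allI)
    show "0 \<in> ?J"
      using I by (simp add: ideal_0)
    show "x + y \<in> ?J" if "x \<in> ?J" "y \<in> ?J" for x y
      using that I by (auto simp: lookup_add intro: ideal_add)
    show "r * x \<in> ?J" if x: "x \<in> ?J" for r x
    proof (induction r rule: mpoly_induct_single)
      case (1 m a)
      show ?case
      proof (intro CollectI allI impI)
        fix n assume n: "\<forall>i. lkp n i < E i"
        show "lkp (Poly_Mapping.single m a * x) n \<in> I"
        proof (cases "\<exists>q. n = m + q")
          case True
          then obtain q where q: "n = m + q" by blast
          then have "\<forall>i. lkp q i < E i"
            using n by (auto simp: lookup_add intro: le_less_trans[OF le_add2])
          then show ?thesis
            using x ideal_mult_left[OF I] by (simp add: q lookup_single_mult_add)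
        next
          case False
          then show ?thesis
            using I by (simp add: lookup_single_mult_eq_0 ideal_0)
        qed
      qed
    next
      case (2 p q)
      then show ?case
        using I by (auto simp: distrib_right lookup_add intro: ideal_add)
    qed
  qed
  moreover have "Const ` I \<union> range (\<lambda>i. Var i ^ E i) \<subseteq> ?J"
    using I by (auto simp: Const_def lookup_single when_def Var_power_eq_single ideal_0) (metis less_irrefl)
  ultimately have "pow_ideal E I \<subseteq> ?J"
    unfolding pow_ideal_def by (rule ideal_gen_least)
  then show "g \<in> pow_ideal E I \<Longrightarrow> \<forall>m. (\<forall>i. lkp m i < E i) \<longrightarrow> lkp g m \<in> I"
    by blast
next
  assume g: "\<forall>m. (\<forall>i. lkp m i < E i) \<longrightarrow> lkp g m \<in> I"
  let ?K = "pow_ideal E I"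
  have K: "is_ideal ?K"
    by (rule is_ideal_pow_ideal)
  have "Poly_Mapping.single m (lkp g m) \<in> ?K" for m
  proof (cases "\<forall>i. lkp m i < E i")
    case True
    then have "Const (lkp g m) \<in> ?K"
      unfolding pow_ideal_def using g by (intro ideal_gen_base) blast
    then show ?thesis
      unfolding single_eq_mono_val by (rule ideal_mult_right[OF K])
  next
    case False
    then obtain i where i: "E i \<le> lkp m i"
      using not_less by blast
    have "(Var i :: 'b R) ^ E i dvd mono_val Var m"
    proof (cases "i \<in> kys m")
      case True
      have "(Var i :: 'b R) ^ E i dvd Var i ^ lkp m i"
        using i by (rule le_imp_power_dvd)
      also have "\<dots> dvd mono_val Var m"
        unfolding mono_val_def using True by (intro dvd_prodI) auto
      finally show ?thesis .
    next
      case False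
      then show ?thesis
        using i by (simp add: in_keys_iff)
    qed
    moreover have "Var i ^ E i \<in> ?K"
      unfolding pow_ideal_def by (intro ideal_gen_base) blast
    ultimately show ?thesis
      unfolding single_eq_mono_val using ideal_dvd[OF K] ideal_mult_left[OF K] by blast
  qed
  then show "g \<in> ?K"
    using mpoly_sum_singles[of g] ideal_sum[OF K, of "kys g" "\<lambda>m. Poly_Mapping.single m (lkp g m)"] by simp
qed

section \<open>The localisation and the map \<open>iota\<close>\<close>

lemma rhom_to_S0: "rhom to_S0"
  unfolding rhom_def to_S0_def
  by (auto simp: one_S0_def plus_S0.abs_eq times_S0.abs_eq loc_rel_iff denoms_1)

lemma to_S0_unit:
  assumes "\<alpha> \<noteq> \<beta>"
  shows "\<exists>u. to_S0 (Var \<alpha> - Var \<beta>) * u = (1 :: ('i, 'a::comm_ring_1) S0)"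
proof -
  let ?d = "Var \<alpha> - Var \<beta> :: ('i, 'a) mpoly"
  have d: "?d \<in> denoms"
    using denoms_step[OF denoms_1 assms] by simp
  have "to_S0 ?d * abs_S0 (1, ?d) = abs_S0 (?d, ?d)"
    unfolding to_S0_def using d by (subst times_S0.abs_eq) (auto simp: loc_rel_iff denoms_1)
  also have "\<dots> = abs_S0 (1, 1)"
    using d by (intro Quotient_rel_abs[OF Quotient_S0]) (simp add: loc_rel_iff denoms_1)
  also have "\<dots> = 1"
    by (simp add: one_S0_def)
  finally show ?thesis
    by blast
qed

text \<open>The denominators are nonzerodivisors over every base ring, so nilpotency established in
  \<open>S0\<close> descends to the polynomial ring.\<close>

lemma to_S0_eq_0:
  assumes "to_S0 p = 0"
  shows "p = 0"
proof -
  have "abs_S0 (p, 1) = abs_S0 (0, 1)"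
    using assms by (simp add: to_S0_def zero_S0_def)
  then have "loc_rel (p, 1) (0, 1)"
    using Quotient_rel[OF Quotient_S0, of "(p, 1)" "(0, 1)"] by (auto simp: loc_rel_iff denoms_1)
  then show ?thesis
    by (simp add: loc_rel_iff)
qed

lemma rhom_iota_const: "rhom (\<lambda>a. Const (to_S0 (Const a)))"
  by (intro rhom_comp[OF rhom_Const] rhom_comp[OF rhom_to_S0] rhom_Const)

lemma rhom_iota: "rhom (iota U)"
  unfolding iota_def by (rule rhom_poly_hom[OF rhom_iota_const])

lemma iota_Const: "iota U (Const a) = Const (to_S0 (Const a))"
  and iota_Var: "iota U (Var i) = Const (to_S0 (Var (block_index U i))) + Var i"
  unfolding iota_def by (simp_all add: poly_hom_Const poly_hom_Var rhom_iota_const)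

text \<open>If \<open>\<sigma>\<close> keeps the variables of \<open>f\<close> in their blocks, the
  t-part of \<open>iota\<close> does not notice it and only the \<epsilon>'s are permuted. On the
  right, \<open>act\<close> works over the coefficients \<open>S0\<close>.\<close>

lemma iota_act:
  assumes "\<And>i. i \<in> vars f \<Longrightarrow> block_index U (\<sigma> i) = block_index U i"
  shows "iota U (act \<sigma> f) = act \<sigma> (iota U f)"
proof -
  let ?c = "\<lambda>a. Const (to_S0 (Const a))"
  note c = rhom_iota_const
  have "iota U (act \<sigma> f) = poly_hom ?c (\<lambda>i. Const (to_S0 (Var (block_index U (\<sigma> i)))) + Var (\<sigma> i)) f"
    by (rule rhom_eqI[OF rhom_comp[OF rhom_iota rhom_act] rhom_poly_hom[OF c]])
      (simp_all add: iota_Const iota_Var poly_hom_Const[OF c] poly_hom_Var[OF c])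
  also have "\<dots> = poly_hom ?c (\<lambda>i. Const (to_S0 (Var (block_index U i))) + Var (\<sigma> i)) f"
    using assms by (intro poly_hom_cong) auto
  also have "\<dots> = act \<sigma> (iota U f)"
    by (rule rhom_eqI[OF rhom_poly_hom[OF c] rhom_comp[OF rhom_act rhom_iota]])
      (simp_all add: iota_Const iota_Var poly_hom_Const[OF c] poly_hom_Var[OF c])
  finally show ?thesis .
qed

lemma lookup_eq_0_if_notin_vars: "m \<in> kys p \<Longrightarrow> i \<notin> vars p \<Longrightarrow> lkp m i = 0"
  unfolding vars_def by (metis UN_I in_keys_iff)

lemma vars_add: "vars (p + q) \<subseteq> vars p \<union> vars q"
  unfolding vars_def using keys_add[of p q] by blast

lemma vars_mult: "vars (p * q) \<subseteq> vars p \<union> vars (q :: ('x, 'a::comm_ring_1) mpoly)"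
proof
  fix x assume "x \<in> vars (p * q)"
  then obtain m where "m \<in> kys (p * q)" "x \<in> kys m"
    by (auto simp: vars_def)
  then obtain a b where "m = a + b" "a \<in> kys p" "b \<in> kys q"
    using keys_mult[of p q] by blast
  then show "x \<in> vars p \<union> vars q"
    using \<open>x \<in> kys m\<close> keys_add[of a b] by (auto simp: vars_def)
qed

lemma vars_Const [simp]: "vars (Const a) = {}"
  by (auto simp: vars_def Const_def split: if_splits)

lemma vars_Var [simp]: "vars (Var x :: ('x, 'a::zero_neq_one) mpoly) = {x}"
  by (auto simp: vars_def Var_def)

lemma vars_sum: "(\<And>i. i \<in> S \<Longrightarrow> vars (g i) \<subseteq> T) \<Longrightarrow> vars (sum g S) \<subseteq> T"
proof (induction S rule: infinite_finite_induct)
  case (insert i S)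
  then have "vars (sum g S) \<subseteq> T" "vars (g i) \<subseteq> T"
    by auto
  then show ?case
    using vars_add[of "g i" "sum g S"] insert.hyps by auto
qed (auto simp: vars_def)

lemma vars_prod:
  fixes g :: "'b \<Rightarrow> ('x, 'a::comm_ring_1) mpoly"
  shows "(\<And>i. i \<in> S \<Longrightarrow> vars (g i) \<subseteq> T) \<Longrightarrow> vars (prod g S) \<subseteq> T"
proof (induction S rule: infinite_finite_induct)
  case (insert i S)
  then have "vars (prod g S) \<subseteq> T" "vars (g i) \<subseteq> T"
    by auto
  then show ?case
    using vars_mult[of "g i" "prod g S"] insert.hyps by auto
qed (auto simp: vars_def)

lemma vars_power: "vars (p ^ n) \<subseteq> vars (p :: ('x, 'a::comm_ring_1) mpoly)"
  using vars_prod[of "{..<n}" "\<lambda>_. p" "vars p"] by simp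

lemma vars_iota: "vars (iota U f) \<subseteq> vars f"
  unfolding iota_def poly_hom_def
proof (rule vars_sum)
  fix m assume m: "m \<in> kys f"
  have "vars (\<Prod>x\<in>kys m. (Const (to_S0 (Var (block_index U x))) + Var x) ^ lkp m x) \<subseteq> vars f"
  proof (rule vars_prod)
    fix x assume "x \<in> kys m"
    then have "vars (Const (to_S0 (Var (block_index U x))) + Var x) \<subseteq> vars f"
      using m vars_add[of "Const (to_S0 (Var (block_index U x)))" "Var x"] by (auto simp: vars_def[of f])
    then show "vars ((Const (to_S0 (Var (block_index U x))) + Var x) ^ lkp m x) \<subseteq> vars f"
      using vars_power by fastforce
  qed
  then show "vars (Const (to_S0 (Const (lkp f m))) *
      (\<Prod>x\<in>kys m. (Const (to_S0 (Var (block_index U x))) + Var x) ^ lkp m x)) \<subseteq> vars f"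
    by (intro order.trans[OF vars_mult]) simp
qed

lemma lookup_map_key: "inj \<sigma> \<Longrightarrow> lkp (Poly_Mapping.map_key \<sigma> m) i = lkp m (\<sigma> i)"
  by (simp add: map_key.rep_eq)

lemma lookup_act:
  fixes g :: "'a::comm_ring_1 R"
  assumes \<sigma>: "bij \<sigma>"
  shows "lkp (act \<sigma> g) m = lkp g (Poly_Mapping.map_key \<sigma> m)"
proof (induction g rule: mpoly_induct_single)
  case (1 n a)
  define k where "k = Poly_Mapping.map_key (inv \<sigma>) n"
  have inj: "inj \<sigma>" "inj (inv \<sigma>)"
    using \<sigma> by (simp_all add: bij_is_inj bij_imp_bij_inv)
  have lk: "lkp k (\<sigma> i) = lkp n i" for i
    using inj by (simp add: k_def lookup_map_key)
  have kk: "kys k = \<sigma> ` kys n"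
  proof (intro set_eqI iffI)
    fix x assume "x \<in> kys k"
    moreover have "x = \<sigma> (inv \<sigma> x)"
      using \<sigma> by (simp add: bij_is_surj surj_f_inv_f)
    ultimately show "x \<in> \<sigma> ` kys n"
      using lk[of "inv \<sigma> x"] by (auto simp: in_keys_iff intro!: image_eqI[of _ _ "inv \<sigma> x"])
  qed (auto simp: in_keys_iff lk)
  have "mono_val Var k = mono_val (\<lambda>i. Var (\<sigma> i) :: 'a R) n"
    unfolding mono_val_def kk using inj_on_subset[OF inj(1)] by (simp add: prod.reindex lk)
  then have "act \<sigma> (Poly_Mapping.single n a) = Poly_Mapping.single k a"
    unfolding act_def by (simp add: poly_hom_single rhom_Const single_eq_mono_val[of k])
  moreover have "k = m \<longleftrightarrow> n = Poly_Mapping.map_key \<sigma> m"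
  proof
    assume "k = m"
    then show "n = Poly_Mapping.map_key \<sigma> m"
      using inj lk by (intro poly_mapping_eqI) (simp add: lookup_map_key)
  next
    assume "n = Poly_Mapping.map_key \<sigma> m"
    then show "k = m"
      using inj \<sigma> by (intro poly_mapping_eqI) (simp add: lookup_map_key k_def bij_is_surj surj_f_inv_f)
  qed
  ultimately show ?case
    by (auto simp: lookup_single when_def)
next
  case (2 p q)
  then show ?case
    by (simp add: lookup_add)
qed

lemma block_index_eq: "partition_of_type l U \<Longrightarrow> i \<in> U \<alpha> \<Longrightarrow> block_index U i = \<alpha>"
  unfolding block_index_def partition_of_type_def disjoint_family_on_def
  by (rule the_equality) auto

lemma block_index_mem: "partition_of_type l U \<Longrightarrow> i \<in> U (block_index U i)"
  using block_index_eq[of l U i] unfolding partition_of_type_def by auto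

lemma inv_ideal_frakP:
  fixes Z :: "('i, 'a::comm_ring_1) S0 set set"
  shows "inv_ideal (fixing {}) (frakP U e Z)"
  unfolding inv_ideal_def
proof (intro conjI ballI)
  have Q: "is_ideal (frakQ U e Z)"
    by (simp add: frakQ_eq_pow_ideal is_ideal_pow_ideal)
  have "is_ideal {f. iota U (act \<sigma> f) \<in> frakQ U e Z}" for \<sigma>
    by (rule is_ideal_vimage[OF rhom_comp[OF rhom_iota rhom_act] Q])
  moreover have "frakP U e Z = (\<Inter>\<sigma>\<in>Sym_inf. {f. iota U (act \<sigma> f) \<in> frakQ U e Z})"
    by (auto simp: frakP_def)
  ultimately show "is_ideal (frakP U e Z)"
    by (auto intro: is_ideal_Inter)
next
  fix s :: "'a R \<Rightarrow> 'a R" and f assume "s \<in> fixing {}" and f: "f \<in> frakP U e Z"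
  then obtain \<tau> where "s = act \<tau>" "\<tau> \<in> Sym_inf"
    by (auto elim: fixingE)
  then show "s f \<in> frakP U e Z"
    using f by (auto simp: frakP_def act_act Sym_inf_comp)
qed

text \<open>Membership in \<open>frakQ\<close> is tested on coefficients, hence commutes with
  intersecting the coefficient ideals. This allows working with one prime at a time.\<close>

lemma frakP_Spec:
  fixes U :: "'i \<Rightarrow> nat set"
  shows "frakP U e (Spec :: ('i, 'a::comm_ring_1) S0 set set) = (\<Inter>P\<in>Spec. frakP U e {P})"
proof -
  have I: "is_ideal (I0 Z)" if "Z \<subseteq> Spec" for Z :: "('i, 'a) S0 set set"
    unfolding I0_def using that by (intro is_ideal_Inter) (auto simp: Spec_def is_prime_ideal_def)
  have "g \<in> frakQ U e Spec \<longleftrightarrow> (\<forall>P\<in>Spec. g \<in> frakQ U e {P})" for g :: "('i, 'a) Stilde"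
    by (auto simp: frakQ_eq_pow_ideal pow_ideal_iff I) (auto simp: I0_def)
  then show ?thesis
    unfolding frakP_def by blast
qed

text \<open>Permuting \<open>g\<close> within the infinite blocks makes its variables disjoint from those of \<open>f\<close>, so the
  product of a coefficient of \<open>f\<close> with one of \<open>g\<close> is a coefficient of the product.\<close>

lemma frakP_prime:
  fixes f g :: "'a::comm_ring_1 R" and l :: "'i \<Rightarrow> enat"
  assumes e: "weighting UNIV e" "reduced UNIV l e" and U: "partition_of_type l U"
    and P: "is_prime_ideal P"
    and f: "f \<notin> frakP U e {P}" and g: "g \<notin> frakP U e {P}"
  shows "\<exists>\<rho>\<in>Sym_inf. f * act \<rho> g \<notin> frakP U e {P}"
proof -
  let ?b = "block_index U"
  have I: "is_ideal P" and prime: "\<And>x y. x * y \<in> P \<Longrightarrow> x \<in> P \<or> y \<in> P"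
    using P by (auto simp: is_prime_ideal_def)
  have Qiff: "h \<in> frakQ U e {P} \<longleftrightarrow> (\<forall>m. (\<forall>i. lkp m i < e (?b i)) \<longrightarrow> lkp h m \<in> P)" for h
    using I by (simp add: frakQ_eq_pow_ideal pow_ideal_iff I0_def)
  obtain s1 where s1: "s1 \<in> Sym_inf" "iota U (act s1 f) \<notin> frakQ U e {P}"
    using f by (auto simp: frakP_def)
  obtain s2 where s2: "s2 \<in> Sym_inf" "iota U (act s2 g) \<notin> frakQ U e {P}"
    using g by (auto simp: frakP_def)
  define F where "F = act s1 f"
  define G where "G = act s2 g"
  define T where "T = vars F"
  define T' where "T' = vars G"
  obtain m where m: "\<And>i. lkp m i < e (?b i)" "lkp (iota U F) m \<notin> P"
    using s1 Qiff by (auto simp: F_def)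
  obtain n where n: "\<And>i. lkp n i < e (?b i)" "lkp (iota U G) n \<notin> P"
    using s2 Qiff by (auto simp: G_def)
  \<comment> \<open>Only infinite blocks have room to avoid the variables of \<open>F\<close>; in
    finite blocks an overlap is accepted.\<close>
  define X where "X \<alpha> = (if l \<alpha> = \<infinity> then U \<alpha> - T else U \<alpha>)" for \<alpha>
  have size: "esize (U \<alpha>) = l \<alpha>" for \<alpha>
    using U by (auto simp: partition_of_type_def)
  have "\<exists>h. inj_on h T' \<and> (\<forall>i\<in>T'. h i \<in> X (?b i))"
  proof (rule exists_placement[where g = ?b and X = X])
    show "finite T'"
      by (simp add: T'_def)
    show "enat (card {i\<in>T'. ?b i = \<alpha>}) \<le> esize (X \<alpha>)" for \<alpha>
    proof (cases "finite (U \<alpha>)")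
      case True
      then have "X \<alpha> = U \<alpha>"
        using size[of \<alpha>] by (auto simp: X_def esize_def split: if_splits)
      moreover have "card {i\<in>T'. ?b i = \<alpha>} \<le> card (U \<alpha>)"
        using True block_index_mem[OF U] by (intro card_mono) auto
      ultimately show ?thesis
        using True by (simp add: esize_def)
    next
      case False
      then have "infinite (X \<alpha>)"
        by (auto simp: X_def T_def)
      then show ?thesis
        by (simp add: esize_def)
    qed
    show "X \<alpha> \<inter> X \<beta> = {}" if "\<alpha> \<noteq> \<beta>" for \<alpha> \<beta>
      using U that by (auto simp: X_def partition_of_type_def disjoint_family_on_def)
  qed
  then obtain h where h: "inj_on h T'" "\<And>i. i \<in> T' \<Longrightarrow> h i \<in> X (?b i)"
    by blast
  then obtain \<sigma> where \<sigma>: "\<sigma> \<in> Sym_inf" "\<And>i. i \<in> T' \<Longrightarrow> \<sigma> i = h i"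
    using Sym_inf_extend[of T' h] by (auto simp: T'_def)
  have sX: "\<sigma> i \<in> X (?b i)" if "i \<in> T'" for i
    using h(2) \<sigma>(2) that by auto
  have sU: "\<sigma> i \<in> U (?b i)" if "i \<in> T'" for i
    using sX[OF that] by (auto simp: X_def split: if_splits)
  have sb: "?b (\<sigma> i) = ?b i" if "i \<in> T'" for i
    using sU[OF that] by (rule block_index_eq[OF U])
  have bij: "bij \<sigma>" "inj \<sigma>" "inj (inv \<sigma>)"
    using \<sigma>(1) Sym_inf_bij Sym_inf_inj Sym_inf_inv by auto
  define q where "q = iota U (act \<sigma> G)"
  have q: "q = act \<sigma> (iota U G)"
    unfolding q_def using sb by (intro iota_act) (auto simp: T'_def)
  define n' where "n' = Poly_Mapping.map_key (inv \<sigma>) n"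
  have n': "lkp n' (\<sigma> i) = lkp n i" for i
    using bij by (simp add: n'_def lookup_map_key)
  then have "Poly_Mapping.map_key \<sigma> n' = n"
    using bij by (intro poly_mapping_eqI) (simp add: lookup_map_key)
  then have qn': "lkp q n' = lkp (iota U G) n"
    using bij by (simp add: q lookup_act)
  have zero: "lkp m i = 0" if "i \<notin> T" "m \<in> kys (iota U F)" for i m
    using that vars_iota[of U F] lookup_eq_0_if_notin_vars by (metis T_def subsetD)
  have zero': "lkp m i = 0" if "i \<notin> \<sigma> ` T'" "m \<in> kys q" for i m
  proof -
    have "Poly_Mapping.map_key \<sigma> m \<in> kys (iota U G)"
      using that(2) bij by (simp add: q lookup_act in_keys_iff)
    moreover have "\<sigma> (inv \<sigma> i) = i"
      using bij(1) by (simp add: bij_is_surj surj_f_inv_f)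
    then have "inv \<sigma> i \<notin> vars (iota U G)"
      using that(1) vars_iota[of U G] by (auto simp: T'_def intro: image_eqI[OF sym])
    ultimately have "lkp (Poly_Mapping.map_key \<sigma> m) (inv \<sigma> i) = 0"
      by (rule lookup_eq_0_if_notin_vars)
    then show ?thesis
      using bij by (simp add: lookup_map_key bij_is_surj surj_f_inv_f)
  qed
  have mk: "m \<in> kys (iota U F)" "n' \<in> kys q"
    using m(2) n(2) ideal_0[OF I] by (auto simp: in_keys_iff qn')
  have disj: "l (?b i) \<noteq> \<infinity>" if "i \<in> T" "i \<in> \<sigma> ` T'" for i
  proof -
    obtain j where j: "j \<in> T'" "i = \<sigma> j"
      using \<open>i \<in> \<sigma> ` T'\<close> by blast
    then have "i \<in> X (?b i)"
      using sX[of j] sb[of j] by simp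
    then show ?thesis
      using \<open>i \<in> T\<close> by (auto simp: X_def split: if_splits)
  qed
  \<comment> \<open>Where variables may be shared, the block is finite, so reducedness gives weight
    1 and hence exponent 0.\<close>
  have fin0: "lkp m i = 0" "lkp n' i = 0" if "l (?b i) \<noteq> \<infinity>" for i
  proof -
    have 1: "e (?b i) = 1"
      using e(2) that by (simp add: reduced_def)
    then show "lkp m i = 0"
      using m(1)[of i] by simp
    show "lkp n' i = 0"
    proof (cases "i \<in> \<sigma> ` T'")
      case True
      then obtain j where j: "j \<in> T'" "i = \<sigma> j"
        by blast
      then show ?thesis
        using n(1)[of j] 1 sb[of j] by (simp add: n')
    qed (use zero' mk in auto)
  qed
  have "lkp (iota U F * q) (m + n') = lkp (iota U F) m * lkp q n'"
  proof (rule lookup_mult_unique)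
    fix a b assume ab: "a \<in> kys (iota U F)" "b \<in> kys q" "a + b = m + n'"
    show "a = m"
    proof (rule poly_mapping_eqI)
      fix i
      have sum: "lkp a i + lkp b i = lkp m i + lkp n' i"
        using arg_cong[OF ab(3), of "\<lambda>x. lkp x i"] by (simp add: lookup_add)
      show "lkp a i = lkp m i"
      proof (cases "i \<in> T")
        case False
        then show ?thesis
          using zero ab(1) mk(1) by simp
      next
        case True
        show ?thesis
        proof (cases "i \<in> \<sigma> ` T'")
          case False
          then show ?thesis
            using zero' ab(2) mk(2) sum by simp
        next
          case True
          then show ?thesis
            using fin0[OF disj[OF \<open>i \<in> T\<close>]] sum by simp
        qed
      qed
    qed
  qed
  then have "lkp (iota U F * q) (m + n') \<notin> P"
    using prime m(2) n(2) by (auto simp: qn')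
  moreover have "lkp (m + n') i < e (?b i)" for i
  proof (cases "i \<in> T \<or> i \<notin> \<sigma> ` T'")
    case True
    then have "lkp n' i = 0"
      using zero' mk(2) fin0 disj by blast
    then show ?thesis
      using m(1) by (simp add: lookup_add)
  next
    case False
    then obtain j where j: "j \<in> T'" "i = \<sigma> j"
      by blast
    then show ?thesis
      using zero[of i m] False mk(1) n(1)[of j] sb[of j] by (simp add: lookup_add n')
  qed
  ultimately have notQ: "iota U F * q \<notin> frakQ U e {P}"
    using Qiff by blast
  \<comment> \<open>The choice makes \<open>s1\<close> carry \<open>act \<rho> g\<close> to
    \<open>act \<sigma> G\<close> while carrying \<open>f\<close> to \<open>F\<close>.\<close>
  define \<rho> where "\<rho> = inv s1 \<circ> \<sigma> \<circ> s2"
  have \<rho>: "\<rho> \<in> Sym_inf"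
    using s1 s2 \<sigma> by (simp add: \<rho>_def Sym_inf_comp Sym_inf_inv)
  have "s1 \<circ> \<rho> = \<sigma> \<circ> s2"
    using Sym_inf_bij[OF s1(1)] by (auto simp: \<rho>_def fun_eq_iff bij_is_surj surj_f_inv_f)
  then have "iota U (act s1 (f * act \<rho> g)) = iota U F * q"
    by (simp add: act_act F_def q_def G_def rhom_mult[OF rhom_iota])
  then have "iota U (act s1 (f * act \<rho> g)) \<notin> frakQ U e {P}"
    using notQ by simp
  then have "f * act \<rho> g \<notin> frakP U e {P}"
    using s1(1) unfolding frakP_def by blast
  then show ?thesis
    using \<rho> by blast
qed

text \<open>An element of \<open>B\<close> outside the ideal at some prime \<open>P\<close> can be
  multiplied repeatedly by its own conjugates without falling into that ideal, so no power of
  \<open>B\<close> is contained in it.\<close>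

lemma S_radical_subset_frakP:
  fixes J :: "'a::comm_ring_1 R set" and l :: "'i \<Rightarrow> enat"
  assumes e: "weighting UNIV e" "reduced UNIV l e" and U: "partition_of_type l U"
    and J: "J \<subseteq> frakP U e Spec"
  shows "S_radical J \<subseteq> frakP U e Spec"
proof -
  have "B \<subseteq> frakP U e Spec" if B: "is_S_ideal B" "ideal_power B n \<subseteq> J" for B n
  proof
    fix f assume f: "f \<in> B"
    show "f \<in> frakP U e Spec"
    proof (rule ccontr)
      assume "f \<notin> frakP U e Spec"
      then obtain P where P: "P \<in> Spec" "f \<notin> frakP U e {P}"
        by (auto simp: frakP_Spec)
      have prime: "is_prime_ideal P"
        using P by (simp add: Spec_def)
      have "\<exists>h\<in>ideal_power B k. h \<notin> frakP U e {P}" for k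
      proof (induction k)
        case 0
        have "f \<in> frakP U e {P}" if "1 \<in> frakP U e {P}"
          using ideal_mult_left[of "frakP U e {P}" 1 f] that inv_ideal_frakP[of U e "{P}"]
          by (simp add: inv_ideal_def)
        then show ?case
          using P(2) by auto
      next
        case (Suc k)
        then obtain h where h: "h \<in> ideal_power B k" "h \<notin> frakP U e {P}"
          by blast
        then obtain \<rho> where \<rho>: "\<rho> \<in> Sym_inf" "h * act \<rho> f \<notin> frakP U e {P}"
          using frakP_prime[OF e U prime _ P(2)] by blast
        have "act \<rho> f \<in> B"
          using B(1) f \<rho> by (auto simp: is_S_ideal_def)
        then have "act \<rho> f * h \<in> ideal_power B (Suc k)"
          unfolding ideal_power.simps ideal_prod_def using h(1) by (intro ideal_gen_base) blast
        then show ?case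
          using \<rho>(2) by (auto simp: mult.commute)
      qed
      then show False
        using B(2) J P(1) by (fastforce simp: frakP_Spec)
    qed
  qed
  then show ?thesis
    unfolding S_radical_def using inv_ideal_frakP[of U e Spec]
    by (intro ideal_gen_least) (auto simp: inv_ideal_def)
qed

section \<open>The elements \<open>h\<close> lie in \<open>\<PP>(\<lambda>, e)\<close>\<close>

text \<open>In each binomial term either \<open>k \<ge> m\<close> or \<open>N - k \<ge> n\<close>.
  With both exponents bounded by the maximal weight, this is the origin of
  \<open>par_N\<close>.\<close>

lemma ideal_power_add:
  assumes I: "is_ideal I" and a: "a ^ m \<in> I" and b: "b ^ n \<in> I" and N: "m + n \<le> Suc N"
  shows "(a + b) ^ N \<in> I"
  unfolding binomial_ring
proof (rule ideal_sum[OF I])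
  fix k assume k: "k \<in> {..N}"
  show "of_nat (N choose k) * a ^ k * b ^ (N - k) \<in> I"
  proof (cases "m \<le> k")
    case True
    then have "a ^ k \<in> I"
      using a ideal_dvd[OF I] le_imp_power_dvd by blast
    then show ?thesis
      using ideal_mult_left[OF I] ideal_mult_right[OF I] by blast
  next
    case False
    then have "b ^ (N - k) \<in> I"
      using b N ideal_dvd[OF I] le_imp_power_dvd[of n "N - k" b] by auto
    then show ?thesis
      using ideal_mult_left[OF I] by blast
  qed
qed

lemma ideal_power_diff:
  assumes I: "is_ideal I" and a: "a ^ m \<in> I" and b: "b ^ n \<in> I" and N: "m + n \<le> Suc N"
  shows "(a - b) ^ N \<in> I"
proof -
  have "(- b) ^ n \<in> I"
    using b ideal_uminus[OF I] by (cases "even n") auto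
  then show ?thesis
    using ideal_power_add[OF I a _ N] by fastforce
qed

lemma vand_subset_dvd: "finite S \<Longrightarrow> S' \<subseteq> S \<Longrightarrow> vand x S' dvd vand x S"
  unfolding vand_def by (rule prod_dvd_prod_subset) auto

lemma vand_cong:
  assumes "\<And>i j. i \<in> S \<Longrightarrow> j \<in> S \<Longrightarrow> x i - x j = y i - y j"
  shows "vand x S = vand y S"
  unfolding vand_def by (rule prod.cong) (use assms in auto)

lemma rhom_vand: "rhom \<Phi> \<Longrightarrow> \<Phi> (vand x S) = vand (\<lambda>i. \<Phi> (x i)) S"
  unfolding vand_def by (simp add: rhom_prod rhom_diff case_prod_beta)

lemma card_eq_sum_fibers:
  assumes "finite S" "finite T" "g ` S \<subseteq> T"
  shows "card S = (\<Sum>y\<in>T. card {x\<in>S. g x = y})"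
  using sum.group[OF assms, of "\<lambda>_. 1 :: nat"] by simp

lemma sum_enat_infinity:
  fixes f :: "'b \<Rightarrow> enat"
  assumes "finite S" "x \<in> S" "f x = \<infinity>"
  shows "sum f S = \<infinity>"
  using assms by (simp add: sum.remove)

lemma enat_sum: "enat (\<Sum>x\<in>S. f x) = (\<Sum>x\<in>S. enat (f x))"
  by (induction S rule: infinite_finite_induct) (auto simp: zero_enat_def plus_enat_simps(1)[symmetric] simp del: plus_enat_simps)

definition cross_pairs :: "'k set \<Rightarrow> ('k \<Rightarrow> nat set) \<Rightarrow> (nat \<times> nat) set" where
  "cross_pairs K W = {(i, j). i < j \<and> (\<exists>\<beta>\<in>K. \<exists>\<gamma>\<in>K. \<beta> \<noteq> \<gamma> \<and> i \<in> W \<beta> \<and> j \<in> W \<gamma>)}"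

lemma h_elem_eq:
  "h_elem n N (K, \<mu>, d) W V =
     (\<Prod>\<beta>\<in>{\<beta>\<in>K. \<mu> \<beta> = \<infinity>}. \<Prod>k\<in>{1..n}. vand Var (V \<beta> k)) *
     (\<Prod>(i, j)\<in>cross_pairs K W. (Var i - Var j) ^ N)"
  by (simp add: h_elem_def Delta_eq_vand cross_pairs_def)

lemma rhom_h_elem:
  assumes "rhom \<Phi>"
  shows "\<Phi> (h_elem n N (K, \<mu>, d) W V) =
     (\<Prod>\<beta>\<in>{\<beta>\<in>K. \<mu> \<beta> = \<infinity>}. \<Prod>k\<in>{1..n}. vand (\<lambda>i. \<Phi> (Var i)) (V \<beta> k)) *
     (\<Prod>(i, j)\<in>cross_pairs K W. (\<Phi> (Var i) - \<Phi> (Var j)) ^ N)"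
  using assms by (simp add: h_elem_eq rhom_mult rhom_prod rhom_vand rhom_power rhom_diff case_prod_beta)

lemma block_choiceD:
  assumes "block_choice n (K, \<mu>, d) W V"
  shows "\<And>\<beta> \<gamma>. \<beta> \<in> K \<Longrightarrow> \<gamma> \<in> K \<Longrightarrow> \<beta> \<noteq> \<gamma> \<Longrightarrow> W \<beta> \<inter> W \<gamma> = {}"
    and "(\<Union>\<beta>\<in>K. W \<beta>) = {..<(\<Sum>\<beta>\<in>K. par_tau n \<mu> d \<beta>)}"
    and "\<And>\<beta>. \<beta> \<in> K \<Longrightarrow> card (W \<beta>) = par_tau n \<mu> d \<beta>"
    and "\<And>\<beta>. \<beta> \<in> K \<Longrightarrow> finite (W \<beta>)"
    and "\<And>\<beta> k. \<beta> \<in> K \<Longrightarrow> \<mu> \<beta> = \<infinity> \<Longrightarrow> k \<in> {1..n} \<Longrightarrow> card (V \<beta> k) = d \<beta>"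
    and "\<And>\<beta> k. \<beta> \<in> K \<Longrightarrow> \<mu> \<beta> = \<infinity> \<Longrightarrow> k \<in> {1..n} \<Longrightarrow> V \<beta> k \<subseteq> W \<beta>"
    and "\<And>\<beta>. \<beta> \<in> K \<Longrightarrow> \<mu> \<beta> = \<infinity> \<Longrightarrow> W \<beta> = (\<Union>k\<in>{1..n}. V \<beta> k)"
    and "\<And>\<beta> k k'. \<beta> \<in> K \<Longrightarrow> \<mu> \<beta> = \<infinity> \<Longrightarrow> k \<in> {1..n} \<Longrightarrow> k' \<in> {1..n} \<Longrightarrow> k \<noteq> k' \<Longrightarrow> V \<beta> k \<inter> V \<beta> k' = {}"
proof -
  show U: "(\<Union>\<beta>\<in>K. W \<beta>) = {..<(\<Sum>\<beta>\<in>K. par_tau n \<mu> d \<beta>)}"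
    using assms by (simp add: block_choice_def)
  show "\<And>\<beta>. \<beta> \<in> K \<Longrightarrow> finite (W \<beta>)"
    using U by (metis UN_upper finite_lessThan finite_subset)
  show union: "W \<beta> = (\<Union>k\<in>{1..n}. V \<beta> k)" if "\<beta> \<in> K" "\<mu> \<beta> = \<infinity>" for \<beta>
    using assms that by (auto simp: block_choice_def)
  show "V \<beta> k \<subseteq> W \<beta>" if "\<beta> \<in> K" "\<mu> \<beta> = \<infinity>" "k \<in> {1..n}" for \<beta> k
    using union[OF that(1,2)] that(3) by blast
qed (use assms in \<open>simp_all add: block_choice_def disjoint_family_on_def\<close>)

lemma finite_cross_pairs:
  assumes "block_choice n (K, \<mu>, d) W V"
  shows "finite (cross_pairs K W)"
proof (rule finite_subset)
  let ?M = "{..<(\<Sum>\<beta>\<in>K. par_tau n \<mu> d \<beta>)}"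
  show "cross_pairs K W \<subseteq> ?M \<times> ?M"
    unfolding block_choiceD(2)[OF assms, symmetric] by (auto simp: cross_pairs_def)
qed simp

lemma h_elem_in_frakP:
  fixes l :: "'i::finite \<Rightarrow> enat" and Z :: "('i, 'a::comm_ring_1) S0 set set"
  assumes e: "weighting UNIV e" "reduced UNIV l e" and U: "partition_of_type l U"
    and x: "(K, \<mu>, d) \<in> wcomps" and nle: "\<not> (K, \<mu>, d) \<preceq> (UNIV, l, e)"
    and bc: "block_choice (par_n (UNIV, l, e)) (K, \<mu>, d) W V"
  shows "h_elem (par_n (UNIV, l, e)) (par_N (UNIV, l, e)) (K, \<mu>, d) W V \<in> frakP U e Z"
  unfolding frakP_def
proof (intro CollectI ballI)
  define n where "n = par_n (UNIV, l, e)"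
  define N where "N = par_N (UNIV, l, e)"
  fix \<sigma> assume \<sigma>: "\<sigma> \<in> Sym_inf"
  define p where "p i = block_index U (\<sigma> i)" for i
  let ?Q = "frakQ U e Z"
  have Q: "is_ideal ?Q"
    by (simp add: frakQ_eq_pow_ideal is_ideal_pow_ideal)
  have eps: "Var i ^ e (block_index U i) \<in> ?Q" for i
    unfolding frakQ_def by (intro ideal_gen_base) auto
  define X :: "nat \<Rightarrow> ('i, 'a) Stilde" where "X = (\<lambda>i. iota U (Var (\<sigma> i)))"
  have Xdiff: "X i - X j = Var (\<sigma> i) - Var (\<sigma> j)" if "p i = p j" for i j
    using that by (simp add: X_def iota_Var p_def)
  have bc: "block_choice n (K, \<mu>, d) W V"
    using bc by (simp add: n_def)
  have K: "finite K"
    using x by (auto simp: wcomps_def infinity_composition_def)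
  have h_eq: "iota U (act \<sigma> (h_elem n N (K, \<mu>, d) W V)) =
     (\<Prod>\<beta>\<in>{\<beta>\<in>K. \<mu> \<beta> = \<infinity>}. \<Prod>k\<in>{1..n}. vand X (V \<beta> k)) *
     (\<Prod>(i, j)\<in>cross_pairs K W. (X i - X j) ^ N)"
    using rhom_h_elem[OF rhom_comp[OF rhom_iota rhom_act], of U \<sigma> n N K \<mu> d W V]
    by (simp add: X_def)
  have e_le: "e \<alpha> + e \<beta> \<le> Suc N" for \<alpha> \<beta>
  proof -
    define M where "M = Max (e ` UNIV)"
    have "e \<alpha> \<le> M" "e \<beta> \<le> M"
      by (auto simp: M_def)
    moreover have "N = 2 * M - 1"
      by (simp add: N_def par_N_def M_def)
    ultimately show ?thesis
      by linarith
  qed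
  show "iota U (act \<sigma> (h_elem (par_n (UNIV, l, e)) (par_N (UNIV, l, e)) (K, \<mu>, d) W V)) \<in> ?Q"
    unfolding n_def[symmetric] N_def[symmetric]
  proof (rule ccontr)
    assume notin: "iota U (act \<sigma> (h_elem n N (K, \<mu>, d) W V)) \<notin> ?Q"
    \<comment> \<open>If both indices lay in one block, the t-parts would cancel and the factor
      would be the \<open>N\<close>-th power of a difference of two \<epsilon>'s.\<close>
    have ppair: "p i \<noteq> p j" if ij: "(i, j) \<in> cross_pairs K W" for i j
    proof
      assume "p i = p j"
      then have "(X i - X j) ^ N \<in> ?Q"
        unfolding Xdiff[OF \<open>p i = p j\<close>] by (intro ideal_power_diff[OF Q eps eps] e_le)
      moreover have "(X i - X j) ^ N dvd (\<Prod>(i, j)\<in>cross_pairs K W. (X i - X j) ^ N)"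
        using dvd_prodI[OF finite_cross_pairs[OF bc] ij, of "\<lambda>(i, j). (X i - X j) ^ N"] by simp
      ultimately show False
        using notin ideal_dvd[OF Q] ideal_mult_left[OF Q] unfolding h_eq by blast
    qed
    have pW: "p i \<noteq> p j" if "\<beta> \<in> K" "\<gamma> \<in> K" "\<beta> \<noteq> \<gamma>" "i \<in> W \<beta>" "j \<in> W \<gamma>" for i j \<beta> \<gamma>
    proof -
      have "i \<noteq> j"
        using block_choiceD(1)[OF bc that(1-3)] that by auto
      then have "(i, j) \<in> cross_pairs K W \<or> (j, i) \<in> cross_pairs K W"
        using that linorder_neqE_nat[OF \<open>i \<noteq> j\<close>] unfolding cross_pairs_def by blast
      then show ?thesis
        using ppair by metis
    qed
    \<comment> \<open>Too many points over one \<open>\<alpha>\<close> give a Vandermonde product in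
      the \<epsilon>'s that vanishes by \<open>vand_in_ideal\<close> and divides the whole
      element.\<close>
    have pV: "card {i\<in>V \<beta> k. p i = \<alpha>} \<le> e \<alpha>" if b: "\<beta> \<in> K" "\<mu> \<beta> = \<infinity>" "k \<in> {1..n}" for \<beta> k \<alpha>
    proof (rule ccontr)
      let ?S = "{i\<in>V \<beta> k. p i = \<alpha>}"
      assume "\<not> card ?S \<le> e \<alpha>"
      have fin: "finite (V \<beta> k)"
        using block_choiceD(4,6)[OF bc] b by (metis finite_subset)
      have "vand (\<lambda>i. Var (\<sigma> i)) ?S \<in> ?Q"
      proof (rule vand_in_ideal[OF Q, of _ "e \<alpha>"])
        show "Var (\<sigma> i) ^ e \<alpha> \<in> ?Q" if "i \<in> ?S" for i
          using eps[of "\<sigma> i"] that by (auto simp: p_def)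
      qed (use fin \<open>\<not> card ?S \<le> e \<alpha>\<close> in auto)
      moreover have "vand X ?S = vand (\<lambda>i. Var (\<sigma> i)) ?S"
        by (rule vand_cong) (auto simp: Xdiff)
      ultimately have in_Q: "vand X ?S \<in> ?Q"
        by simp
      have d1: "vand X ?S dvd vand X (V \<beta> k)"
        using fin by (intro vand_subset_dvd) auto
      have d2: "vand X (V \<beta> k) dvd (\<Prod>k\<in>{1..n}. vand X (V \<beta> k))"
        using b(3) by (intro dvd_prodI) auto
      have d3: "(\<Prod>k\<in>{1..n}. vand X (V \<beta> k)) dvd
          (\<Prod>\<beta>\<in>{\<beta>\<in>K. \<mu> \<beta> = \<infinity>}. \<Prod>k\<in>{1..n}. vand X (V \<beta> k))"
        using K b by (intro dvd_prodI[of _ _ "\<lambda>\<beta>. \<Prod>k\<in>{1..n}. vand X (V \<beta> k)"]) auto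
      have "(\<Prod>\<beta>\<in>{\<beta>\<in>K. \<mu> \<beta> = \<infinity>}. \<Prod>k\<in>{1..n}. vand X (V \<beta> k)) \<in> ?Q"
        by (rule ideal_dvd[OF Q in_Q dvd_trans[OF d1 dvd_trans[OF d2 d3]]])
      then show False
        using notin ideal_mult_right[OF Q] unfolding h_eq by blast
    qed
    define E where "E = {\<alpha>. \<exists>\<beta>\<in>K. \<exists>i\<in>W \<beta>. p i = \<alpha>}"
    \<comment> \<open>By \<open>pW\<close> an index \<open>\<alpha>\<close> is met by a single
      block, so the choice is forced on \<open>E\<close>.\<close>
    define \<phi> where "\<phi> \<alpha> = (SOME \<beta>. \<beta> \<in> K \<and> (\<exists>i\<in>W \<beta>. p i = \<alpha>))" for \<alpha>
    have \<phi>: "\<phi> \<alpha> \<in> K \<and> (\<exists>i\<in>W (\<phi> \<alpha>). p i = \<alpha>)" if "\<alpha> \<in> E" for \<alpha>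
      unfolding \<phi>_def by (rule someI_ex) (use that in \<open>auto simp: E_def\<close>)
    have \<phi>p: "\<phi> (p i) = \<beta>" "p i \<in> E" if "\<beta> \<in> K" "i \<in> W \<beta>" for i \<beta>
    proof -
      show pE: "p i \<in> E"
        using that by (auto simp: E_def)
      obtain j where j: "\<phi> (p i) \<in> K" "j \<in> W (\<phi> (p i))" "p j = p i"
        using \<phi>[OF pE] by blast
      show "\<phi> (p i) = \<beta>"
        using pW[OF j(1) that(1) _ j(2) that(2)] j(3) by blast
    qed
    have pU: "card {i\<in>S. p i = \<alpha>} \<le> card (U \<alpha>)" if "finite (U \<alpha>)" for S \<alpha>
    proof -
      have "card {i\<in>S. p i = \<alpha>} = card (\<sigma> ` {i\<in>S. p i = \<alpha>})"
        using Sym_inf_inj[OF \<sigma>] by (intro card_image[symmetric]) (auto intro: inj_on_subset)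
      also have "\<dots> \<le> card (U \<alpha>)"
        using that block_index_mem[OF U] by (intro card_mono) (auto simp: p_def)
      finally show ?thesis .
    qed
    have size: "esize (U \<alpha>) = l \<alpha>" for \<alpha>
      using U by (auto simp: partition_of_type_def)
    have fib: "enat (card {i\<in>S. p i = \<alpha>}) \<le> l \<alpha>" for S \<alpha>
      using pU[of \<alpha> S] size[of \<alpha>, symmetric] by (auto simp: esize_def)
    \<comment> \<open>Pigeonhole: \<open>n\<close> exceeds by one the number of indices in finite
      blocks, so some sub-block lies entirely over infinite blocks. This sub-block provides both
      inequalities of the order at an infinite \<open>\<beta>\<close>.\<close>
    have fin_block: "\<exists>k\<in>{1..n}. \<forall>i\<in>V \<beta> k. l (p i) = \<infinity>" if b: "\<beta> \<in> K" "\<mu> \<beta> = \<infinity>" for \<beta>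
    proof (rule ccontr)
      assume "\<not> ?thesis"
      then have "\<forall>k\<in>{1..n}. \<exists>i. i \<in> V \<beta> k \<and> l (p i) \<noteq> \<infinity>"
        by blast
      then obtain f where f: "\<And>k. k \<in> {1..n} \<Longrightarrow> f k \<in> V \<beta> k \<and> l (p (f k)) \<noteq> \<infinity>"
        using bchoice[of "{1..n}" "\<lambda>k i. i \<in> V \<beta> k \<and> l (p i) \<noteq> \<infinity>"] by blast
      define F where "F = (\<Union>\<alpha>\<in>{\<alpha>. l \<alpha> \<noteq> \<infinity>}. U \<alpha>)"
      have finU: "finite (U \<alpha>)" "card (U \<alpha>) = the_enat (l \<alpha>)" if "l \<alpha> \<noteq> \<infinity>" for \<alpha>
        using size[of \<alpha>] that by (auto simp: esize_def split: if_splits)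
      have "inj_on (\<sigma> \<circ> f) {1..n}"
      proof (rule comp_inj_on)
        show "inj_on f {1..n}"
          using f block_choiceD(8)[OF bc b] by (intro inj_onI) (metis disjoint_iff)
      qed (use Sym_inf_inj[OF \<sigma>] in \<open>auto intro: inj_on_subset\<close>)
      moreover have "(\<sigma> \<circ> f) ` {1..n} \<subseteq> F"
        using f block_index_mem[OF U] unfolding F_def p_def by fastforce
      moreover have "finite F"
        using finU by (auto simp: F_def)
      ultimately have "card {1..n} \<le> card F"
        by (metis card_inj_on_le)
      also have "card F \<le> (\<Sum>\<alpha>\<in>{\<alpha>. l \<alpha> \<noteq> \<infinity>}. card (U \<alpha>))"
        unfolding F_def by (rule card_UN_le) simp
      also have "\<dots> = (\<Sum>\<alpha>\<in>{\<alpha>. l \<alpha> \<noteq> \<infinity>}. the_enat (l \<alpha>))"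
        using finU by (intro sum.cong) auto
      also have "\<dots> < n"
        by (simp add: n_def par_n_def)
      finally show False
        by simp
    qed
    have "(K, \<mu>, d) \<preceq> (UNIV, l, e)"
      unfolding wcomp_le_def prod.case
    proof (intro exI conjI ballI impI)
      show "E \<subseteq> UNIV" "\<phi> ` E \<subseteq> K"
        using \<phi> by auto
    next
      fix \<beta> assume b: "\<beta> \<in> K"
      show "\<mu> \<beta> \<le> (\<Sum>\<alpha>\<in>{\<alpha>\<in>E. \<phi> \<alpha> = \<beta>}. l \<alpha>)"
      proof (cases "\<mu> \<beta> = \<infinity>")
        case True
        then obtain k where k: "k \<in> {1..n}" "\<forall>i\<in>V \<beta> k. l (p i) = \<infinity>"
          using fin_block b by blast
        have "1 \<le> d \<beta>"
          using x b by (auto simp: wcomps_def weighting_def)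
        then have "V \<beta> k \<noteq> {}"
          using block_choiceD(5)[OF bc b True k(1)] by auto
        then obtain i where i: "i \<in> V \<beta> k" by blast
        then have "i \<in> W \<beta>"
          using block_choiceD(6)[OF bc b True k(1)] by blast
        then have "p i \<in> {\<alpha>\<in>E. \<phi> \<alpha> = \<beta>}"
          using \<phi>p b by auto
        then have "(\<Sum>\<alpha>\<in>{\<alpha>\<in>E. \<phi> \<alpha> = \<beta>}. l \<alpha>) = \<infinity>"
          using k i by (intro sum_enat_infinity[of _ "p i"]) auto
        then show ?thesis
          by simp
      next
        case False
        have "\<mu> \<beta> = enat (card (W \<beta>))"
          using False block_choiceD(3)[OF bc b] by (auto simp: par_tau_def)
        also have "card (W \<beta>) = (\<Sum>\<alpha>\<in>{\<alpha>\<in>E. \<phi> \<alpha> = \<beta>}. card {i\<in>W \<beta>. p i = \<alpha>})"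
          using block_choiceD(4)[OF bc b] \<phi>p[OF b] by (intro card_eq_sum_fibers) auto
        also have "enat \<dots> = (\<Sum>\<alpha>\<in>{\<alpha>\<in>E. \<phi> \<alpha> = \<beta>}. enat (card {i\<in>W \<beta>. p i = \<alpha>}))"
          by (rule enat_sum)
        also have "\<dots> \<le> (\<Sum>\<alpha>\<in>{\<alpha>\<in>E. \<phi> \<alpha> = \<beta>}. l \<alpha>)"
          by (intro sum_mono fib)
        finally show ?thesis .
      qed
    next
      fix \<beta> assume b: "\<beta> \<in> K" "\<mu> \<beta> = \<infinity>"
      then obtain k where k: "k \<in> {1..n}" "\<forall>i\<in>V \<beta> k. l (p i) = \<infinity>"
        using fin_block b by blast
      have sub: "V \<beta> k \<subseteq> W \<beta>"
        using block_choiceD(6)[OF bc b k(1)] .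
      have fin: "finite (V \<beta> k)"
        using sub block_choiceD(4)[OF bc b(1)] finite_subset by blast
      have "d \<beta> = card (V \<beta> k)"
        using block_choiceD(5)[OF bc b k(1)] by simp
      also have "\<dots> = (\<Sum>\<alpha>\<in>{\<alpha>\<in>E. \<phi> \<alpha> = \<beta> \<and> l \<alpha> = \<infinity>}. card {i\<in>V \<beta> k. p i = \<alpha>})"
        using fin sub \<phi>p[OF b(1)] k(2) by (intro card_eq_sum_fibers) auto
      also have "\<dots> \<le> (\<Sum>\<alpha>\<in>{\<alpha>\<in>E. \<phi> \<alpha> = \<beta> \<and> l \<alpha> = \<infinity>}. e \<alpha>)"
        by (intro sum_mono pV b k(1))
      finally show "d \<beta> \<le> (\<Sum>\<alpha>\<in>{\<alpha>\<in>E. \<phi> \<alpha> = \<beta> \<and> l \<alpha> = \<infinity>}. e \<alpha>)" .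
    qed
    then show False
      using nle by simp
  qed
qed

section \<open>The partially ordered set \<open>\<Xi>\<close>\<close>

lemma wcomp_le_iff:
  "(K, \<mu>, d) \<preceq> (I, l, e) \<longleftrightarrow> (\<exists>E \<phi>. E \<subseteq> I \<and> \<phi> ` E \<subseteq> K \<and>
       (\<forall>\<beta>\<in>K. \<mu> \<beta> \<le> (\<Sum>\<alpha>\<in>{\<alpha>\<in>E. \<phi> \<alpha> = \<beta>}. l \<alpha>)) \<and>
       (\<forall>\<beta>\<in>K. \<mu> \<beta> = \<infinity> \<longrightarrow> d \<beta> \<le> (\<Sum>\<alpha>\<in>{\<alpha>\<in>E. \<phi> \<alpha> = \<beta> \<and> l \<alpha> = \<infinity>}. e \<alpha>)))"
  by (simp add: wcomp_le_def)

text \<open>The partial maps compose on those points that \<open>\<phi>2\<close> sends into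
  \<open>E1\<close>; the inequalities are summed over the fibres.\<close>

lemma wcomp_le_trans:
  fixes K :: "'k set" and L :: "'j set" and I :: "'i set"
  assumes fin: "finite L" "finite I"
    and 1: "(K, \<mu>, d) \<preceq> (L, \<nu>, c)" and 2: "(L, \<nu>, c) \<preceq> (I, l, e)"
  shows "(K, \<mu>, d) \<preceq> (I, l, e)"
proof -
  obtain E1 \<phi>1 where E1: "E1 \<subseteq> L" "\<phi>1 ` E1 \<subseteq> K"
    "\<And>\<beta>. \<beta> \<in> K \<Longrightarrow> \<mu> \<beta> \<le> (\<Sum>\<gamma>\<in>{\<gamma>\<in>E1. \<phi>1 \<gamma> = \<beta>}. \<nu> \<gamma>)"
    "\<And>\<beta>. \<beta> \<in> K \<Longrightarrow> \<mu> \<beta> = \<infinity> \<Longrightarrow> d \<beta> \<le> (\<Sum>\<gamma>\<in>{\<gamma>\<in>E1. \<phi>1 \<gamma> = \<beta> \<and> \<nu> \<gamma> = \<infinity>}. c \<gamma>)"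
    using 1 unfolding wcomp_le_iff by blast
  obtain E2 \<phi>2 where E2: "E2 \<subseteq> I" "\<phi>2 ` E2 \<subseteq> L"
    "\<And>\<beta>. \<beta> \<in> L \<Longrightarrow> \<nu> \<beta> \<le> (\<Sum>\<gamma>\<in>{\<gamma>\<in>E2. \<phi>2 \<gamma> = \<beta>}. l \<gamma>)"
    "\<And>\<beta>. \<beta> \<in> L \<Longrightarrow> \<nu> \<beta> = \<infinity> \<Longrightarrow> c \<beta> \<le> (\<Sum>\<gamma>\<in>{\<gamma>\<in>E2. \<phi>2 \<gamma> = \<beta> \<and> l \<gamma> = \<infinity>}. e \<gamma>)"
    using 2 unfolding wcomp_le_iff by blast
  have finE: "finite E1" "finite E2"
    using fin E1(1) E2(1) finite_subset by auto
  define E where "E = {\<alpha>\<in>E2. \<phi>2 \<alpha> \<in> E1}"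
  define \<phi> where "\<phi> = \<phi>1 \<circ> \<phi>2"
  show ?thesis
    unfolding wcomp_le_iff
  proof (intro exI conjI ballI impI)
    show "E \<subseteq> I" "\<phi> ` E \<subseteq> K"
      using E1 E2 by (auto simp: E_def \<phi>_def)
  next
    fix \<beta> assume b: "\<beta> \<in> K"
    let ?T = "{\<gamma>\<in>E1. \<phi>1 \<gamma> = \<beta>}"
    let ?S = "{\<alpha>\<in>E. \<phi> \<alpha> = \<beta>}"
    have "\<mu> \<beta> \<le> (\<Sum>\<gamma>\<in>?T. \<nu> \<gamma>)"
      using E1(3) b .
    also have "\<dots> \<le> (\<Sum>\<gamma>\<in>?T. \<Sum>\<alpha>\<in>{\<alpha>\<in>E2. \<phi>2 \<alpha> = \<gamma>}. l \<alpha>)"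
      using E1(1) E2(3) by (intro sum_mono) auto
    also have "\<dots> = (\<Sum>\<gamma>\<in>?T. \<Sum>\<alpha>\<in>{\<alpha>\<in>?S. \<phi>2 \<alpha> = \<gamma>}. l \<alpha>)"
      by (intro sum.cong refl arg_cong2[of _ _ _ _ sum]) (auto simp: E_def \<phi>_def)
    also have "\<dots> = (\<Sum>\<alpha>\<in>?S. l \<alpha>)"
      using finE by (intro sum.group) (auto simp: E_def \<phi>_def)
    finally show "\<mu> \<beta> \<le> (\<Sum>\<alpha>\<in>?S. l \<alpha>)" .
  next
    fix \<beta> assume b: "\<beta> \<in> K" "\<mu> \<beta> = \<infinity>"
    let ?T = "{\<gamma>\<in>E1. \<phi>1 \<gamma> = \<beta> \<and> \<nu> \<gamma> = \<infinity>}"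
    \<comment> \<open>Weights pass only through infinite blocks of \<open>L\<close>, hence the last
      condition; dropping it at the end can only enlarge the sum.\<close>
    let ?S = "{\<alpha>\<in>E. \<phi> \<alpha> = \<beta> \<and> l \<alpha> = \<infinity> \<and> \<nu> (\<phi>2 \<alpha>) = \<infinity>}"
    have "d \<beta> \<le> (\<Sum>\<gamma>\<in>?T. c \<gamma>)"
      using E1(4) b .
    also have "\<dots> \<le> (\<Sum>\<gamma>\<in>?T. \<Sum>\<alpha>\<in>{\<alpha>\<in>E2. \<phi>2 \<alpha> = \<gamma> \<and> l \<alpha> = \<infinity>}. e \<alpha>)"
      using E1(1) E2(4) by (intro sum_mono) auto
    also have "\<dots> = (\<Sum>\<gamma>\<in>?T. \<Sum>\<alpha>\<in>{\<alpha>\<in>?S. \<phi>2 \<alpha> = \<gamma>}. e \<alpha>)"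
      by (intro sum.cong refl arg_cong2[of _ _ _ _ sum]) (auto simp: E_def \<phi>_def)
    also have "\<dots> = (\<Sum>\<alpha>\<in>?S. e \<alpha>)"
      using finE by (intro sum.group) (auto simp: E_def \<phi>_def)
    also have "\<dots> \<le> (\<Sum>\<alpha>\<in>{\<alpha>\<in>E. \<phi> \<alpha> = \<beta> \<and> l \<alpha> = \<infinity>}. e \<alpha>)"
      using finE by (intro sum_mono2) (auto simp: E_def)
    finally show "d \<beta> \<le> (\<Sum>\<alpha>\<in>{\<alpha>\<in>E. \<phi> \<alpha> = \<beta> \<and> l \<alpha> = \<infinity>}. e \<alpha>)" .
  qed
qed

section \<open>Isomorphism classes and well-foundedness of the order\<close>

lemma wcomp_iso_iff:
  "((K, \<mu>, d), (L, \<nu>, c)) \<in> wcomp_iso \<longleftrightarrow> (K, \<mu>, d) \<in> wcomps \<and> (L, \<nu>, c) \<in> wcomps \<and>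
     (\<exists>f. bij_betw f K L \<and> (\<forall>\<beta>\<in>K. \<nu> (f \<beta>) = \<mu> \<beta> \<and> c (f \<beta>) = d \<beta>))"
  by (simp add: wcomp_iso_def)

lemma equiv_wcomp_iso: "equiv (wcomps :: 'a wcomp set) wcomp_iso"
proof (rule equivI)
  show "wcomp_iso \<subseteq> wcomps \<times> wcomps"
    by (auto simp: wcomp_iso_def)
  show "refl_on wcomps wcomp_iso"
    by (auto simp: refl_on_def wcomp_iso_def intro: exI[of _ id])
  show "sym (wcomp_iso :: ('a wcomp \<times> 'a wcomp) set)"
  proof (rule symI)
    fix x y :: "'a wcomp" assume xy: "(x, y) \<in> wcomp_iso"
    obtain K \<mu> d L \<nu> c where eq: "x = (K, \<mu>, d)" "y = (L, \<nu>, c)"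
      by (metis prod_cases3)
    obtain f where f: "bij_betw f K L" "\<And>\<beta>. \<beta> \<in> K \<Longrightarrow> \<nu> (f \<beta>) = \<mu> \<beta> \<and> c (f \<beta>) = d \<beta>"
      and w: "x \<in> wcomps" "y \<in> wcomps"
      using xy unfolding eq wcomp_iso_iff by blast
    have "bij_betw (inv_into K f) L K"
      using f(1) by (rule bij_betw_inv_into)
    moreover have "\<mu> (inv_into K f \<beta>) = \<nu> \<beta> \<and> d (inv_into K f \<beta>) = c \<beta>" if "\<beta> \<in> L" for \<beta>
    proof -
      have "inv_into K f \<beta> \<in> K" "f (inv_into K f \<beta>) = \<beta>"
        using that f(1) by (auto simp: bij_betw_def inv_into_into f_inv_into_f)
      then show ?thesis
        using f(2)[of "inv_into K f \<beta>"] by simp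
    qed
    ultimately show "(y, x) \<in> wcomp_iso"
      using w unfolding eq wcomp_iso_iff by blast
  qed
  show "trans (wcomp_iso :: ('a wcomp \<times> 'a wcomp) set)"
  proof (rule transI)
    fix x y z :: "'a wcomp" assume xy: "(x, y) \<in> wcomp_iso" "(y, z) \<in> wcomp_iso"
    obtain K \<mu> d L \<nu> c M \<rho> b where eq: "x = (K, \<mu>, d)" "y = (L, \<nu>, c)" "z = (M, \<rho>, b)"
      by (metis prod_cases3)
    obtain f where f: "bij_betw f K L" "\<And>\<beta>. \<beta> \<in> K \<Longrightarrow> \<nu> (f \<beta>) = \<mu> \<beta> \<and> c (f \<beta>) = d \<beta>"
      using xy unfolding eq wcomp_iso_iff by blast
    obtain g where g: "bij_betw g L M" "\<And>\<beta>. \<beta> \<in> L \<Longrightarrow> \<rho> (g \<beta>) = \<nu> \<beta> \<and> b (g \<beta>) = c \<beta>"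
      using xy unfolding eq wcomp_iso_iff by blast
    have "bij_betw (g \<circ> f) K M"
      using f g by (blast intro: bij_betw_trans)
    moreover have "\<rho> ((g \<circ> f) \<beta>) = \<mu> \<beta> \<and> b ((g \<circ> f) \<beta>) = d \<beta>" if "\<beta> \<in> K" for \<beta>
      using f g that by (auto simp: bij_betw_def)
    ultimately show "(x, z) \<in> wcomp_iso"
      using xy unfolding eq wcomp_iso_iff by blast
  qed
qed

lemma wcomp_iso_sym: "(x, y) \<in> wcomp_iso \<Longrightarrow> (y, x) \<in> wcomp_iso"
  using equiv_wcomp_iso unfolding equiv_def by (blast dest: symD)

lemma wcomp_iso_wcomps: "(x, y) \<in> wcomp_iso \<Longrightarrow> x \<in> wcomps \<and> y \<in> wcomps"
  using equiv_wcomp_iso unfolding equiv_def by blast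

lemma wcomp_iso_le:
  assumes "(x, y) \<in> wcomp_iso"
  shows "x \<preceq> y"
proof -
  obtain K \<mu> d L \<nu> c where eq: "x = (K, \<mu>, d)" "y = (L, \<nu>, c)"
    by (metis prod_cases3)
  obtain f where f: "bij_betw f K L" "\<And>\<beta>. \<beta> \<in> K \<Longrightarrow> \<nu> (f \<beta>) = \<mu> \<beta> \<and> c (f \<beta>) = d \<beta>"
    using assms unfolding eq wcomp_iso_iff by blast
  define \<phi> where "\<phi> = inv_into K f"
  have inv: "\<phi> (f \<beta>) = \<beta>" if "\<beta> \<in> K" for \<beta>
    using f(1) that by (auto simp: \<phi>_def bij_betw_def)
  have S: "{\<alpha>\<in>L. \<phi> \<alpha> = \<beta>} = {f \<beta>}" if "\<beta> \<in> K" for \<beta>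
    using f(1) that inv by (auto simp: bij_betw_def)
  have S': "{\<alpha>\<in>L. \<phi> \<alpha> = \<beta> \<and> \<nu> \<alpha> = \<infinity>} = {f \<beta>}" if "\<beta> \<in> K" "\<mu> \<beta> = \<infinity>" for \<beta>
    using S[OF that(1)] f(2)[OF that(1)] that by auto
  show ?thesis
    unfolding eq wcomp_le_iff
  proof (intro exI conjI ballI impI)
    show "L \<subseteq> L" "\<phi> ` L \<subseteq> K"
      using f(1) inv by (auto simp: bij_betw_def)
  qed (use f(2) in \<open>simp_all add: S S'\<close>)
qed

text \<open>A rank for the order, compared lexicographically. The third entry adds up finite sizes
  and the weights of infinite blocks; at finite blocks a reduced weight carries no
  information.\<close>

definition wc_measure :: "'k wcomp \<Rightarrow> nat \<times> nat \<times> nat" where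
  "wc_measure = (\<lambda>(K, \<mu>, d). (card K, card {\<beta>\<in>K. \<mu> \<beta> = \<infinity>},
     \<Sum>\<beta>\<in>K. if \<mu> \<beta> = \<infinity> then d \<beta> else the_enat (\<mu> \<beta>)))"

abbreviation "lex3 \<equiv> less_than <*lex*> less_than <*lex*> less_than"

lemma sum_nat_eqD:
  fixes f g :: "'b \<Rightarrow> nat"
  assumes "finite L" "\<And>x. x \<in> L \<Longrightarrow> f x \<le> g x" "sum g L \<le> sum f L" "a \<in> L"
  shows "f a = g a"
proof (rule ccontr)
  assume "f a \<noteq> g a"
  then have "f a < g a"
    using assms(2)[OF assms(4)] by simp
  then have "sum f L < sum g L"
    using assms by (intro sum_strict_mono_ex1) auto
  then show False
    using assms(3) by simp
qed

text \<open>Positivity of \<open>\<mu>\<close> makes \<open>\<phi>\<close> surjective, so the number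
  of blocks can only grow. If it does not, \<open>\<phi>\<close> is bijective and infinite blocks go
  to infinite ones; if their number agrees too, sizes and weights compare pointwise, and equal sums
  force an isomorphism.\<close>

lemma wcomp_le_measure:
  assumes x: "x \<in> wcomps" and y: "y \<in> wcomps" and le: "x \<preceq> y"
  shows "(x, y) \<in> wcomp_iso \<or> (wc_measure x, wc_measure y) \<in> lex3"
proof (rule disjCI)
  assume nlt: "(wc_measure x, wc_measure y) \<notin> lex3"
  obtain K \<mu> d L \<nu> c where eq: "x = (K, \<mu>, d)" "y = (L, \<nu>, c)"
    by (metis prod_cases3)
  have fin: "finite K" "finite L" and mu: "\<And>\<beta>. \<beta> \<in> K \<Longrightarrow> 1 \<le> \<mu> \<beta>"
    and red: "\<And>\<beta>. \<beta> \<in> K \<Longrightarrow> \<mu> \<beta> \<noteq> \<infinity> \<Longrightarrow> d \<beta> = 1" "\<And>\<beta>. \<beta> \<in> L \<Longrightarrow> \<nu> \<beta> \<noteq> \<infinity> \<Longrightarrow> c \<beta> = 1"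
    using x y by (auto simp: eq wcomps_def infinity_composition_def reduced_def)
  obtain E \<phi> where E: "E \<subseteq> L" "\<phi> ` E \<subseteq> K"
    "\<And>\<beta>. \<beta> \<in> K \<Longrightarrow> \<mu> \<beta> \<le> (\<Sum>\<gamma>\<in>{\<gamma>\<in>E. \<phi> \<gamma> = \<beta>}. \<nu> \<gamma>)"
    "\<And>\<beta>. \<beta> \<in> K \<Longrightarrow> \<mu> \<beta> = \<infinity> \<Longrightarrow> d \<beta> \<le> (\<Sum>\<gamma>\<in>{\<gamma>\<in>E. \<phi> \<gamma> = \<beta> \<and> \<nu> \<gamma> = \<infinity>}. c \<gamma>)"
    using le unfolding eq wcomp_le_iff by blast
  have finE: "finite E"
    using E(1) fin finite_subset by blast
  have surj: "\<phi> ` E = K"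
  proof (intro equalityI E(2) subsetI)
    fix \<beta> assume b: "\<beta> \<in> K"
    have "{\<gamma>\<in>E. \<phi> \<gamma> = \<beta>} \<noteq> {}"
      using E(3)[OF b] mu[OF b] by (metis not_one_le_zero order.trans sum.empty)
    then show "\<beta> \<in> \<phi> ` E"
      by blast
  qed
  have "card K \<le> card E" "card E \<le> card L"
    using surj finE card_image_le[of E \<phi>] card_mono[OF fin(2) E(1)] by auto
  moreover have "card L \<le> card K"
    using nlt by (auto simp: eq wc_measure_def)
  ultimately have cards: "card K = card E" "card E = card L"
    by auto
  then have EL: "E = L"
    using E(1) fin card_subset_eq by blast
  have inj: "inj_on \<phi> L"
    using eq_card_imp_inj_on[OF finE, of \<phi>] surj cards EL by simp
  then have bij: "bij_betw \<phi> L K"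
    using surj EL by (simp add: bij_betw_def)
  have K: "\<phi> \<gamma> \<in> K" if "\<gamma> \<in> L" for \<gamma>
    using that surj EL by auto
  have S: "{\<gamma>'\<in>E. \<phi> \<gamma>' = \<phi> \<gamma>} = {\<gamma>}" if "\<gamma> \<in> L" for \<gamma>
    using that inj EL by (auto simp: inj_on_def)
  have le1: "\<mu> (\<phi> \<gamma>) \<le> \<nu> \<gamma>" if "\<gamma> \<in> L" for \<gamma>
    using E(3)[OF K[OF that]] S[OF that] by simp
  have le2: "d (\<phi> \<gamma>) \<le> c \<gamma>" if "\<gamma> \<in> L" "\<mu> (\<phi> \<gamma>) = \<infinity>" for \<gamma>
  proof -
    have "{\<gamma>'\<in>E. \<phi> \<gamma>' = \<phi> \<gamma> \<and> \<nu> \<gamma>' = \<infinity>} = {\<gamma>}"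
      using S[OF that(1)] le1[OF that(1)] that(2) by auto
    then show ?thesis
      using E(4)[OF K[OF that(1)] that(2)] by simp
  qed
  let ?A = "{\<gamma>\<in>L. \<mu> (\<phi> \<gamma>) = \<infinity>}" and ?B = "{\<gamma>\<in>L. \<nu> \<gamma> = \<infinity>}"
  have AB: "?A \<subseteq> ?B"
    using le1 by force
  have "{\<beta>\<in>K. \<mu> \<beta> = \<infinity>} = \<phi> ` ?A"
    using surj EL by auto
  then have cA: "card {\<beta>\<in>K. \<mu> \<beta> = \<infinity>} = card ?A"
    using inj by (simp add: card_image inj_on_subset)
  have "card ?B \<le> card ?A"
    using nlt cards EL cA by (auto simp: eq wc_measure_def)
  then have ABeq: "?A = ?B"
    using AB fin by (intro card_seteq) auto
  then have cAB: "card {\<beta>\<in>K. \<mu> \<beta> = \<infinity>} = card ?B"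
    using cA by simp
  have inf: "\<mu> (\<phi> \<gamma>) = \<infinity> \<longleftrightarrow> \<nu> \<gamma> = \<infinity>" if "\<gamma> \<in> L" for \<gamma>
    using ABeq that by auto
  let ?f = "\<lambda>\<beta>. if \<mu> \<beta> = \<infinity> then d \<beta> else the_enat (\<mu> \<beta>)"
  let ?g = "\<lambda>\<gamma>. if \<nu> \<gamma> = \<infinity> then c \<gamma> else the_enat (\<nu> \<gamma>)"
  have fg: "?f (\<phi> \<gamma>) \<le> ?g \<gamma>" if "\<gamma> \<in> L" for \<gamma>
    using le1[OF that] le2[OF that] inf[OF that] by (auto simp: enat_ord_simps)
  have sumK: "(\<Sum>\<beta>\<in>K. ?f \<beta>) = (\<Sum>\<gamma>\<in>L. ?f (\<phi> \<gamma>))"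
    using sum.reindex_bij_betw[OF bij, of ?f] by simp
  have "(\<Sum>\<gamma>\<in>L. ?g \<gamma>) \<le> (\<Sum>\<gamma>\<in>L. ?f (\<phi> \<gamma>))"
    using nlt cards cAB EL unfolding sumK[symmetric] by (simp add: eq wc_measure_def)
  then have fg_eq: "?f (\<phi> \<gamma>) = ?g \<gamma>" if "\<gamma> \<in> L" for \<gamma>
    using sum_nat_eqD[OF fin(2), of "\<lambda>\<gamma>. ?f (\<phi> \<gamma>)" ?g \<gamma>, OF fg _ that] by simp
  have "\<mu> (\<phi> \<gamma>) = \<nu> \<gamma> \<and> d (\<phi> \<gamma>) = c \<gamma>" if "\<gamma> \<in> L" for \<gamma>
    using fg_eq[OF that] inf[OF that] red(1)[OF K[OF that]] red(2)[OF that]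
    by (cases "\<nu> \<gamma>"; cases "\<mu> (\<phi> \<gamma>)") auto
  then have "(y, x) \<in> wcomp_iso"
    using bij x y unfolding eq wcomp_iso_iff by blast
  then show "(x, y) \<in> wcomp_iso"
    by (rule wcomp_iso_sym)
qed

lemma finite_wcomps: "(K, \<mu>, d) \<in> wcomps \<Longrightarrow> finite K"
  by (simp add: wcomps_def infinity_composition_def)

lemma wcomps_le_trans:
  assumes "x \<preceq> y" "y \<preceq> z" "y \<in> wcomps" "z \<in> wcomps"
  shows "x \<preceq> z"
proof -
  obtain K \<mu> d L \<nu> c I l e where eq: "x = (K, \<mu>, d)" "y = (L, \<nu>, c)" "z = (I, l, e)"
    by (metis prod_cases3)
  show ?thesis
    using assms finite_wcomps unfolding eq by (metis wcomp_le_trans)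
qed

lemma Xi_class: "c \<in> Xi \<Longrightarrow> x \<in> c \<Longrightarrow> c = wcomp_iso `` {x}"
  unfolding Xi_def by (erule quotientE) (simp add: equiv_class_eq[OF equiv_wcomp_iso])

lemma Xi_wcomps: "c \<in> Xi \<Longrightarrow> x \<in> c \<Longrightarrow> x \<in> wcomps"
  unfolding Xi_def using in_quotient_imp_subset[OF equiv_wcomp_iso] by blast

text \<open>Induction on the rank: a class in \<open>Psi\<close> that is not minimal has a
  non-isomorphic one below it, whose rank is strictly smaller.\<close>

lemma exists_Psi0_below:
  assumes "x \<in> wcomps" "wcomp_iso `` {x} \<in> Psi y"
  shows "\<exists>c\<in>Psi0 y. \<forall>z\<in>c. z \<preceq> x"
proof -
  have wf: "wf (inv_image lex3 (wc_measure :: nat wcomp \<Rightarrow> _))"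
    by (rule wf_inv_image[OF wf_lex_prod[OF wf_less_than wf_lex_prod[OF wf_less_than wf_less_than]]])
  define P where "P x \<longleftrightarrow> (x \<in> wcomps \<longrightarrow> wcomp_iso `` {x} \<in> Psi y \<longrightarrow> (\<exists>c\<in>Psi0 y. \<forall>z\<in>c. z \<preceq> x))"
    for x :: "nat wcomp"
  have "P x"
  proof (rule wf_induct[OF wf, where P = P])
    fix x :: "nat wcomp"
    assume IH: "\<forall>z. (z, x) \<in> inv_image lex3 wc_measure \<longrightarrow> P z"
    show "P x"
      unfolding P_def
    proof (intro impI)
      assume "x \<in> wcomps" "wcomp_iso `` {x} \<in> Psi y"
      note 2 = IH this
      let ?c = "wcomp_iso `` {x}"
      show "\<exists>c\<in>Psi0 y. \<forall>z\<in>c. z \<preceq> x"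
      proof (cases "?c \<in> Psi0 y")
        case True
        have "z \<preceq> x" if "z \<in> ?c" for z
          using wcomp_iso_le[OF wcomp_iso_sym, of x z] that by simp
        then show ?thesis
          using True by blast
      next
        case False
        then obtain c' where c': "c' \<in> Psi y" "Xi_le c' ?c" "c' \<noteq> ?c"
          using 2(3) unfolding Psi0_def by blast
        then obtain x' x1 where x': "x' \<in> c'" "x1 \<in> ?c" "x' \<preceq> x1"
          unfolding Xi_le_def by blast
        have c'Xi: "c' \<in> Xi"
          using c' by (simp add: Psi_def)
        have "(x1, x) \<in> wcomp_iso"
          using wcomp_iso_sym[of x x1] x'(2) by simp
        then have "x1 \<preceq> x" "x1 \<in> wcomps"
          using wcomp_iso_le wcomp_iso_wcomps by blast+
        then have le: "x' \<preceq> x"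
          using wcomps_le_trans[OF x'(3)] 2 by blast
        have w: "x' \<in> wcomps" and cl: "c' = wcomp_iso `` {x'}"
          using Xi_wcomps[OF c'Xi x'(1)] Xi_class[OF c'Xi x'(1)] .
        have "(x', x) \<notin> wcomp_iso"
          using c'(3) cl equiv_class_eq[OF equiv_wcomp_iso] by blast
        then have "(x', x) \<in> inv_image lex3 wc_measure"
          using wcomp_le_measure[OF w _ le] 2 by (auto simp: in_inv_image)
        then obtain c where "c \<in> Psi0 y" "\<forall>z\<in>c. z \<preceq> x'"
          using IH w c'(1) cl unfolding P_def by blast
        then show ?thesis
          using wcomps_le_trans[OF _ le w] 2 by blast
      qed
    qed
  qed
  then show ?thesis
    using assms unfolding P_def by blast
qed

text \<open>One more infinite block than there are indices of \<lambda> cannot be covered by a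
  partial map. This guarantees that at least one h exists.\<close>

lemma Psi_nonempty:
  fixes l :: "'i::finite \<Rightarrow> enat"
  shows "\<exists>x\<in>wcomps. wcomp_iso `` {x} \<in> Psi (UNIV, l, e)"
proof -
  define K :: "nat set" where "K = {..card (UNIV :: 'i set)}"
  define x :: "nat wcomp" where "x = (K, \<lambda>_. \<infinity>, \<lambda>_. 1)"
  have x: "x \<in> wcomps"
    by (auto simp: x_def wcomps_def infinity_composition_def weighting_def reduced_def K_def)
  have "\<not> z \<preceq> (UNIV, l, e)" if "z \<in> wcomp_iso `` {x}" for z
  proof
    assume le: "z \<preceq> (UNIV, l, e)"
    obtain L \<nu> c where z: "z = (L, \<nu>, c)"
      by (metis prod_cases3)
    have "((K, \<lambda>_. \<infinity>, \<lambda>_. 1), (L, \<nu>, c)) \<in> wcomp_iso"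
      using that by (simp add: z x_def)
    then obtain f where "bij_betw f K L"
      unfolding wcomp_iso_iff by blast
    then have card: "card L = Suc (card (UNIV :: 'i set))"
      using bij_betw_same_card[of f K L] by (simp add: K_def)
    have pos: "\<And>\<beta>. \<beta> \<in> L \<Longrightarrow> 1 \<le> \<nu> \<beta>"
      using that by (auto simp: wcomp_iso_def z wcomps_def infinity_composition_def)
    obtain E \<phi> where E: "\<phi> ` E \<subseteq> L" "\<And>\<beta>. \<beta> \<in> L \<Longrightarrow> \<nu> \<beta> \<le> (\<Sum>\<gamma>\<in>{\<gamma>\<in>E. \<phi> \<gamma> = \<beta>}. l \<gamma>)"
      using le unfolding z wcomp_le_iff by blast
    have "L \<subseteq> \<phi> ` E"
    proof
      fix \<beta> assume b: "\<beta> \<in> L"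
      have "{\<gamma>\<in>E. \<phi> \<gamma> = \<beta>} \<noteq> {}"
        using E(2)[OF b] pos[OF b] by (metis not_one_le_zero order.trans sum.empty)
      then show "\<beta> \<in> \<phi> ` E"
        by blast
    qed
    then have "card L \<le> card (UNIV :: 'i set)"
      by (meson card_image_le card_mono finite finite_imageI order.trans subset_UNIV)
    then show False
      using card by simp
  qed
  moreover have "wcomp_iso `` {x} \<in> Xi"
    unfolding Xi_def using x by (rule quotientI)
  ultimately show ?thesis
    using x by (auto simp: Psi_def)
qed

section \<open>Equivariant primes of \<open>R\<close>\<close>

text \<open>This supplies \<open>fin\<close> of \<open>exists_equi_prime\<close>. A product involves
  at most \<open>c\<close> variables, and a permutation fixing \<open>W\<close> moves those outside
  \<open>W\<close> into the \<open>c\<close> places after \<open>b\<close>, so up to the group only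
  finitely many products occur.\<close>

lemma orbit_products_finite:
  fixes f :: "'a::comm_ring_1 R" and n :: nat
  assumes W: "finite W" "W0 \<subseteq> W"
  defines "X \<equiv> {(\<Prod>k<n. act (s k) f) |s. \<forall>k. s k \<in> Sym_inf \<and> (\<forall>w\<in>W0. s k w = w)}"
  shows "\<exists>F. finite F \<and> F \<subseteq> X \<and> (\<forall>K. inv_ideal (fixing W) K \<longrightarrow> F \<subseteq> K \<longrightarrow> X \<subseteq> K)"
proof -
  define c where "c = n * card (vars f)"
  obtain b where b: "W \<subseteq> {..<b}"
    using W(1) finite_nat_set_iff_bounded by auto
  define V where "V = {..<b + c}"
  define F where "F = {(\<Prod>k<n. act (s k) f) |s. (\<forall>k. s k \<in> Sym_inf \<and> (\<forall>w\<in>W0. s k w = w)) \<and> (\<forall>k<n. \<forall>i\<in>vars f. s k i \<in> V)}"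
  have "F \<subseteq> (\<lambda>t. \<Prod>k<n. act (t k) f) ` (PiE {..<n} (\<lambda>_. PiE (vars f) (\<lambda>_. V)))"
  proof
    fix x assume "x \<in> F"
    then obtain s where s: "x = (\<Prod>k<n. act (s k) f)" "\<forall>k<n. \<forall>i\<in>vars f. s k i \<in> V"
      by (auto simp: F_def)
    \<comment> \<open>Since \<open>act\<close> sees only values on \<open>vars f\<close>, the
      choices can be cut down to a finite function space.\<close>
    define t where "t = restrict (\<lambda>k. restrict (s k) (vars f)) {..<n}"
    have "x = (\<Prod>k<n. act (t k) f)"
      unfolding s by (intro prod.cong refl act_cong) (auto simp: t_def)
    moreover have "t \<in> PiE {..<n} (\<lambda>_. PiE (vars f) (\<lambda>_. V))"
      using s(2) by (auto simp: t_def)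
    ultimately show "x \<in> (\<lambda>t. \<Prod>k<n. act (t k) f) ` (PiE {..<n} (\<lambda>_. PiE (vars f) (\<lambda>_. V)))"
      by blast
  qed
  then have fin: "finite F"
    by (rule finite_subset) (auto intro!: finite_imageI finite_PiE simp: V_def)
  have FX: "F \<subseteq> X"
    by (auto simp: F_def X_def)
  have "X \<subseteq> K" if K: "inv_ideal (fixing W) K" "F \<subseteq> K" for K
  proof
    fix x assume "x \<in> X"
    then obtain s where s: "x = (\<Prod>k<n. act (s k) f)" "\<forall>k. s k \<in> Sym_inf \<and> (\<forall>w\<in>W0. s k w = w)"
      by (auto simp: X_def)
    define T where "T = (\<Union>k<n. s k ` vars f)"
    have T: "finite T"
      by (auto simp: T_def)
    have "card T \<le> (\<Sum>k<n. card (s k ` vars f))"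
      unfolding T_def by (rule card_UN_le) auto
    also have "\<dots> \<le> (\<Sum>k<n. card (vars f))"
      by (intro sum_mono card_image_le) auto
    finally have "card (T - W) \<le> card {b..<b + c}"
      using card_mono[OF T, of "T - W"] by (auto simp: c_def)
    then obtain g where g: "g ` (T - W) \<subseteq> {b..<b + c}" "inj_on g (T - W)"
      using card_le_inj[of "T - W" "{b..<b + c}"] T by auto
    define h where "h i = (if i \<in> W then i else g i)" for i
    have gW: "g i \<notin> W" if "i \<in> T" "i \<notin> W" for i
      using that g(1) b by force
    have "inj_on h (T \<union> W)"
      using g(2) gW by (auto simp: inj_on_def h_def)
    then obtain \<sigma> where \<sigma>: "\<sigma> \<in> Sym_inf" "\<And>i. i \<in> T \<union> W \<Longrightarrow> \<sigma> i = h i"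
      using Sym_inf_extend[of "T \<union> W" h] T W(1) by blast
    have sV: "\<sigma> i \<in> V" if "i \<in> T" for i
      using that \<sigma>(2)[of i] g(1) b by (auto simp: h_def V_def)
    have "act \<sigma> x = (\<Prod>k<n. act (\<sigma> \<circ> s k) f)"
      by (simp add: s act_act)
    also have "\<dots> \<in> F"
      unfolding F_def
    proof (intro CollectI exI conjI allI impI ballI)
      show "\<sigma> \<circ> s k \<in> Sym_inf" for k
        using s(2) \<sigma>(1) by (simp add: Sym_inf_comp)
      show "(\<sigma> \<circ> s k) w = w" if "w \<in> W0" for k w
        using s(2) \<sigma>(2)[of w] W(2) that by (auto simp: h_def)
      show "(\<sigma> \<circ> s k) i \<in> V" if "k < n" "i \<in> vars f" for k i
        using sV[of "s k i"] that by (auto simp: T_def)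
    qed (rule refl)
    finally have "act \<sigma> x \<in> K"
      using K by blast
    moreover have "act (inv \<sigma>) \<in> fixing W"
      using \<sigma> by (intro fixingI Sym_inf_inv inv_f_eq[OF Sym_inf_inj]) (auto simp: h_def)
    ultimately have "act (inv \<sigma>) (act \<sigma> x) \<in> K"
      using K by (auto simp: inv_ideal_def)
    then show "x \<in> K"
      using Sym_inf_inj[OF \<sigma>(1)] by (simp add: act_act act_id)
  qed
  then show ?thesis
    using fin FX by blast
qed

lemma ideal_gen_mult:
  assumes I: "is_ideal I" and AB: "\<And>a b. a \<in> A \<Longrightarrow> b \<in> B \<Longrightarrow> a * b \<in> I"
    and x: "x \<in> ideal_gen A" and y: "y \<in> ideal_gen B"
  shows "x * y \<in> I"
proof -
  have "x * b \<in> I" if "b \<in> B" for b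
    using ideal_gen_least[OF is_ideal_colon[OF I, of b], of A] AB that x by blast
  then have "B \<subseteq> {b. b * x \<in> I}"
    by (auto simp: mult.commute)
  then have "y * x \<in> I"
    using ideal_gen_least[OF is_ideal_colon[OF I, of x], of B] y by blast
  then show ?thesis
    by (simp add: mult.commute)
qed

lemma ideal_power_subset:
  fixes n :: nat
  assumes J: "is_ideal J" and "G \<noteq> {}" and "\<And>g. (\<And>k. g k \<in> G) \<Longrightarrow> (\<Prod>k<n. g k) \<in> J"
  shows "ideal_power (ideal_gen G) n \<subseteq> J"
proof -
  define P where "P n = {(\<Prod>k<n. g k) |g :: nat \<Rightarrow> 'a. \<forall>k. g k \<in> G}" for n :: nat
  have "ideal_power (ideal_gen G) n \<subseteq> ideal_gen (P n)"
  proof (induction n)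
    case 0
    have "1 \<in> P 0"
      using assms(2) by (auto simp: P_def)
    then have "x \<in> ideal_gen (P 0)" for x
      using ideal_mult_left[OF is_ideal_gen ideal_gen_base, of 1 "P 0" x] by simp
    then show ?case
      by auto
  next
    case (Suc n)
    have prod: "a * b \<in> ideal_gen (P (Suc n))" if a: "a \<in> G" and b: "b \<in> P n" for a b
    proof -
      obtain g where g: "b = (\<Prod>k<n. g k)" "\<forall>k. g k \<in> G"
        using b by (auto simp: P_def)
      have "a * b = (\<Prod>k<Suc n. case_nat a g k)"
        by (simp add: g(1) prod.lessThan_Suc_shift del: prod.lessThan_Suc)
      then have "a * b \<in> P (Suc n)"
        using a g(2) unfolding P_def by (intro CollectI exI[of _ "case_nat a g"]) (auto split: nat.split)
      then show ?thesis
        by (rule ideal_gen_base)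
    qed
    have "x * y \<in> ideal_gen (P (Suc n))" if "x \<in> ideal_gen G" "y \<in> ideal_power (ideal_gen G) n" for x y
      using ideal_gen_mult[OF is_ideal_gen prod that(1)] that(2) Suc.IH by blast
    then show ?case
      unfolding ideal_power.simps ideal_prod_def by (intro ideal_gen_least[OF is_ideal_gen]) auto
  qed
  also have "ideal_gen (P n) \<subseteq> J"
    using assms(3) by (intro ideal_gen_least[OF J]) (auto simp: P_def)
  finally show ?thesis .
qed

lemma inv_ideal_S_ideal_gen: "inv_ideal (fixing {}) (S_ideal_gen (G :: 'a::comm_ring_1 R set))"
  unfolding inv_ideal_def S_ideal_gen_def
proof (intro conjI ballI)
  let ?O = "\<Union>\<sigma>\<in>Sym_inf. act \<sigma> ` G"
  fix s :: "'a R \<Rightarrow> 'a R" and x assume "s \<in> fixing {}" and x: "x \<in> ideal_gen ?O"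
  then obtain \<sigma> where \<sigma>: "s = act \<sigma>" "\<sigma> \<in> Sym_inf"
    by (auto elim: fixingE)
  have "?O \<subseteq> {x. act \<sigma> x \<in> ideal_gen ?O}"
  proof
    fix y assume "y \<in> ?O"
    then obtain \<tau> g where "y = act \<tau> g" "\<tau> \<in> Sym_inf" "g \<in> G"
      by blast
    then have "act \<sigma> y \<in> ?O"
      using Sym_inf_comp[OF \<sigma>(2), of \<tau>] by (auto simp: act_act)
    then show "y \<in> {x. act \<sigma> x \<in> ideal_gen ?O}"
      by (simp only: mem_Collect_eq ideal_gen_base)
  qed
  then have "ideal_gen ?O \<subseteq> {x. act \<sigma> x \<in> ideal_gen ?O}"
    by (rule ideal_gen_least[OF is_ideal_vimage[OF rhom_act is_ideal_gen]])
  then show "s x \<in> ideal_gen ?O"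
    using subsetD[OF _ x] \<sigma>(1) by blast
qed (rule is_ideal_gen)

text \<open>The \<open>n\<close>-fold products of conjugates generate the \<open>n\<close>-th power
  of \<open>S_ideal_gen {f}\<close>, which therefore is a summand of the radical.\<close>

lemma in_S_radicalI:
  fixes f :: "'a::comm_ring_1 R" and n :: nat
  assumes J: "is_ideal J" and "\<And>s. (\<And>k. s k \<in> Sym_inf) \<Longrightarrow> (\<Prod>k<n. act (s k) f) \<in> J"
  shows "f \<in> S_radical J"
proof -
  let ?B = "S_ideal_gen {f}"
  have "is_S_ideal ?B"
    using inv_ideal_S_ideal_gen by (simp add: is_S_ideal_iff)
  moreover have "ideal_power ?B n \<subseteq> J"
    unfolding S_ideal_gen_def
  proof (rule ideal_power_subset[OF J])
    fix g :: "nat \<Rightarrow> 'a R" assume "\<And>k. g k \<in> (\<Union>\<sigma>\<in>Sym_inf. act \<sigma> ` {f})"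
    then have "\<forall>k. \<exists>\<sigma>\<in>Sym_inf. g k = act \<sigma> f"
      by blast
    then obtain s where "\<And>k. s k \<in> Sym_inf" "\<And>k. g k = act (s k) f"
      by metis
    then show "(\<Prod>k<n. g k) \<in> J"
      using assms(2) by simp
  qed (use Sym_inf_id in auto)
  moreover have "act id f \<in> ?B"
    unfolding S_ideal_gen_def using Sym_inf_id by (intro ideal_gen_base) blast
  then have "f \<in> ?B"
    by (simp add: act_id)
  ultimately show ?thesis
    unfolding S_radical_def by (intro ideal_gen_base) blast
qed

lemma prod_lessThan_add:
  fixes g :: "nat \<Rightarrow> 'r::comm_monoid_mult"
  shows "(\<Prod>k<m + n. g k) = (\<Prod>k<m. g k) * (\<Prod>k<n. g (m + k))"
  by (induction n) (simp_all add: mult.assoc)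

text \<open>The sets to avoid are the \<open>n\<close>-fold products of conjugates of
  \<open>f\<close>, one set for each \<open>n\<close>; that \<open>J\<close> avoids them is the
  contrapositive of \<open>in_S_radicalI\<close>.\<close>

lemma exists_S_prime:
  fixes f :: "'a::comm_ring_1 R"
  assumes J: "inv_ideal (fixing {}) J" and f: "f \<notin> S_radical J"
  shows "\<exists>p. equi_prime (fixing {}) p \<and> J \<subseteq> p \<and> f \<notin> p"
proof -
  define X where "X n = {(\<Prod>k<n. act (s k) f) |s. \<forall>k. s k \<in> Sym_inf}" for n :: nat
  have "\<exists>Q. equi_prime (fixing {}) Q \<and> J \<subseteq> Q \<and> (\<forall>Y\<in>range X. \<not> Y \<subseteq> Q)"
  proof (rule exists_equi_prime[OF aut_group_fixing J])
    show "\<not> Y \<subseteq> J" if Y: "Y \<in> range X" for Y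
    proof
      assume "Y \<subseteq> J"
      moreover obtain n where "Y = X n"
        using Y by blast
      ultimately have "f \<in> S_radical J"
        using J unfolding X_def inv_ideal_def by (intro in_S_radicalI[where n = n]) blast+
      then show False
        using f by blast
    qed
    show "\<exists>F. finite F \<and> F \<subseteq> Y \<and> (\<forall>K. inv_ideal (fixing {}) K \<longrightarrow> F \<subseteq> K \<longrightarrow> Y \<subseteq> K)"
      if "Y \<in> range X" for Y
      using that orbit_products_finite[of "{}" "{}" f] by (auto simp: X_def)
    show "\<exists>Z\<in>range X. Z \<subseteq> {x * y |x y. x \<in> Y \<and> y \<in> Y'}"
      if YY: "Y \<in> range X" "Y' \<in> range X" for Y Y'
    proof -
      obtain m n where mn: "Y = X m" "Y' = X n"
        using YY by blast
      have "X (m + n) \<subseteq> {x * y |x y. x \<in> Y \<and> y \<in> Y'}"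
      proof
        fix z assume "z \<in> X (m + n)"
        then obtain s where s: "z = (\<Prod>k<m + n. act (s k) f)" "\<forall>k. s k \<in> Sym_inf"
          by (auto simp: X_def)
        have "(\<Prod>k<m. act (s k) f) \<in> Y"
          using s(2) unfolding mn X_def by blast
        moreover have "(\<Prod>k<n. act (s (m + k)) f) \<in> Y'"
          using s(2) unfolding mn X_def by (intro CollectI exI[of _ "\<lambda>k. s (m + k)"]) simp
        ultimately
        show "z \<in> {x * y |x y. x \<in> Y \<and> y \<in> Y'}"
          unfolding s(1) prod_lessThan_add by blast
      qed
      then show ?thesis
        by blast
    qed
  qed auto
  then obtain p where p: "equi_prime (fixing {}) p" "J \<subseteq> p" "\<not> X 1 \<subseteq> p"
    by blast
  have "f \<notin> p"
  proof
    assume "f \<in> p"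
    then have "act \<sigma> f \<in> p" if "\<sigma> \<in> Sym_inf" for \<sigma>
      using equi_prime_inv[OF p(1)] that by (auto intro: fixingI)
    then show False
      using p(3) by (auto simp: X_def)
  qed
  then show ?thesis
    using p by blast
qed

text \<open>Enlarges the fixed set without losing information. The start is the colon ideal of
  \<open>q\<close> by \<open>y\<close>, stable since \<open>y\<close> is fixed by
  \<open>fixing W2\<close>; what is avoided are the full \<open>fixing W\<close>-orbits of all
  elements outside \<open>q\<close>. Primality of \<open>q\<close> keeps these orbits away from the
  colon ideal and closed under products.\<close>

lemma equi_prime_refine:
  fixes q :: "'a::comm_ring_1 R set"
  assumes q: "equi_prime (fixing W) q" and W: "W \<subseteq> W2" "finite W2"
    and y: "y \<notin> q" "\<And>s. s \<in> fixing W2 \<Longrightarrow> s y = y"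
  shows "\<exists>q2. equi_prime (fixing W2) q2 \<and> (\<forall>x. x * y \<in> q \<longrightarrow> x \<in> q2) \<and>
    (\<forall>x. x \<notin> q \<longrightarrow> (\<exists>s\<in>fixing W. s x \<notin> q2))"
proof -
  define X where "X x = {s x |s. s \<in> fixing W}" for x :: "'a R"
  have X_prod: "X x = {(\<Prod>k<1::nat. act (s k) x) |s. \<forall>k. s k \<in> Sym_inf \<and> (\<forall>w\<in>W. s k w = w)}" for x
  proof (intro equalityI subsetI)
    fix z assume "z \<in> X x"
    then obtain \<sigma> where "z = act \<sigma> x" "\<sigma> \<in> Sym_inf" "\<forall>w\<in>W. \<sigma> w = w"
      by (auto simp: X_def fixing_def)
    then show "z \<in> {(\<Prod>k<1::nat. act (s k) x) |s. \<forall>k. s k \<in> Sym_inf \<and> (\<forall>w\<in>W. s k w = w)}"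
      by (intro CollectI exI[of _ "\<lambda>_. \<sigma>"]) auto
  qed (auto simp: X_def fixing_def)
  have I: "is_ideal q"
    using q by (rule equi_prime_ideal)
  have "\<exists>Q. equi_prime (fixing W2) Q \<and> {x. x * y \<in> q} \<subseteq> Q \<and> (\<forall>Y\<in>X ` (- q). \<not> Y \<subseteq> Q)"
  proof (rule exists_equi_prime[OF aut_group_fixing])
    show "inv_ideal (fixing W2) {x. x * y \<in> q}"
      unfolding inv_ideal_def
    proof (intro conjI ballI CollectI is_ideal_colon[OF I])
      fix s :: "'a R \<Rightarrow> 'a R" and x assume s: "s \<in> fixing W2" and "x \<in> {x. x * y \<in> q}"
      then have "s (x * y) \<in> q"
        using equi_prime_inv[OF q] fixing_mono[OF W(1)] by blast
      moreover have "rhom s"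
        using s rhom_act by (auto elim: fixingE)
      ultimately show "s x * y \<in> q"
        using y(2)[OF s] by (simp add: rhom_mult)
    qed
    show "X ` (- q) \<noteq> {}"
      using y(1) by blast
    show "\<not> Y \<subseteq> {x. x * y \<in> q}" if Y: "Y \<in> X ` (- q)" for Y
    proof -
      obtain x where x: "x \<notin> q" "Y = X x"
        using Y by blast
      then obtain s where "s \<in> fixing W" "y * s x \<notin> q"
        using equi_primeD[OF q y(1)] by blast
      then show ?thesis
        unfolding x(2) X_def by (auto simp: mult.commute)
    qed
    show "\<exists>F. finite F \<and> F \<subseteq> Y \<and> (\<forall>K. inv_ideal (fixing W2) K \<longrightarrow> F \<subseteq> K \<longrightarrow> Y \<subseteq> K)"
      if Y: "Y \<in> X ` (- q)" for Y
    proof -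
      obtain x where "Y = X x"
        using Y by blast
      then show ?thesis
        using orbit_products_finite[OF W(2,1), of x 1] unfolding X_prod by simp
    qed
    show "\<exists>Z\<in>X ` (- q). Z \<subseteq> {x * y |x y. x \<in> Y \<and> y \<in> Y'}"
      if YY: "Y \<in> X ` (- q)" "Y' \<in> X ` (- q)" for Y Y'
    proof -
      obtain x x' where x: "x \<notin> q" "Y = X x" "x' \<notin> q" "Y' = X x'"
        using YY by blast
      then obtain s where s: "s \<in> fixing W" "x * s x' \<notin> q"
        using equi_primeD[OF q] by blast
      have "X (x * s x') \<subseteq> {x * y |x y. x \<in> Y \<and> y \<in> Y'}"
      proof
        fix z assume "z \<in> X (x * s x')"
        then obtain t where t: "t \<in> fixing W" "z = t (x * s x')"
          by (auto simp: X_def)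
        have "rhom t" "(\<lambda>u. t (s u)) \<in> fixing W"
          using aut_group_fixing[of W] t(1) s(1) by (auto simp: aut_group_def)
        then have "z = t x * t (s x')" "t x \<in> Y" "t (s x') \<in> Y'"
          using t unfolding x X_def by (auto simp: rhom_mult)
        then show "z \<in> {x * y |x y. x \<in> Y \<and> y \<in> Y'}"
          by blast
      qed
      then show ?thesis
        using s(2) by blast
    qed
  qed
  then obtain q2 where q2: "equi_prime (fixing W2) q2" "{x. x * y \<in> q} \<subseteq> q2" "\<forall>Y\<in>X ` (- q). \<not> Y \<subseteq> q2"
    by blast
  have "\<exists>s\<in>fixing W. s x \<notin> q2" if "x \<notin> q" for x
  proof -
    have "\<not> X x \<subseteq> q2"
      using q2(3) that by blast
    then show ?thesis
      by (auto simp: X_def)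
  qed
  then show ?thesis
    using q2 by blast
qed

text \<open>For fixed elements equivariant primality is ordinary primality: outside \<open>q\<close>
  they are nonzerodivisors modulo \<open>q\<close>.\<close>

lemma equi_prime_cancel:
  assumes q: "equi_prime H q" and c: "c \<notin> q" "\<And>s. s \<in> H \<Longrightarrow> s c = c" and x: "x * c \<in> q"
  shows "x \<in> q"
  using equi_primeD[OF q _ c(1), of x] c(2) x by (metis (no_types))

lemma equi_prime_prod:
  assumes q: "equi_prime H q" and f: "\<And>i s. i \<in> S \<Longrightarrow> s \<in> H \<Longrightarrow> s (f i) = f i"
    and notin: "\<And>i. i \<in> S \<Longrightarrow> f i \<notin> q"
  shows "x * prod f S \<in> q \<Longrightarrow> x \<in> q"
  using f notin
proof (induction S arbitrary: x rule: infinite_finite_induct)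
  case (insert i S)
  then have "x * f i \<in> q"
    by (simp add: mult.assoc)
  then show ?case
    using equi_prime_cancel[OF q, of "f i" x] insert.prems by auto
qed auto

lemma equi_prime_power:
  assumes q: "equi_prime H q" and c: "c \<notin> q" "\<And>s. s \<in> H \<Longrightarrow> s c = c"
  shows "x * c ^ n \<in> q \<Longrightarrow> x \<in> q"
  using equi_prime_prod[OF q, of "{..<n}" "\<lambda>_. c" x] c by simp

section \<open>Configurations of finitely many points\<close>

text \<open>Given an \<open>\<SS>\<close>-prime \<open>p\<close>, the ideal \<open>q\<close> is prime with respect to the permutations fixing the finite
  set \<open>W\<close> and determines \<open>p\<close> as the set of all \<open>f\<close> whose conjugates lie in \<open>q\<close>. Modulo \<open>q\<close> the variables
  in \<open>W\<close> are constants, with distinct values indexed by \<open>K\<close>, and each other variable differs from one of these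
  values by a nilpotent.\<close>

definition config ::
  "'a::comm_ring_1 R set \<Rightarrow> nat set \<Rightarrow> nat set \<Rightarrow> nat \<Rightarrow> 'a R set \<Rightarrow> bool" where
  "config p W K N q \<longleftrightarrow> finite W \<and> K \<subseteq> W \<and> equi_prime (fixing W) q \<and> p \<subseteq> q \<and>
     (\<forall>x. x \<notin> p \<longrightarrow> (\<exists>\<sigma>\<in>Sym_inf. act \<sigma> x \<notin> q)) \<and>
     (\<forall>a\<in>K. \<forall>b\<in>K. a \<noteq> b \<longrightarrow> Var a - Var b \<notin> q) \<and>
     (\<forall>w\<in>W. \<exists>a\<in>K. Var w - Var a \<in> q) \<and>
     (\<forall>i. i \<notin> W \<longrightarrow> (\<Prod>a\<in>K. (Var i - Var a) ^ N) \<in> q)"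

text \<open>Up to elements invertible modulo \<open>q\<close>, these are the idempotents that separate the possible limits of
  \<open>\<xi>\<^sub>i\<close>: \<open>away K N a i\<close> is nonzero only where \<open>\<xi>\<^sub>i\<close> is infinitely close to \<open>\<xi>\<^sub>a\<close>.\<close>

definition away :: "nat set \<Rightarrow> nat \<Rightarrow> nat \<Rightarrow> nat \<Rightarrow> 'a::comm_ring_1 R" where
  "away K N a i = (\<Prod>b\<in>K - {a}. (Var i - Var b) ^ N)"

lemma fixing_Var: "s \<in> fixing W \<Longrightarrow> w \<in> W \<Longrightarrow> s (Var w) = Var w"
  by (auto elim: fixingE)

lemma fixing_diff: "s \<in> fixing W \<Longrightarrow> s (x - y) = s x - s y"
  by (auto elim!: fixingE)

lemma act_away:
  assumes "\<And>w. w \<in> K \<Longrightarrow> \<sigma> w = w"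
  shows "act \<sigma> (away K N a i) = away K N a (\<sigma> i)"
  using assms by (simp add: away_def)

lemma fixing_move:
  assumes W: "finite W" and T: "finite T" "T \<inter> W = {}" and T': "finite T'" "T' \<inter> W = {}"
    and card: "card T = card T'"
  shows "\<exists>\<sigma>\<in>Sym_inf. (\<forall>w\<in>W. \<sigma> w = w) \<and> bij_betw \<sigma> T T'"
proof -
  obtain f where f: "bij_betw f T T'"
    using finite_same_card_bij[OF T(1) T'(1) card] by blast
  define g where "g i = (if i \<in> W then i else f i)" for i
  have "inj_on g (W \<union> T)"
    using f T(2) T'(2) by (auto simp: inj_on_def g_def bij_betw_def)
  then obtain \<sigma> where \<sigma>: "\<sigma> \<in> Sym_inf" "\<And>i. i \<in> W \<union> T \<Longrightarrow> \<sigma> i = g i"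
    using Sym_inf_extend[of "W \<union> T" g] W T(1) by blast
  have "bij_betw \<sigma> T T'"
    using f by (rule bij_betw_cong[THEN iffD1, rotated]) (use \<sigma>(2) T(2) in \<open>auto simp: g_def\<close>)
  then show ?thesis
    using \<sigma> by (intro bexI[of _ \<sigma>]) (auto simp: g_def)
qed

lemma act_eq_iff:
  assumes q: "equi_prime (fixing W) q" and \<sigma>: "\<sigma> \<in> Sym_inf" "\<And>w. w \<in> W \<Longrightarrow> \<sigma> w = w"
  shows "act \<sigma> x \<in> q \<longleftrightarrow> x \<in> q"
proof
  have "act (inv \<sigma>) \<in> fixing W"
    using \<sigma> by (intro fixingI Sym_inf_inv inv_f_eq[OF Sym_inf_inj])
  moreover assume "act \<sigma> x \<in> q"
  ultimately have "act (inv \<sigma>) (act \<sigma> x) \<in> q"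
    using equi_prime_inv[OF q] by blast
  then show "x \<in> q"
    using Sym_inf_inj[OF \<sigma>(1)] by (simp add: act_act act_id)
next
  assume "x \<in> q"
  then show "act \<sigma> x \<in> q"
    using equi_prime_inv[OF q fixingI[OF \<sigma>]] by blast
qed

text \<open>Any two sets of equal size outside \<open>W\<close> are exchanged by a permutation
  fixing \<open>W\<close>, so membership depends only on the size.\<close>

lemma prod_away_sym:
  fixes q :: "'a::comm_ring_1 R set"
  assumes q: "equi_prime (fixing W) q" and W: "finite W" "K \<subseteq> W"
    and T: "finite T" "T \<inter> W = {}" and T': "finite T'" "T' \<inter> W = {}" and card: "card T = card T'"
    and a: "a \<in> K"
  shows "(\<Prod>i\<in>T. (Var i - Var a) ^ n * away K N a i) \<in> q \<longleftrightarrow> (\<Prod>i\<in>T'. (Var i - Var a) ^ n * away K N a i) \<in> q"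
proof -
  obtain \<sigma> where \<sigma>: "\<sigma> \<in> Sym_inf" "\<And>w. w \<in> W \<Longrightarrow> \<sigma> w = w" "bij_betw \<sigma> T T'"
    using fixing_move[OF W(1) T T' card] by blast
  have "act \<sigma> (away K N a i :: 'a R) = away K N a (\<sigma> i)" for i
    using \<sigma>(2) W(2) by (intro act_away) auto
  moreover have "\<sigma> a = a"
    using \<sigma>(2) W(2) a by auto
  ultimately have "act \<sigma> (\<Prod>i\<in>T. (Var i - Var a) ^ n * away K N a i :: 'a R)
      = (\<Prod>i\<in>T. (Var (\<sigma> i) - Var a) ^ n * away K N a (\<sigma> i))"
    by simp
  also have "\<dots> = (\<Prod>i\<in>T'. (Var i - Var a) ^ n * away K N a i)"
    using \<sigma>(3) by (rule prod.reindex_bij_betw)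
  finally show ?thesis
    using act_eq_iff[OF q \<sigma>(1,2), of "\<Prod>i\<in>T. (Var i - Var a) ^ n * away K N a i"] by (simp del: act_prod)
qed

lemma ideal_prod_cong:
  assumes I: "is_ideal I"
  shows "(\<And>x. x \<in> S \<Longrightarrow> f x - g x \<in> I) \<Longrightarrow> prod f S - prod g S \<in> I"
proof (induction S rule: infinite_finite_induct)
  case (insert x S)
  have "prod f (insert x S) - prod g (insert x S) =
      f x * (prod f S - prod g S) + prod g S * (f x - g x)"
    using insert.hyps by (simp add: algebra_simps)
  then show ?case
    using insert by (auto intro!: ideal_add[OF I] ideal_mult_left[OF I])
qed (use I ideal_0 in auto)

lemma ideal_power_cong: "is_ideal I \<Longrightarrow> x - y \<in> I \<Longrightarrow> x ^ n - y ^ n \<in> I"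
  using ideal_prod_cong[of I "{..<n}" "\<lambda>_. x" "\<lambda>_. y"] by simp

lemma act_vand: "act \<sigma> (vand Var S) = vand (\<lambda>i. Var (\<sigma> i)) S"
  by (simp add: rhom_vand[OF rhom_act])

text \<open>Take \<open>W = {..<r}\<close> and refine at a power of the discriminant of \<open>\<xi>\<^sub>i\<close>, \<open>i < r\<close>, where \<open>r\<close> is
  maximal such that no power of this discriminant lies in \<open>p\<close>.\<close>

lemma exists_config:
  fixes p :: "'a::comm_ring_1 R set"
  assumes p: "equi_prime (fixing {}) p" and m: "vand Var {..<m} ^ M \<in> p"
  shows "\<exists>W K N q. config p W K N q"
proof -
  have Ip: "is_ideal p" and one: "1 \<notin> p"
    using p by (auto simp: equi_prime_def inv_ideal_def)
  \<comment> \<open>The shift to \<open>Suc k\<close> makes the least such \<open>k\<close> the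
    number of points sought; for no points the discriminant is 1, which is outside
    \<open>p\<close>.\<close>
  define Q where "Q k \<longleftrightarrow> (\<exists>N. vand Var {..<Suc k} ^ N \<in> p)" for k
  have "m \<noteq> 0"
    using m one by (intro notI) simp
  then have "Q (m - 1)"
    using m by (auto simp: Q_def)
  define r where "r = (LEAST k. Q k)"
  have Qr: "Q r"
    unfolding r_def using \<open>Q (m - 1)\<close> by (rule LeastI)
  have notin: "vand Var {..<r} ^ N \<notin> p" for N
  proof (cases r)
    case 0
    then show ?thesis
      using one by simp
  next
    case (Suc r')
    then have "\<not> Q r'"
      using not_less_Least[of r' Q] by (simp add: r_def)
    then show ?thesis
      by (simp add: Q_def Suc)
  qed
  obtain N where N: "vand Var {..<Suc r} ^ N \<in> p"
    using Qr by (auto simp: Q_def)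
  define W where "W = {..<r}"
  define y :: "'a R" where "y = vand Var W ^ N"
  have y_fixed: "s y = y" if sW: "s \<in> fixing W" for s
  proof -
    obtain \<sigma> where \<sigma>: "s = act \<sigma>" "\<And>w. w \<in> W \<Longrightarrow> \<sigma> w = w"
      using sW by (rule fixingE) blast
    have "vand (\<lambda>i. Var (\<sigma> i)) W = (vand Var W :: 'a R)"
      by (rule vand_cong) (simp add: \<sigma>(2))
    then show ?thesis
      by (simp add: y_def \<sigma>(1) act_vand)
  qed
  obtain q where q: "equi_prime (fixing W) q" "\<And>x. x * y \<in> p \<Longrightarrow> x \<in> q"
    "\<And>x. x \<notin> p \<Longrightarrow> \<exists>s\<in>fixing {}. s x \<notin> q"
    using equi_prime_refine[OF p, of W y] notin y_fixed unfolding y_def W_def by blast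
  have Iq: "is_ideal q"
    using q(1) by (rule equi_prime_ideal)
  \<comment> \<open>Moving the index \<open>r\<close> to \<open>i\<close> turns the discriminant on
    r + 1 points into that of \<open>W\<close> times the product over \<open>W\<close>, up to sign.
    The power of the former lies in \<open>p\<close>, and the refinement cancels
    \<open>y\<close>.\<close>
  have near: "(\<Prod>w\<in>W. (Var i - Var w) ^ N) \<in> q" if i: "i \<notin> W" for i
  proof -
    have "r \<notin> W"
      by (simp add: W_def)
    then obtain \<sigma> where \<sigma>: "\<sigma> \<in> Sym_inf" "\<And>w. w \<in> W \<Longrightarrow> \<sigma> w = w" "bij_betw \<sigma> {r} {i}"
      using fixing_move[of W "{r}" "{i}"] i by (auto simp: W_def)
    obtain s where s: "s = 1 \<or> s = -1"
      "vand (\<lambda>j. Var (\<sigma> j) :: 'a R) (insert r W) = s * (\<Prod>j\<in>W. Var (\<sigma> r) - Var (\<sigma> j)) * vand (\<lambda>j. Var (\<sigma> j)) W"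
      using vand_insert[of W r "\<lambda>j. Var (\<sigma> j) :: 'a R"] by (auto simp: W_def)
    have "vand (\<lambda>j. Var (\<sigma> j)) W = (vand Var W :: 'a R)"
      by (rule vand_cong) (simp add: \<sigma>(2))
    moreover have "(\<Prod>j\<in>W. Var (\<sigma> r) - Var (\<sigma> j)) = (\<Prod>j\<in>W. Var i - Var j :: 'a R)"
      using \<sigma>(2,3) by (intro prod.cong) (auto simp: bij_betw_def)
    moreover have "insert r W = {..<Suc r}"
      by (auto simp: W_def)
    ultimately have "act \<sigma> (vand Var {..<Suc r} :: 'a R) = s * (\<Prod>j\<in>W. Var i - Var j) * vand Var W"
      using s(2) by (simp add: act_vand)
    moreover have "act \<sigma> (vand Var {..<Suc r} ^ N) \<in> p"
      using N equi_prime_inv[OF p fixingI[OF \<sigma>(1)]] by blast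
    ultimately have "s ^ N * ((\<Prod>j\<in>W. Var i - Var j) ^ N * y) \<in> p"
      by (simp add: power_mult_distrib y_def mult.assoc)
    then have "s ^ N * (s ^ N * ((\<Prod>j\<in>W. Var i - Var j) ^ N * y)) \<in> p"
      by (rule ideal_mult_left[OF Ip])
    moreover have "s ^ N * s ^ N = 1"
      using s(1) by (auto simp: power_mult_distrib[symmetric])
    ultimately have "(\<Prod>j\<in>W. Var i - Var j) ^ N * y \<in> p"
      by (metis mult.assoc mult_1)
    then show ?thesis
      using q(2) by (simp add: prod_power_distrib)
  qed
  \<comment> \<open>Points of \<open>W\<close> may become congruent modulo \<open>q\<close>;
    \<open>K\<close> collects the smallest index of each congruence class.\<close>
  define K where "K = {w\<in>W. \<forall>v\<in>W. v < w \<longrightarrow> Var w - Var v \<notin> q}"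
  have rep: "\<exists>a\<in>K. Var w - Var a \<in> q" if w: "w \<in> W" for w
  proof -
    let ?P = "\<lambda>v. v \<in> W \<and> Var w - Var v \<in> q"
    define a where "a = (LEAST v. ?P v)"
    have "?P w"
      using w ideal_0[OF Iq] by simp
    then have a: "?P a"
      unfolding a_def by (rule LeastI)
    have "Var a - Var v \<notin> q" if "v \<in> W" "v < a" for v
    proof
      assume "Var a - Var v \<in> q"
      then have "?P v"
        using a ideal_add[OF Iq, of "Var w - Var a" "Var a - Var v"] that by simp
      then show False
        using that(2) not_less_Least[of v ?P] by (simp add: a_def)
    qed
    then show ?thesis
      using a by (auto simp: K_def)
  qed
  then obtain \<rho> where \<rho>: "\<And>w. w \<in> W \<Longrightarrow> \<rho> w \<in> K \<and> Var w - Var (\<rho> w) \<in> q"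
    by metis
  have finW: "finite W"
    by (simp add: W_def)
  have finK: "finite K"
    using finW by (simp add: K_def)
  \<comment> \<open>Replacing points by representatives merges at most \<open>card W\<close> factors
    into one, hence the larger exponent.\<close>
  have near': "(\<Prod>a\<in>K. (Var i - Var a) ^ (N * card W)) \<in> q" if i: "i \<notin> W" for i
  proof -
    have "(\<Prod>w\<in>W. (Var i - Var w) ^ N) - (\<Prod>w\<in>W. (Var i - Var (\<rho> w)) ^ N) \<in> q"
    proof (intro ideal_prod_cong[OF Iq] ideal_power_cong[OF Iq])
      fix w assume "w \<in> W"
      then have "- (Var w - Var (\<rho> w)) \<in> q"
        using \<rho> ideal_uminus[OF Iq] by blast
      then show "Var i - Var w - (Var i - Var (\<rho> w)) \<in> q"
        by (simp add: algebra_simps)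
    qed
    then have "(\<Prod>w\<in>W. (Var i - Var (\<rho> w)) ^ N) \<in> q"
      using near[OF i] ideal_cong[OF Iq] by blast
    moreover have "(\<Prod>w\<in>W. (Var i - Var (\<rho> w)) ^ N) dvd (\<Prod>a\<in>K. (Var i - Var a :: 'a R) ^ (N * card W))"
    proof -
      have "(\<Prod>w\<in>W. (Var i - Var (\<rho> w)) ^ N) = (\<Prod>a\<in>K. \<Prod>w\<in>{w\<in>W. \<rho> w = a}. (Var i - Var (\<rho> w) :: 'a R) ^ N)"
        using finW finK \<rho> by (intro prod.group[symmetric]) auto
      also have "\<dots> dvd (\<Prod>a\<in>K. (Var i - Var a) ^ (N * card W))"
      proof (rule prod_dvd_prod)
        fix a assume "a \<in> K"
        have "(\<Prod>w\<in>{w\<in>W. \<rho> w = a}. (Var i - Var (\<rho> w) :: 'a R) ^ N) = (Var i - Var a) ^ (N * card {w\<in>W. \<rho> w = a})"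
          by (simp add: power_mult)
        also have "\<dots> dvd (Var i - Var a) ^ (N * card W)"
          using finW by (intro le_imp_power_dvd mult_le_mono2 card_mono) auto
        finally show "(\<Prod>w\<in>{w\<in>W. \<rho> w = a}. (Var i - Var (\<rho> w) :: 'a R) ^ N) dvd (Var i - Var a) ^ (N * card W)" .
      qed
      finally show ?thesis .
    qed
    ultimately show ?thesis
      using ideal_dvd[OF Iq] by blast
  qed
  have sep: "Var a - Var b \<notin> q" if "a \<in> K" "b \<in> K" "a \<noteq> b" for a b
  proof
    assume ab: "Var a - Var b \<in> q"
    then have "Var b - Var a \<in> q"
      using ideal_uminus[OF Iq, of "Var a - Var b"] by simp
    then show False
      using ab that unfolding K_def by (cases a b rule: linorder_cases) auto
  qed
  have "p \<subseteq> q"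
    using q(2) ideal_mult_right[OF Ip] by blast
  moreover have "\<exists>\<sigma>\<in>Sym_inf. act \<sigma> x \<notin> q" if "x \<notin> p" for x
    using q(3)[OF that] by (auto elim: fixingE)
  ultimately have "config p W K (N * card W) q"
    using finW q(1) sep rep near' unfolding config_def K_def by blast
  then show ?thesis
    by blast
qed

text \<open>If only finitely many variables outside \<open>W\<close> can be close to \<open>\<xi>\<^sub>a\<close> at the same time, adding a maximal
  set of such variables to \<open>W\<close> leaves none.\<close>

lemma config_refine:
  fixes p :: "'a::comm_ring_1 R set"
  assumes c: "config p W K N q" and a: "a \<in> K" and inf: "\<exists>i. i \<notin> W \<and> away K N a i \<notin> q"
    and T0: "finite T0" "T0 \<inter> W = {}" "(\<Prod>i\<in>T0. away K N a i) \<in> q"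
  shows "\<exists>W2 q2. config p W2 K N q2 \<and>
    {b\<in>K. \<exists>i. i \<notin> W2 \<and> away K N b i \<notin> q2} \<subset> {b\<in>K. \<exists>i. i \<notin> W \<and> away K N b i \<notin> q}"
proof -
  have finW: "finite W" and KW: "K \<subseteq> W" and q: "equi_prime (fixing W) q"
    and pq: "p \<subseteq> q" and core: "\<And>x. x \<notin> p \<Longrightarrow> \<exists>\<sigma>\<in>Sym_inf. act \<sigma> x \<notin> q"
    and sep: "\<And>a b. a \<in> K \<Longrightarrow> b \<in> K \<Longrightarrow> a \<noteq> b \<Longrightarrow> Var a - Var b \<notin> q"
    and rep: "\<And>w. w \<in> W \<Longrightarrow> \<exists>a\<in>K. Var w - Var a \<in> q"
    and near: "\<And>i. i \<notin> W \<Longrightarrow> (\<Prod>a\<in>K. (Var i - Var a) ^ N) \<in> q"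
    using c unfolding config_def by blast+
  have Iq: "is_ideal q" and one: "1 \<notin> q"
    using q by (auto simp: equi_prime_def inv_ideal_def)
  have sym: "(\<Prod>i\<in>T. away K N a i) \<in> q \<longleftrightarrow> (\<Prod>i\<in>T'. away K N a i) \<in> q"
    if "finite T" "T \<inter> W = {}" "finite T'" "T' \<inter> W = {}" "card T = card T'" for T T'
    using prod_away_sym[OF q finW KW that a, of 0 N] by simp
  \<comment> \<open>From a smallest set with product in \<open>q\<close> one element is dropped: the
    product \<open>y\<close> over the rest survives, while every further factor near
    \<open>a\<close> kills it. Inverting \<open>y\<close> therefore leaves no outside variable near
    \<open>a\<close>.\<close>
  define P where "P n \<longleftrightarrow> (\<exists>T. finite T \<and> T \<inter> W = {} \<and> card T = n \<and> (\<Prod>i\<in>T. away K N a i) \<in> q)" for n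
  define n where "n = (LEAST n. P n)"
  have "P (card T0)"
    unfolding P_def using T0 by blast
  then have "P n"
    unfolding n_def by (rule LeastI)
  then obtain T1 where T1: "finite T1" "T1 \<inter> W = {}" "card T1 = n" "(\<Prod>i\<in>T1. away K N a i) \<in> q"
    by (auto simp: P_def)
  have "T1 \<noteq> {}"
    using T1(4) one by auto
  then obtain j where j: "j \<in> T1"
    by blast
  define T where "T = T1 - {j}"
  have T: "finite T" "T \<inter> W = {}" "Suc (card T) = n"
    using T1 j card_Suc_Diff1[OF T1(1) j] by (auto simp: T_def)
  define y :: "'a R" where "y = (\<Prod>i\<in>T. away K N a i)"
  have "\<not> P (card T)"
    using not_less_Least[of "card T" P] T(3) by (simp add: n_def)
  then have y: "y \<notin> q"
    using T unfolding P_def y_def by blast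
  have kill: "away K N a i * y \<in> q" if i: "i \<notin> W \<union> T" for i
  proof -
    have "(\<Prod>i\<in>insert i T. away K N a i) \<in> q"
      using sym[of "insert i T" T1] T T1 i by auto
    then show ?thesis
      using i T(1) by (simp add: y_def)
  qed
  define W2 where "W2 = W \<union> T"
  have y_fixed: "s y = y" if sW: "s \<in> fixing W2" for s
  proof -
    obtain \<sigma> where \<sigma>: "s = act \<sigma>" "\<And>w. w \<in> W2 \<Longrightarrow> \<sigma> w = w"
      using sW by (rule fixingE) blast
    have "act \<sigma> (away K N a i :: 'a R) = away K N a i" if "i \<in> T" for i
      using act_away[of K \<sigma> N a i] \<sigma>(2) KW that by (auto simp: W2_def)
    then show ?thesis
      by (simp add: y_def \<sigma>(1))
  qed
  obtain q2 where q2: "equi_prime (fixing W2) q2" "\<And>x. x * y \<in> q \<Longrightarrow> x \<in> q2"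
    "\<And>x. x \<notin> q \<Longrightarrow> \<exists>s\<in>fixing W. s x \<notin> q2"
    using equi_prime_refine[OF q, of W2 y] y y_fixed finW T(1) unfolding W2_def by blast
  have qq2: "q \<subseteq> q2"
    using q2(2) ideal_mult_right[OF Iq] by blast
  have Iq2: "is_ideal q2" and one2: "1 \<notin> q2"
    using q2(1) by (auto simp: equi_prime_def inv_ideal_def)
  have core2: "\<exists>\<sigma>\<in>Sym_inf. act \<sigma> x \<notin> q2" if x: "x \<notin> p" for x
  proof -
    obtain \<sigma> where \<sigma>: "\<sigma> \<in> Sym_inf" "act \<sigma> x \<notin> q"
      using core[OF x] by blast
    then obtain \<tau> where "\<tau> \<in> Sym_inf" "act \<tau> (act \<sigma> x) \<notin> q2"
      using q2(3) by (metis fixingE)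
    then show ?thesis
      using Sym_inf_comp \<sigma>(1) by (auto simp: act_act)
  qed
  have sep2: "Var b - Var d \<notin> q2" if bd: "b \<in> K" "d \<in> K" "b \<noteq> d" for b d
  proof -
    obtain s where s: "s \<in> fixing W" "s (Var b - Var d) \<notin> q2"
      using q2(3)[OF sep[OF bd]] by blast
    then show ?thesis
      using bd KW by (simp add: fixing_diff[OF s(1)] fixing_Var[OF s(1)] subset_iff)
  qed
  \<comment> \<open>A newly frozen variable is fixed by the smaller group, so a product of powers of
    its differences lies in \<open>q2\<close> only if one of the differences does.\<close>
  have rep2: "\<exists>b\<in>K. Var w - Var b \<in> q2" if w: "w \<in> W2" for w
  proof (cases "w \<in> W")
    case True
    then show ?thesis
      using rep qq2 by blast
  next
    case False
    show ?thesis
    proof (rule ccontr)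
      assume no: "\<not> ?thesis"
      have fixed: "s (Var w - Var b) = Var w - Var b" if "b \<in> K" "s \<in> fixing W2" for b s
        using that w KW by (simp add: fixing_diff[OF that(2)] fixing_Var[OF that(2)] W2_def subset_iff)
      have "(Var w - Var b) ^ N \<notin> q2" if "b \<in> K" for b
        using equi_prime_power[OF q2(1), of "Var w - Var b" 1 N] fixed no that one2 by auto
      moreover have "s ((Var w - Var b) ^ N) = (Var w - Var b) ^ N" if "b \<in> K" "s \<in> fixing W2" for b s
        using fixed[OF that] that(2) by (auto elim!: fixingE)
      moreover have "1 * (\<Prod>b\<in>K. (Var w - Var b) ^ N) \<in> q2"
        using near[OF False] qq2 by auto
      ultimately have "1 \<in> q2"
        using equi_prime_prod[OF q2(1), of K "\<lambda>b. (Var w - Var b) ^ N" 1] by blast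
      then show False
        using one2 by blast
    qed
  qed
  have "config p W2 K N q2"
    unfolding config_def
  proof (intro conjI ballI allI impI)
    show "finite W2" "K \<subseteq> W2" "p \<subseteq> q2"
      using finW T(1) KW pq qq2 by (auto simp: W2_def)
    show "(\<Prod>a\<in>K. (Var i - Var a) ^ N) \<in> q2" if "i \<notin> W2" for i
      using near[of i] qq2 that by (auto simp: W2_def)
  qed (use q2(1) core2 sep2 rep2 in auto)
  moreover have "{b\<in>K. \<exists>i. i \<notin> W2 \<and> away K N b i \<notin> q2} \<subset> {b\<in>K. \<exists>i. i \<notin> W \<and> away K N b i \<notin> q}"
  proof
    show "{b\<in>K. \<exists>i. i \<notin> W2 \<and> away K N b i \<notin> q2} \<subseteq> {b\<in>K. \<exists>i. i \<notin> W \<and> away K N b i \<notin> q}"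
      using qq2 by (auto simp: W2_def)
    have "a \<notin> {b\<in>K. \<exists>i. i \<notin> W2 \<and> away K N b i \<notin> q2}"
      using kill q2(2) by (auto simp: W2_def)
    then show "{b\<in>K. \<exists>i. i \<notin> W2 \<and> away K N b i \<notin> q2} \<noteq> {b\<in>K. \<exists>i. i \<notin> W \<and> away K N b i \<notin> q}"
      using a inf by blast
  qed
  ultimately show ?thesis
    by blast
qed

text \<open>The state in which \<open>config_refine\<close> no longer applies: points near which an
  outside variable can lie admit arbitrarily many at once.\<close>

definition saturated_config ::
  "'a::comm_ring_1 R set \<Rightarrow> nat set \<Rightarrow> nat set \<Rightarrow> nat \<Rightarrow> 'a R set \<Rightarrow> bool" where
  "saturated_config p W K N q \<longleftrightarrow> config p W K N q \<and>
     (\<forall>a\<in>K. (\<exists>i. i \<notin> W \<and> away K N a i \<notin> q) \<longrightarrow>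
        (\<forall>T. finite T \<longrightarrow> T \<inter> W = {} \<longrightarrow> (\<Prod>i\<in>T. away K N a i) \<notin> q))"

text \<open>Each refinement deactivates a point of \<open>K\<close> and activates none.\<close>

lemma exists_saturated_config:
  assumes "config p W K N q"
  shows "\<exists>W q. saturated_config p W K N q"
  using assms
proof (induction "card {b\<in>K. \<exists>i. i \<notin> W \<and> away K N b i \<notin> q}" arbitrary: W q rule: less_induct)
  case less
  show ?case
  proof (cases "saturated_config p W K N q")
    case False
    then obtain a T where "a \<in> K" "\<exists>i. i \<notin> W \<and> away K N a i \<notin> q" "finite T" "T \<inter> W = {}"
      "(\<Prod>i\<in>T. away K N a i) \<in> q"
      using less.prems unfolding saturated_config_def by blast
    then obtain W2 q2 where c2: "config p W2 K N q2"
      "{b\<in>K. \<exists>i. i \<notin> W2 \<and> away K N b i \<notin> q2} \<subset> {b\<in>K. \<exists>i. i \<notin> W \<and> away K N b i \<notin> q}"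
      using config_refine[OF less.prems \<open>a \<in> K\<close>, of T] by blast
    have "finite K"
      using less.prems finite_subset unfolding config_def by blast
    then have "card {b\<in>K. \<exists>i. i \<notin> W2 \<and> away K N b i \<notin> q2} < card {b\<in>K. \<exists>i. i \<notin> W \<and> away K N b i \<notin> q}"
      using c2(2) by (intro psubset_card_mono) auto
    then show ?thesis
      using less.hyps c2(1) by blast
  qed blast
qed

section \<open>The type of a configuration\<close>

locale sat_config =
  fixes p :: "'a::comm_ring_1 R set" and W K :: "nat set" and N :: nat and q :: "'a R set"
  assumes sat_config: "saturated_config p W K N q"
begin

lemma finW: "finite W" and KW: "K \<subseteq> W" and q: "equi_prime (fixing W) q" and pq: "p \<subseteq> q"
  and core: "x \<notin> p \<Longrightarrow> \<exists>\<sigma>\<in>Sym_inf. act \<sigma> x \<notin> q"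
  and sep: "a \<in> K \<Longrightarrow> b \<in> K \<Longrightarrow> a \<noteq> b \<Longrightarrow> Var a - Var b \<notin> q"
  and rep: "w \<in> W \<Longrightarrow> \<exists>a\<in>K. Var w - Var a \<in> q"
  and near: "i \<notin> W \<Longrightarrow> (\<Prod>a\<in>K. (Var i - Var a) ^ N) \<in> q"
  using sat_config unfolding saturated_config_def config_def by blast+

lemma finK: "finite K"
  using finW KW finite_subset by blast

lemma Iq: "is_ideal q" and one: "1 \<notin> q"
  using q by (auto simp: equi_prime_def inv_ideal_def)

text \<open>A point is active if variables outside \<open>W\<close> can be close to it, and then infinitely many can.
  The active points give the infinite blocks, with weight the nilpotency order \<open>depth\<close>; at the others only
  variables from \<open>W\<close> occur.\<close>

definition active :: "nat \<Rightarrow> bool" where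
  "active a \<longleftrightarrow> (\<exists>i. i \<notin> W \<and> away K N a i \<notin> q)"

lemma saturated:
  "a \<in> K \<Longrightarrow> active a \<Longrightarrow> finite T \<Longrightarrow> T \<inter> W = {} \<Longrightarrow> (\<Prod>i\<in>T. away K N a i) \<notin> q"
  using sat_config unfolding saturated_config_def active_def by blast

lemma pow_away_sym:
  assumes "a \<in> K" "i \<notin> W" "j \<notin> W"
  shows "(Var i - Var a) ^ n * away K N a i \<in> q \<longleftrightarrow> (Var j - Var a) ^ n * away K N a j \<in> q"
  using prod_away_sym[OF q finW KW, of "{i}" "{j}" a n N] assms by simp

lemma active_iff: "a \<in> K \<Longrightarrow> i \<notin> W \<Longrightarrow> active a \<longleftrightarrow> away K N a i \<notin> q"
  using pow_away_sym[of a i _ 0] unfolding active_def power_0 mult_1 by blast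

lemma pow_N_away: "a \<in> K \<Longrightarrow> i \<notin> W \<Longrightarrow> (Var i - Var a) ^ N * away K N a i \<in> q"
  using near[of i] finK by (simp add: prod.remove away_def)

definition depth :: "nat \<Rightarrow> nat" where
  "depth a = (LEAST n. \<exists>i. i \<notin> W \<and> (Var i - Var a) ^ n * away K N a i \<in> q)"

lemma exists_outside: "\<exists>i. i \<notin> W"
  using finW infinite_UNIV_nat by (metis ex_new_if_finite)

lemma pow_depth_away: "a \<in> K \<Longrightarrow> i \<notin> W \<Longrightarrow> (Var i - Var a) ^ depth a * away K N a i \<in> q"
proof -
  assume a: "a \<in> K" and i: "i \<notin> W"
  have "\<exists>i. i \<notin> W \<and> (Var i - Var a) ^ N * away K N a i \<in> q"
    using exists_outside pow_N_away[OF a] by blast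
  then have "\<exists>i. i \<notin> W \<and> (Var i - Var a) ^ depth a * away K N a i \<in> q"
    unfolding depth_def by (rule LeastI)
  then show ?thesis
    using pow_away_sym[OF a _ i] by blast
qed

lemma pow_less_depth_away:
  "i \<notin> W \<Longrightarrow> n < depth a \<Longrightarrow> (Var i - Var a) ^ n * away K N a i \<notin> q"
  using not_less_Least[of n "\<lambda>n. \<exists>i. i \<notin> W \<and> (Var i - Var a) ^ n * away K N a i \<in> q"]
  unfolding depth_def by blast

lemma depth_pos: "a \<in> K \<Longrightarrow> active a \<Longrightarrow> 1 \<le> depth a"
  using pow_depth_away[of a] exists_outside active_iff[of a] by (cases "depth a") auto

definition cls :: "nat \<Rightarrow> nat set" where
  "cls a = {w\<in>W. Var w - Var a \<in> q}"

definition ctype :: "nat \<Rightarrow> enat" where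
  "ctype a = (if active a then \<infinity> else enat (card (cls a)))"

definition cwt :: "nat \<Rightarrow> nat" where
  "cwt a = (if active a then depth a else 1)"

lemma ctype_infinity: "ctype a = \<infinity> \<longleftrightarrow> active a"
  by (simp add: ctype_def)

lemma cls_disjoint: "a \<in> K \<Longrightarrow> b \<in> K \<Longrightarrow> a \<noteq> b \<Longrightarrow> cls a \<inter> cls b = {}"
proof (rule ccontr)
  assume ab: "a \<in> K" "b \<in> K" "a \<noteq> b" and "cls a \<inter> cls b \<noteq> {}"
  then obtain w where "Var w - Var a \<in> q" "Var w - Var b \<in> q"
    by (auto simp: cls_def)
  then have "Var a - Var b \<in> q"
    using ideal_diff[OF Iq, of "Var w - Var b" "Var w - Var a"] by simp
  then show False
    using sep ab by blast
qed

lemma fixed_diff: "a \<in> W \<Longrightarrow> b \<in> W \<Longrightarrow> s \<in> fixing W \<Longrightarrow> s (Var a - Var b) = Var a - Var b"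
  by (simp add: fixing_diff[of s W] fixing_Var[of s W])

section \<open>Separating the points: a Chinese remainder argument modulo \<open>q\<close>\<close>

lemma cancel_diff_power:
  assumes "a \<in> K" "b \<in> K" "a \<noteq> b" "x * (Var a - Var b) ^ n \<in> q"
  shows "x \<in> q"
  using equi_prime_power[OF q sep[OF assms(1-3)] _ assms(4)] fixed_diff assms KW by blast

text \<open>The bases differ by \<open>Var a - Var b\<close>, which is regular modulo
  \<open>q\<close>, and a high power of this difference is a combination of the two given
  powers.\<close>

lemma coprime_powers:
  assumes ab: "a \<in> K" "b \<in> K" "a \<noteq> b"
    and x: "x * (y - Var a) ^ m \<in> q" "x * (y - Var b) ^ n \<in> q"
  shows "x \<in> q"
proof -
  have I: "is_ideal {z. z * x \<in> q}"
    by (rule is_ideal_colon[OF Iq])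
  have "((y - Var b) - (y - Var a)) ^ (n + m) \<in> {z. z * x \<in> q}"
    by (rule ideal_power_diff[OF I, of _ n _ m]) (use x in \<open>simp_all add: mult.commute\<close>)
  then have "x * (Var a - Var b) ^ (n + m) \<in> q"
    by (simp add: mult.commute)
  then show ?thesis
    by (rule cancel_diff_power[OF ab])
qed

lemma coprime_power_prod:
  assumes "finite S"
  shows "S \<subseteq> K \<Longrightarrow> c \<in> K - S \<Longrightarrow> x * (\<Prod>b\<in>S. (y - Var b) ^ N) \<in> q \<Longrightarrow> x * (y - Var c) ^ N \<in> q \<Longrightarrow> x \<in> q"
  using assms
proof (induction S arbitrary: x rule: finite_induct)
  case (insert b S)
  have "x * (y - Var b) ^ N \<in> q"
  proof (rule insert.IH)
    show "x * (y - Var b) ^ N * (\<Prod>b\<in>S. (y - Var b) ^ N) \<in> q"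
      using insert.prems insert.hyps by (simp add: mult.assoc)
    show "x * (y - Var b) ^ N * (y - Var c) ^ N \<in> q"
      using ideal_mult_right[OF Iq insert.prems(4), of "(y - Var b) ^ N"] by (simp add: mult_ac)
  qed (use insert.prems in auto)
  then show ?case
    using coprime_powers[of b c x y N N] insert.prems by auto
qed simp

text \<open>Up to elements regular modulo \<open>q\<close>, the products omitting one factor
  generate the unit ideal.\<close>

lemma coprime_cover:
  assumes "finite S" "S \<noteq> {}"
  shows "S \<subseteq> K \<Longrightarrow> (\<And>a. a \<in> S \<Longrightarrow> x * (\<Prod>b\<in>S - {a}. (y - Var b) ^ N) \<in> q) \<Longrightarrow> x \<in> q"
  using assms
proof (induction S arbitrary: x rule: finite_ne_induct)
  case (singleton a)
  then show ?case
    using singleton.prems(2)[of a] by simp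
next
  case (insert c S)
  have "x * (y - Var c) ^ N \<in> q"
  proof (rule insert.IH)
    fix a assume a: "a \<in> S"
    have "insert c S - {a} = insert c (S - {a})"
      using a insert.hyps by auto
    then have "(\<Prod>b\<in>insert c S - {a}. (y - Var b) ^ N) = (y - Var c) ^ N * (\<Prod>b\<in>S - {a}. (y - Var b) ^ N)"
      using insert.hyps by simp
    then show "x * (y - Var c) ^ N * (\<Prod>b\<in>S - {a}. (y - Var b) ^ N) \<in> q"
      using insert.prems(2)[of a] a by (simp add: mult.assoc)
  qed (use insert.prems in auto)
  moreover have "x * (\<Prod>b\<in>S. (y - Var b) ^ N) \<in> q"
    using insert.prems(2)[of c] insert.hyps by simp
  ultimately show ?case
    using coprime_power_prod[OF insert.hyps(1)] insert.prems insert.hyps by blast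
qed

lemma K_nonempty: "K \<noteq> {}"
  using exists_outside near one by force

text \<open>Membership in \<open>q\<close> can be tested near each point separately; the elements
  \<open>away K N a i\<close> play the role of a partition of unity.\<close>

lemma away_cover: "(\<And>a. a \<in> K \<Longrightarrow> x * away K N a i \<in> q) \<Longrightarrow> x \<in> q"
  using coprime_cover[OF finK K_nonempty order_refl, of x "Var i"] unfolding away_def by blast

lemma exists_active: "\<exists>a\<in>K. active a"
proof (rule ccontr)
  assume no: "\<not> ?thesis"
  obtain i where "i \<notin> W"
    using exists_outside by blast
  then have "1 * away K N a i \<in> q" if "a \<in> K" for a
    using no that active_iff by auto
  then show False
    using away_cover one by blast
qed

lemma ctype_wcomps: "(K, ctype, cwt) \<in> wcomps"
proof -
  have "1 \<le> card (cls a)" if "a \<in> K" for a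
  proof -
    have "a \<in> cls a"
      using that KW ideal_0[OF Iq] by (auto simp: cls_def)
    then show ?thesis
      using finW card_gt_0_iff[of "cls a"] by (auto simp: cls_def)
  qed
  then show ?thesis
    using finK exists_active depth_pos
    by (auto simp: wcomps_def infinity_composition_def weighting_def reduced_def ctype_def cwt_def one_enat_def)
qed

subsection \<open>Non-vanishing of monomials in the nilpotents\<close>

text \<open>The top surviving power of the nilpotent \<open>Var i - Var a\<close>, localised near an
  active point \<open>a\<close>; for weight 1 it is \<open>away\<close> itself.\<close>

definition socle :: "nat \<Rightarrow> nat \<Rightarrow> 'a R" where
  "socle a i = (Var i - Var a) ^ (cwt a - 1) * away K N a i"

lemma socle_notin: "a \<in> K \<Longrightarrow> active a \<Longrightarrow> i \<notin> W \<Longrightarrow> socle a i \<notin> q"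
  unfolding socle_def using depth_pos[of a] by (intro pow_less_depth_away) (auto simp: cwt_def)

lemma act_socle: "(\<And>w. w \<in> W \<Longrightarrow> \<sigma> w = w) \<Longrightarrow> a \<in> K \<Longrightarrow> act \<sigma> (socle a i) = socle a (\<sigma> i)"
  unfolding socle_def using KW by (simp add: act_away subset_iff)

lemma socle_mult_other:
  assumes "a \<in> K" "b \<in> K" "a \<noteq> b" "i \<notin> W"
  shows "socle b i * socle a i \<in> q"
proof -
  have "(Var i - Var b) ^ N dvd (away K N a i :: 'a R)"
    unfolding away_def using finK assms by (intro dvd_prodI) auto
  then obtain r :: "'a R" where "away K N a i = (Var i - Var b) ^ N * r"
    by (auto simp: dvd_def)
  then have "socle b i * socle a i = ((Var i - Var b) ^ (cwt b - 1) * (Var i - Var a) ^ (cwt a - 1) * r) *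
      ((Var i - Var b) ^ N * away K N b i)"
    by (simp add: socle_def mult_ac)
  then show ?thesis
    using pow_N_away[OF assms(2,4)] ideal_mult_left[OF Iq] by metis
qed

text \<open>For weight at least 2, twice the exponent already reaches the nilpotency order.\<close>

lemma socle_square:
  assumes a: "a \<in> K" "active a" "cwt a \<noteq> 1" and i: "i \<notin> W"
  shows "socle a i * socle a i \<in> q"
proof -
  have d: "depth a \<le> 2 * (cwt a - 1)"
    using a depth_pos[OF a(1,2)] by (auto simp: cwt_def)
  have "socle a i * socle a i = (Var i - Var a) ^ (2 * (cwt a - 1)) * away K N a i * away K N a i"
    by (simp add: socle_def mult_2 power_add mult_ac)
  also have "\<dots> = ((Var i - Var a) ^ (2 * (cwt a - 1) - depth a) * away K N a i) *
      ((Var i - Var a) ^ depth a * away K N a i)"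
    using d by (simp add: power_add[symmetric] mult_ac)
  also have "\<dots> \<in> q"
    using pow_depth_away[OF a(1) i] by (rule ideal_mult_left[OF Iq])
  finally show ?thesis .
qed

text \<open>Equivariant primality only provides some conjugate of the new factor that keeps the
  product outside \<open>q\<close>. The work lies in making its variable differ from those already
  used.\<close>

lemma prod_socle_notin:
  assumes "finite T"
  shows "T \<inter> W = {} \<Longrightarrow> (\<And>i. i \<in> T \<Longrightarrow> \<kappa> i \<in> K \<and> active (\<kappa> i)) \<Longrightarrow> (\<Prod>i\<in>T. socle (\<kappa> i) i) \<notin> q"
  using assms
proof (induction T rule: finite_induct)
  case empty
  then show ?case
    using one by simp
next
  case (insert j T)
  define Y where "Y = (\<Prod>i\<in>T. socle (\<kappa> i) i)"
  define a where "a = \<kappa> j"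
  have a: "a \<in> K" "active a"
    using insert.prems by (auto simp: a_def)
  have TW: "T \<inter> W = {}" and j: "j \<notin> W"
    using insert.prems by auto
  have Y: "Y \<notin> q"
    using insert unfolding Y_def by auto
  have dvdY: "socle (\<kappa> i) i dvd Y" if "i \<in> T" for i
    unfolding Y_def using that insert.hyps by (intro dvd_prodI) auto
  have inj: "\<sigma> i \<notin> W" if "\<sigma> \<in> Sym_inf" "\<And>w. w \<in> W \<Longrightarrow> \<sigma> w = w" "i \<notin> W" for \<sigma> i
    using Sym_inf_inj[OF that(1)] that(2,3) by (metis injD)
  have "\<exists>i. i \<notin> W \<union> T \<and> Y * socle a i \<notin> q"
  \<comment> \<open>For larger weight, a conjugate landing in \<open>T\<close> would create a square
    of a socle or a product at two points, both in \<open>q\<close>. For weight 1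
    \<open>socle_square\<close> does not apply, so more variables than \<open>T\<close> has are
    moved at once and one of them misses \<open>T\<close>.\<close>
  proof (cases "cwt a = 1")
    case False
    obtain \<sigma> where \<sigma>: "\<sigma> \<in> Sym_inf" "\<And>w. w \<in> W \<Longrightarrow> \<sigma> w = w" "Y * act \<sigma> (socle a j) \<notin> q"
      using equi_primeD[OF q Y socle_notin[OF a j]] by (metis fixingE)
    have notin: "Y * socle a (\<sigma> j) \<notin> q"
      using \<sigma>(3) act_socle[OF \<sigma>(2) a(1)] by simp
    have \<sigma>j: "\<sigma> j \<notin> W"
      using inj \<sigma> j by blast
    have "\<sigma> j \<notin> T"
    proof
      assume jT: "\<sigma> j \<in> T"
      have "socle (\<kappa> (\<sigma> j)) (\<sigma> j) * socle a (\<sigma> j) \<in> q"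
        using socle_mult_other[OF a(1) _ _ \<sigma>j] socle_square[OF a False \<sigma>j] insert.prems(2)[of "\<sigma> j"] jT
        by (cases "\<kappa> (\<sigma> j) = a") auto
      moreover have "socle (\<kappa> (\<sigma> j)) (\<sigma> j) * socle a (\<sigma> j) dvd Y * socle a (\<sigma> j)"
        using dvdY[OF jT] by (rule mult_dvd_mono) simp
      ultimately show False
        using notin ideal_dvd[OF Iq] by blast
    qed
    then show ?thesis
      using notin \<sigma>j by blast
  next
    case True
    obtain T' where T': "finite T'" "card T' = Suc (card T)" "T' \<subseteq> - W"
      using infinite_arbitrarily_large[of "- W" "Suc (card T)"] finW by auto
    have "(\<Prod>i\<in>T'. away K N a i) \<notin> q"
      using T' by (intro saturated[OF a]) auto
    then obtain \<sigma> where \<sigma>: "\<sigma> \<in> Sym_inf" "\<And>w. w \<in> W \<Longrightarrow> \<sigma> w = w" "Y * act \<sigma> (\<Prod>i\<in>T'. away K N a i) \<notin> q"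
      using equi_primeD[OF q Y] by (metis fixingE)
    have "\<not> \<sigma> ` T' \<subseteq> T"
    proof
      assume "\<sigma> ` T' \<subseteq> T"
      then have "card (\<sigma> ` T') \<le> card T"
        using insert.hyps by (intro card_mono) auto
      moreover have "card (\<sigma> ` T') = card T'"
        using inj_on_subset[OF Sym_inf_inj[OF \<sigma>(1)]] by (simp add: card_image)
      ultimately show False
        using T' by simp
    qed
    then obtain i where i: "i \<in> T'" "\<sigma> i \<notin> T"
      by blast
    have "act \<sigma> (away K N a i :: 'a R) = away K N a (\<sigma> i)"
      using \<sigma>(2) KW by (intro act_away) auto
    then have "socle a (\<sigma> i) = act \<sigma> (away K N a i)"
      using True by (simp add: socle_def)
    moreover have "act \<sigma> (away K N a i :: 'a R) dvd act \<sigma> (\<Prod>i\<in>T'. away K N a i)"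
      using i T' by (auto intro: dvd_prodI)
    ultimately have "Y * socle a (\<sigma> i) dvd Y * act \<sigma> (\<Prod>i\<in>T'. away K N a i)"
      by (intro mult_dvd_mono) auto
    then have "Y * socle a (\<sigma> i) \<notin> q"
      using \<sigma>(3) ideal_dvd[OF Iq] by blast
    moreover have "\<sigma> i \<notin> W"
      using inj \<sigma> i T' by blast
    ultimately show ?thesis
      using i by blast
  qed
  then obtain i where i: "i \<notin> W \<union> T" "Y * socle a i \<notin> q"
    by blast
  \<comment> \<open>The index found need not be \<open>j\<close>, but a permutation fixing
    \<open>W\<close> and \<open>T\<close> moves it there.\<close>
  obtain \<sigma> where \<sigma>: "\<sigma> \<in> Sym_inf" "\<And>w. w \<in> W \<union> T \<Longrightarrow> \<sigma> w = w" "bij_betw \<sigma> {i} {j}"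
    using fixing_move[of "W \<union> T" "{i}" "{j}"] finW insert.hyps j i by auto
  have "act \<sigma> Y = Y"
    unfolding Y_def using \<sigma>(2) insert.prems by (simp add: act_socle)
  moreover have "act \<sigma> (socle a i) = socle a j"
    using act_socle[of \<sigma> a i] \<sigma>(2,3) a by (auto simp: bij_betw_def)
  ultimately have "act \<sigma> (Y * socle a i) = Y * socle a j"
    by simp
  moreover have "act \<sigma> (Y * socle a i) \<notin> q"
    using act_eq_iff[OF q \<sigma>(1), of "Y * socle a i"] \<sigma>(2) i(2) by simp
  ultimately show ?case
    using insert.hyps by (simp add: Y_def a_def mult.commute)
qed

end

subsection \<open>Non-vanishing of the elements \<open>h\<close>\<close>

lemma glue_functions:
  assumes "\<And>j j'. j \<in> J \<Longrightarrow> j' \<in> J \<Longrightarrow> j \<noteq> j' \<Longrightarrow> S j \<inter> S j' = {}"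
  shows "\<exists>f. \<forall>j\<in>J. \<forall>i\<in>S j. f i = F j i"
proof (intro exI ballI)
  fix j i assume ji: "j \<in> J" "i \<in> S j"
  have "(SOME j. j \<in> J \<and> i \<in> S j) = j"
    by (rule some_equality) (use ji assms in blast)+
  then show "(\<lambda>i. F (SOME j. j \<in> J \<and> i \<in> S j) i) i = F j i"
    by simp
qed

lemma vand_split_types:
  assumes "finite S" "finite K" "\<kappa> ` S \<subseteq> K"
  shows "vand x S = (\<Prod>a\<in>K. vand x {i\<in>S. \<kappa> i = a}) *
    (\<Prod>(i, j)\<in>{(i, j). i \<in> S \<and> j \<in> S \<and> i < j \<and> \<kappa> i \<noteq> \<kappa> j}. x i - x j)"
proof -
  let ?P = "\<lambda>a. {(i, j). i \<in> {i\<in>S. \<kappa> i = a} \<and> j \<in> {i\<in>S. \<kappa> i = a} \<and> i < j}"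
  let ?D = "{(i, j). i \<in> S \<and> j \<in> S \<and> i < j \<and> \<kappa> i \<noteq> \<kappa> j}"
  let ?F = "\<lambda>(i, j). x i - x j"
  have finP: "finite (?P a)" for a
    by (rule finite_subset[of _ "S \<times> S"]) (use assms(1) in auto)
  have finD: "finite ?D"
    by (rule finite_subset[of _ "S \<times> S"]) (use assms(1) in auto)
  have "{(i, j). i \<in> S \<and> j \<in> S \<and> i < j} = (\<Union>a\<in>K. ?P a) \<union> ?D"
    using assms(3) by auto
  then have "vand x S = prod ?F ((\<Union>a\<in>K. ?P a) \<union> ?D)"
    by (simp add: vand_def)
  also have "\<dots> = prod ?F (\<Union>a\<in>K. ?P a) * prod ?F ?D"
    using assms(2) finP finD by (intro prod.union_disjoint) auto
  also have "prod ?F (\<Union>a\<in>K. ?P a) = (\<Prod>a\<in>K. prod ?F (?P a))"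
    using assms(2) finP by (intro prod.UNION_disjoint) auto
  finally show ?thesis
    by (simp add: vand_def)
qed

lemma cancel_prod:
  assumes "\<And>f z. f \<in> F \<Longrightarrow> z * u f \<in> I \<Longrightarrow> z \<in> I"
  shows "z * prod u F \<in> I \<Longrightarrow> z \<in> (I :: 'r::comm_ring_1 set)"
  using assms
proof (induction F arbitrary: z rule: infinite_finite_induct)
  case (insert f F)
  have "z * u f * prod u F \<in> I"
    using insert.prems(1) insert.hyps by (simp add: mult.assoc)
  then have "z * u f \<in> I"
    using insert.IH insert.prems(2) by blast
  then show ?case
    using insert.prems(2) by blast
qed auto

lemma cancel_power:
  assumes "\<And>z. z * u \<in> I \<Longrightarrow> z \<in> I"
  shows "z * u ^ n \<in> I \<Longrightarrow> z \<in> (I :: 'r::comm_ring_1 set)"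
  using cancel_prod[of "{..<n}" "\<lambda>_. u" I z] assms by simp

lemma vand_socle_family:
  assumes I: "is_ideal I" and F: "finite F"
    and S: "\<And>f. f \<in> F \<Longrightarrow> finite (S f) \<and> card (S f) \<le> d f"
    and pow: "\<And>f i. f \<in> F \<Longrightarrow> i \<in> S f \<Longrightarrow> x i ^ d f \<in> I"
  shows "z * (\<Prod>f\<in>F. vand x (S f)) \<in> I \<Longrightarrow> z * (\<Prod>f\<in>F. \<Prod>i\<in>S f. x i ^ (d f - 1)) \<in> I"
  using F S pow
proof (induction F arbitrary: z rule: finite_induct)
  case (insert f F)
  let ?R = "\<Prod>f\<in>F. vand x (S f)"
  have "(\<Prod>i\<in>S f. x i ^ (d f - 1)) * (z * ?R) \<in> I"
  proof (rule vand_socle[OF I])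
    show "vand x (S f) * (z * ?R) \<in> I"
      using insert.prems(1) insert.hyps by (simp add: mult_ac)
    show "x i ^ d f * (z * ?R) \<in> I" if "i \<in> S f" for i
      using insert.prems(3)[of f i] that ideal_mult_right[OF I] by auto
  qed (use insert.prems in auto)
  then have "(z * (\<Prod>i\<in>S f. x i ^ (d f - 1))) * ?R \<in> I"
    by (simp add: mult_ac)
  then have "(z * (\<Prod>i\<in>S f. x i ^ (d f - 1))) * (\<Prod>f\<in>F. \<Prod>i\<in>S f. x i ^ (d f - 1)) \<in> I"
    using insert.prems by (intro insert.IH) auto
  then show ?case
    using insert.hyps by (simp add: mult_ac)
qed simp

context sat_config
begin

text \<open>Here \<open>\<kappa> i\<close> is the point near which the \<open>i\<close>-th variable
  of h will be placed. Finite blocks are distributed with the sizes as capacities; infinite ones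
  sub-block by sub-block over active points, with the weights as capacities.\<close>

lemma exists_types:
  assumes x: "(K', \<mu>, d) \<in> wcomps" and le: "(K', \<mu>, d) \<preceq> (K, ctype, cwt)"
    and bc: "block_choice n (K', \<mu>, d) W' V"
  obtains \<kappa> where
    "\<And>\<beta> i. \<beta> \<in> K' \<Longrightarrow> i \<in> W' \<beta> \<Longrightarrow> \<kappa> i \<in> K"
    "\<And>\<beta> \<gamma> i j. \<beta> \<in> K' \<Longrightarrow> \<gamma> \<in> K' \<Longrightarrow> \<beta> \<noteq> \<gamma> \<Longrightarrow> i \<in> W' \<beta> \<Longrightarrow> j \<in> W' \<gamma> \<Longrightarrow> \<kappa> i \<noteq> \<kappa> j"
    "\<And>\<beta> i. \<beta> \<in> K' \<Longrightarrow> \<mu> \<beta> = \<infinity> \<Longrightarrow> i \<in> W' \<beta> \<Longrightarrow> active (\<kappa> i)"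
    "\<And>\<beta> a. \<beta> \<in> K' \<Longrightarrow> \<mu> \<beta> \<noteq> \<infinity> \<Longrightarrow> a \<in> K \<Longrightarrow> enat (card {i\<in>W' \<beta>. \<kappa> i = a}) \<le> ctype a"
    "\<And>\<beta> k a. \<beta> \<in> K' \<Longrightarrow> \<mu> \<beta> = \<infinity> \<Longrightarrow> k \<in> {1..n} \<Longrightarrow> a \<in> K \<Longrightarrow> card {i\<in>V \<beta> k. \<kappa> i = a} \<le> cwt a"
proof -
  obtain E \<phi> where E: "E \<subseteq> K" "\<phi> ` E \<subseteq> K'"
    "\<And>\<beta>. \<beta> \<in> K' \<Longrightarrow> \<mu> \<beta> \<le> (\<Sum>a\<in>{a\<in>E. \<phi> a = \<beta>}. ctype a)"
    "\<And>\<beta>. \<beta> \<in> K' \<Longrightarrow> \<mu> \<beta> = \<infinity> \<Longrightarrow> d \<beta> \<le> (\<Sum>a\<in>{a\<in>E. \<phi> a = \<beta> \<and> ctype a = \<infinity>}. cwt a)"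
    using le unfolding wcomp_le_iff by blast
  have finE: "finite E"
    using E(1) finK finite_subset by blast
  define good where "good \<beta> g \<longleftrightarrow> (\<forall>i\<in>W' \<beta>. g i \<in> E \<and> \<phi> (g i) = \<beta>) \<and>
      (\<mu> \<beta> = \<infinity> \<longrightarrow> (\<forall>i\<in>W' \<beta>. active (g i)) \<and>
         (\<forall>k\<in>{1..n}. \<forall>a\<in>K. card {i\<in>V \<beta> k. g i = a} \<le> cwt a)) \<and>
      (\<mu> \<beta> \<noteq> \<infinity> \<longrightarrow> (\<forall>a\<in>K. enat (card {i\<in>W' \<beta>. g i = a}) \<le> ctype a))" for \<beta> g
  have "\<exists>g. good \<beta> g" if b: "\<beta> \<in> K'" for \<beta>
  proof (cases "\<mu> \<beta> = \<infinity>")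
    case False
    let ?A = "{a\<in>E. \<phi> a = \<beta>}"
    have "enat (card (W' \<beta>)) = \<mu> \<beta>"
      using False block_choiceD(3)[OF bc b] by (auto simp: par_tau_def)
    then have "enat (card (W' \<beta>)) \<le> (\<Sum>a\<in>?A. ctype a)"
      using E(3)[OF b] by simp
    then obtain g where g: "\<forall>i\<in>W' \<beta>. g i \<in> ?A" "\<forall>a\<in>?A. enat (card {i\<in>W' \<beta>. g i = a}) \<le> ctype a"
      using exists_assignment[of ?A "W' \<beta>" ctype] finE block_choiceD(4)[OF bc b] by auto
    have "enat (card {i\<in>W' \<beta>. g i = a}) \<le> ctype a" for a
    proof (cases "a \<in> ?A")
      case False
      then have e: "{i\<in>W' \<beta>. g i = a} = {}"
        using g(1) by auto
      show ?thesis
        unfolding e by (simp add: zero_enat_def[symmetric])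
    qed (use g(2) in blast)
    then show ?thesis
      using False g(1) by (intro exI[of _ g]) (auto simp: good_def)
  next
    case True
    let ?A = "{a\<in>E. \<phi> a = \<beta> \<and> ctype a = \<infinity>}"
    have "\<exists>g. (\<forall>i\<in>V \<beta> k. g i \<in> ?A) \<and> (\<forall>a\<in>?A. enat (card {i\<in>V \<beta> k. g i = a}) \<le> enat (cwt a))"
      if k: "k \<in> {1..n}" for k
    proof (rule exists_assignment)
      show "finite (V \<beta> k)"
        using block_choiceD(4,6)[OF bc b] True k finite_subset by blast
      show "enat (card (V \<beta> k)) \<le> (\<Sum>a\<in>?A. enat (cwt a))"
        using E(4)[OF b True] block_choiceD(5)[OF bc b True k] by (simp add: enat_sum[symmetric])
    qed (use finE in simp)
    then have "\<forall>k\<in>{1..n}. \<exists>g. (\<forall>i\<in>V \<beta> k. g i \<in> ?A) \<and> (\<forall>a\<in>?A. enat (card {i\<in>V \<beta> k. g i = a}) \<le> enat (cwt a))"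
      by (rule ballI)
    from bchoice[OF this] obtain G
      where "\<forall>k\<in>{1..n}. (\<forall>i\<in>V \<beta> k. G k i \<in> ?A) \<and> (\<forall>a\<in>?A. enat (card {i\<in>V \<beta> k. G k i = a}) \<le> enat (cwt a))"
      by blast
    then have G: "\<And>k i. k \<in> {1..n} \<Longrightarrow> i \<in> V \<beta> k \<Longrightarrow> G k i \<in> ?A"
      "\<And>k a. k \<in> {1..n} \<Longrightarrow> a \<in> ?A \<Longrightarrow> card {i\<in>V \<beta> k. G k i = a} \<le> cwt a"
      by auto
    obtain g where g: "\<And>k i. k \<in> {1..n} \<Longrightarrow> i \<in> V \<beta> k \<Longrightarrow> g i = G k i"
      using glue_functions[of "{1..n}" "V \<beta>" G] block_choiceD(8)[OF bc b True] by blast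
    have gA: "g i \<in> ?A" if "i \<in> W' \<beta>" for i
      using that block_choiceD(7)[OF bc b True] g G(1) by auto
    have "card {i\<in>V \<beta> k. g i = a} \<le> cwt a" if k: "k \<in> {1..n}" for k a
    proof (cases "a \<in> ?A")
      case True
      have "{i\<in>V \<beta> k. g i = a} = {i\<in>V \<beta> k. G k i = a}"
        using g[OF k] by auto
      then show ?thesis
        using G(2)[OF k True] by simp
    next
      case False
      then have e: "{i\<in>V \<beta> k. g i = a} = {}"
        using g[OF k] G(1)[OF k] by auto
      show ?thesis
        unfolding e by simp
    qed
    then show ?thesis
      using True gA by (intro exI[of _ g]) (auto simp: good_def ctype_infinity)
  qed
  then obtain G where "\<And>\<beta>. \<beta> \<in> K' \<Longrightarrow> good \<beta> (G \<beta>)"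
    by metis
  note G = this[unfolded good_def]
  obtain \<kappa> where \<kappa>: "\<And>\<beta> i. \<beta> \<in> K' \<Longrightarrow> i \<in> W' \<beta> \<Longrightarrow> \<kappa> i = G \<beta> i"
    using glue_functions[of K' W' G] block_choiceD(1)[OF bc] by blast
  have \<phi>: "\<phi> (\<kappa> i) = \<beta>" if "\<beta> \<in> K'" "i \<in> W' \<beta>" for \<beta> i
    using \<kappa> G that by auto
  show ?thesis
  proof (rule that)
    show "\<kappa> i \<in> K" if "\<beta> \<in> K'" "i \<in> W' \<beta>" for \<beta> i
      using \<kappa> G that E(1) by auto
    show "\<kappa> i \<noteq> \<kappa> j" if "\<beta> \<in> K'" "\<gamma> \<in> K'" "\<beta> \<noteq> \<gamma>" "i \<in> W' \<beta>" "j \<in> W' \<gamma>" for \<beta> \<gamma> i j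
      using \<phi> that by metis
    show "active (\<kappa> i)" if "\<beta> \<in> K'" "\<mu> \<beta> = \<infinity>" "i \<in> W' \<beta>" for \<beta> i
      using \<kappa> G that by auto
    show "enat (card {i\<in>W' \<beta>. \<kappa> i = a}) \<le> ctype a" if b: "\<beta> \<in> K'" "\<mu> \<beta> \<noteq> \<infinity>" "a \<in> K" for \<beta> a
    proof -
      have "{i\<in>W' \<beta>. \<kappa> i = a} = {i\<in>W' \<beta>. G \<beta> i = a}"
        using \<kappa> b by auto
      then show ?thesis
        using G b by auto
    qed
    show "card {i\<in>V \<beta> k. \<kappa> i = a} \<le> cwt a" if b: "\<beta> \<in> K'" "\<mu> \<beta> = \<infinity>" "k \<in> {1..n}" "a \<in> K" for \<beta> k a
    proof -
      have "V \<beta> k \<subseteq> W' \<beta>"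
        using block_choiceD(6)[OF bc] b by blast
      then have "{i\<in>V \<beta> k. \<kappa> i = a} = {i\<in>V \<beta> k. G \<beta> i = a}"
        using \<kappa> b by auto
      then show ?thesis
        using G b by auto
    qed
  qed
qed

lemma h_elem_notin:
  assumes x: "(K', \<mu>, d) \<in> wcomps" and le: "(K', \<mu>, d) \<preceq> (K, ctype, cwt)"
    and bc: "block_choice n (K', \<mu>, d) W' V"
  shows "\<exists>\<tau>\<in>Sym_inf. act \<tau> (h_elem n N' (K', \<mu>, d) W' V) \<notin> q"
proof -
  obtain \<kappa> where \<kappa>: "\<And>\<beta> i. \<beta> \<in> K' \<Longrightarrow> i \<in> W' \<beta> \<Longrightarrow> \<kappa> i \<in> K"
    and cross: "\<And>\<beta> \<gamma> i j. \<beta> \<in> K' \<Longrightarrow> \<gamma> \<in> K' \<Longrightarrow> \<beta> \<noteq> \<gamma> \<Longrightarrow> i \<in> W' \<beta> \<Longrightarrow> j \<in> W' \<gamma> \<Longrightarrow> \<kappa> i \<noteq> \<kappa> j"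
    and act_\<kappa>: "\<And>\<beta> i. \<beta> \<in> K' \<Longrightarrow> \<mu> \<beta> = \<infinity> \<Longrightarrow> i \<in> W' \<beta> \<Longrightarrow> active (\<kappa> i)"
    and fibW: "\<And>\<beta> a. \<beta> \<in> K' \<Longrightarrow> \<mu> \<beta> \<noteq> \<infinity> \<Longrightarrow> a \<in> K \<Longrightarrow> enat (card {i\<in>W' \<beta>. \<kappa> i = a}) \<le> ctype a"
    and fibV: "\<And>\<beta> k a. \<beta> \<in> K' \<Longrightarrow> \<mu> \<beta> = \<infinity> \<Longrightarrow> k \<in> {1..n} \<Longrightarrow> a \<in> K \<Longrightarrow> card {i\<in>V \<beta> k. \<kappa> i = a} \<le> cwt a"
    using exists_types[OF assms] by blast
  have finK': "finite K'"
    using x by (rule finite_wcomps)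
  define M where "M = (\<Union>\<beta>\<in>K'. W' \<beta>)"
  have finM: "finite M"
    unfolding M_def using finK' block_choiceD(4)[OF bc] by blast
  have \<kappa>M: "\<kappa> i \<in> K" if "i \<in> M" for i
    using that \<kappa> by (auto simp: M_def)
  \<comment> \<open>Variables meant for active points share one reservoir, the complement of
    \<open>W\<close>; an inactive point offers only its class in \<open>W\<close>.\<close>
  define g where "g i = (if active (\<kappa> i) then None else Some (\<kappa> i))" for i
  define X where "X b = (case b of None \<Rightarrow> - W | Some a \<Rightarrow> cls a)" for b
  have "\<exists>h. inj_on h M \<and> (\<forall>i\<in>M. h i \<in> X (g i))"
  proof (rule exists_placement[where g = g and X = X])
    show "enat (card {i\<in>M. g i = b}) \<le> esize (X b)" if b: "b \<in> g ` M" for b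
    proof (cases b)
      case None
      then show ?thesis
        using finW by (simp add: X_def esize_def)
    next
      case (Some a)
      then obtain i where i: "i \<in> M" "\<kappa> i = a" "\<not> active a"
        using b by (auto simp: g_def split: if_splits)
      then obtain \<beta> where \<beta>: "\<beta> \<in> K'" "i \<in> W' \<beta>"
        by (auto simp: M_def)
      have "\<mu> \<beta> \<noteq> \<infinity>"
        using act_\<kappa>[OF \<beta>(1) _ \<beta>(2)] i by auto
      have "{i\<in>M. g i = b} \<subseteq> {i\<in>W' \<beta>. \<kappa> i = a}"
      proof
        fix j assume "j \<in> {i\<in>M. g i = b}"
        then have j: "j \<in> M" "\<kappa> j = a"
          using Some by (auto simp: g_def split: if_splits)
        then obtain \<gamma> where "\<gamma> \<in> K'" "j \<in> W' \<gamma>"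
          by (auto simp: M_def)
        then show "j \<in> {i\<in>W' \<beta>. \<kappa> i = a}"
          using cross[of \<beta> \<gamma> i j] \<beta> i j by auto
      qed
      then have "enat (card {i\<in>M. g i = b}) \<le> enat (card {i\<in>W' \<beta>. \<kappa> i = a})"
        using block_choiceD(4)[OF bc \<beta>(1)] by (simp add: card_mono)
      also have "\<dots> \<le> ctype a"
        using fibW[OF \<beta>(1) \<open>\<mu> \<beta> \<noteq> \<infinity>\<close>] \<kappa>M[OF i(1)] i(2) by simp
      also have "\<dots> = esize (X b)"
        using i(3) Some finW by (simp add: ctype_def X_def esize_def cls_def)
      finally show ?thesis .
    qed
    show "X b \<inter> X c = {}" if "b \<in> g ` M" "c \<in> g ` M" "b \<noteq> c" for b c
      using that cls_disjoint \<kappa>M by (fastforce simp: X_def g_def cls_def split: if_splits)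
  qed (rule finM)
  then obtain h where h: "inj_on h M" "\<And>i. i \<in> M \<Longrightarrow> h i \<in> X (g i)"
    by blast
  obtain \<tau> where \<tau>: "\<tau> \<in> Sym_inf" "\<And>i. i \<in> M \<Longrightarrow> \<tau> i = h i"
    using Sym_inf_extend[OF finM h(1)] by blast
  define M' where "M' = {i\<in>M. active (\<kappa> i)}"
  define \<epsilon> :: "nat \<Rightarrow> 'a R" where "\<epsilon> i = Var (\<tau> i) - Var (\<kappa> i)" for i
  have out: "\<tau> i \<notin> W" if "i \<in> M'" for i
    using h(2)[of i] \<tau>(2)[of i] that by (auto simp: X_def g_def M'_def)
  have eps0: "\<epsilon> i \<in> q" if "i \<in> M - M'" for i
    using h(2)[of i] \<tau>(2)[of i] that by (auto simp: X_def g_def M'_def \<epsilon>_def cls_def)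
  have finM': "finite M'"
    using finM by (simp add: M'_def)
  have inj\<tau>: "inj \<tau>"
    using \<tau>(1) by (rule Sym_inf_inj)
  \<comment> \<open>Multiplying by \<open>L\<close> localises every outside variable at its chosen
    point, so modulo the colon ideal \<open>I\<close> all \<open>\<epsilon> i\<close> are
    nilpotent.\<close>
  define L :: "'a R" where "L = (\<Prod>i\<in>M'. away K N (\<kappa> i) (\<tau> i))"
  have socle: "(\<Prod>i\<in>M'. \<epsilon> i ^ (cwt (\<kappa> i) - 1)) * L \<notin> q"
  proof -
    have "(\<Prod>j\<in>\<tau> ` M'. socle (\<kappa> (inv \<tau> j)) j) \<notin> q"
      using out finM' \<kappa>M inj\<tau> by (intro prod_socle_notin) (auto simp: M'_def)
    moreover have "(\<Prod>j\<in>\<tau> ` M'. socle (\<kappa> (inv \<tau> j)) j) = (\<Prod>i\<in>M'. socle (\<kappa> i) (\<tau> i))"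
      using inj\<tau> inj_on_subset[OF inj\<tau>] by (simp add: prod.reindex)
    ultimately show ?thesis
      by (simp add: socle_def prod.distrib L_def \<epsilon>_def)
  qed
  define I where "I = {z. z * L \<in> q}"
  have I: "is_ideal I"
    unfolding I_def by (rule is_ideal_colon[OF Iq])
  have eps_pow: "\<epsilon> i ^ cwt (\<kappa> i) \<in> I" if i: "i \<in> M'" for i
  proof -
    have "\<epsilon> i ^ cwt (\<kappa> i) * away K N (\<kappa> i) (\<tau> i) \<in> q"
      using pow_depth_away[OF \<kappa>M out[OF i]] i by (auto simp: \<epsilon>_def cwt_def M'_def)
    moreover have "\<epsilon> i ^ cwt (\<kappa> i) * away K N (\<kappa> i) (\<tau> i) dvd \<epsilon> i ^ cwt (\<kappa> i) * L"
      unfolding L_def using finM' i by (intro mult_dvd_mono dvd_prodI) auto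
    ultimately show ?thesis
      unfolding I_def using ideal_dvd[OF Iq] by blast
  qed
  have eps_nil: "\<exists>k. \<epsilon> i ^ k \<in> I" if "i \<in> M" for i
  proof (cases "i \<in> M'")
    case False
    then have "\<epsilon> i ^ 1 \<in> I"
      using eps0[of i] that ideal_mult_right[OF Iq] by (auto simp: I_def)
    then show ?thesis
      by blast
  qed (use eps_pow in blast)
  \<comment> \<open>For different types the difference is a fixed difference, regular modulo
    \<open>q\<close>, plus a nilpotent one, hence regular modulo \<open>I\<close>. All factors of h
    between different types can be cancelled.\<close>
  have cancel: "z \<in> I" if ij: "i \<in> M" "j \<in> M" "\<kappa> i \<noteq> \<kappa> j" and z: "z * (Var (\<tau> i) - Var (\<tau> j)) \<in> I" for i j z
  proof -
    obtain k k' where k: "\<epsilon> i ^ k \<in> I" "\<epsilon> j ^ k' \<in> I"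
      using eps_nil ij by blast
    have Iz: "is_ideal {u. u * z \<in> I}"
      by (rule is_ideal_colon[OF I])
    have "(\<epsilon> i - \<epsilon> j) ^ (k + k') \<in> I"
      by (rule ideal_power_diff[OF I k]) simp
    then have 1: "(\<epsilon> i - \<epsilon> j) ^ (k + k') \<in> {u. u * z \<in> I}"
      using ideal_mult_right[OF I] by blast
    have 2: "(Var (\<tau> i) - Var (\<tau> j)) ^ 1 \<in> {u. u * z \<in> I}"
      using z by (simp add: mult.commute)
    have "((Var (\<tau> i) - Var (\<tau> j)) - (\<epsilon> i - \<epsilon> j)) ^ (1 + (k + k')) \<in> {u. u * z \<in> I}"
      by (rule ideal_power_diff[OF Iz 2 1]) simp
    moreover have "(Var (\<tau> i) - Var (\<tau> j)) - (\<epsilon> i - \<epsilon> j) = Var (\<kappa> i) - Var (\<kappa> j)"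
      by (simp add: \<epsilon>_def)
    ultimately have "(z * L) * (Var (\<kappa> i) - Var (\<kappa> j)) ^ (1 + (k + k')) \<in> q"
      unfolding I_def by (simp add: mult_ac)
    then show ?thesis
      unfolding I_def using cancel_diff_power[OF \<kappa>M \<kappa>M, OF ij] by blast
  qed
  let ?x = "\<lambda>i. Var (\<tau> i) :: 'a R"
  let ?Inf = "{\<beta>\<in>K'. \<mu> \<beta> = \<infinity>}"
  define \<Gamma> where "\<Gamma> = ?Inf \<times> {1..n}"
  define B where "B = (\<lambda>(\<beta>, k). V \<beta> k)"
  have fin\<Gamma>: "finite \<Gamma>"
    using finK' by (simp add: \<Gamma>_def)
  have BM: "B \<gamma> \<subseteq> M'" "finite (B \<gamma>)" if "\<gamma> \<in> \<Gamma>" for \<gamma>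
  proof -
    obtain \<beta> k where \<gamma>: "\<gamma> = (\<beta>, k)" "\<beta> \<in> K'" "\<mu> \<beta> = \<infinity>" "k \<in> {1..n}"
      using \<open>\<gamma> \<in> \<Gamma>\<close> by (auto simp: \<Gamma>_def)
    have "V \<beta> k \<subseteq> W' \<beta>"
      using block_choiceD(6)[OF bc \<gamma>(2-4)] .
    then show "B \<gamma> \<subseteq> M'"
      using \<gamma> act_\<kappa> by (auto simp: B_def M'_def M_def)
    then show "finite (B \<gamma>)"
      using finM' finite_subset by blast
  qed
  have BM': "i \<in> M'" "i \<in> M" "\<kappa> i \<in> K" if "\<gamma> \<in> \<Gamma>" "i \<in> B \<gamma>" for \<gamma> i
    using BM(1)[OF that(1)] that(2) \<kappa>M by (auto simp: M'_def)
  have Bdisj: "B \<gamma> \<inter> B \<gamma>' = {}" if \<gamma>\<Gamma>: "\<gamma> \<in> \<Gamma>" "\<gamma>' \<in> \<Gamma>" and neq: "\<gamma> \<noteq> \<gamma>'" for \<gamma> \<gamma>'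
  proof -
    obtain \<beta> k \<beta>' k' where \<gamma>: "\<gamma> = (\<beta>, k)" "\<beta> \<in> K'" "\<mu> \<beta> = \<infinity>" "k \<in> {1..n}"
      "\<gamma>' = (\<beta>', k')" "\<beta>' \<in> K'" "\<mu> \<beta>' = \<infinity>" "k' \<in> {1..n}"
      using \<gamma>\<Gamma> by (auto simp: \<Gamma>_def)
    show ?thesis
    proof (cases "\<beta> = \<beta>'")
      case True
      then show ?thesis
        using block_choiceD(8)[OF bc \<gamma>(2-4,8)] \<gamma> neq by (auto simp: B_def)
    next
      case False
      then show ?thesis
        using block_choiceD(1)[OF bc \<gamma>(2,6)] block_choiceD(6)[OF bc \<gamma>(2-4)] block_choiceD(6)[OF bc \<gamma>(6-8)] \<gamma>
        by (auto simp: B_def)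
    qed
  qed
  show ?thesis
  proof (rule ccontr)
    assume "\<not> ?thesis"
    then have "act \<tau> (h_elem n N' (K', \<mu>, d) W' V) \<in> q"
      using \<tau>(1) by blast
    then have "act \<tau> (h_elem n N' (K', \<mu>, d) W' V) \<in> I"
      unfolding I_def using ideal_mult_right[OF Iq] by blast
    then have "(\<Prod>\<beta>\<in>?Inf. \<Prod>k\<in>{1..n}. vand ?x (V \<beta> k)) * (\<Prod>(i, j)\<in>cross_pairs K' W'. (?x i - ?x j) ^ N') \<in> I"
      by (simp add: rhom_h_elem[OF rhom_act])
    then have "(\<Prod>\<beta>\<in>?Inf. \<Prod>k\<in>{1..n}. vand ?x (V \<beta> k)) \<in> I"
    proof (rule cancel_prod[rotated])
      fix f :: "nat \<times> nat" and z
      assume f: "f \<in> cross_pairs K' W'" and z: "z * (case f of (i, j) \<Rightarrow> (?x i - ?x j) ^ N') \<in> I"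
      obtain i j where ij: "f = (i, j)" by fastforce
      have "i \<in> M" "j \<in> M" "\<kappa> i \<noteq> \<kappa> j"
        using f cross unfolding ij cross_pairs_def M_def by blast+
      then have "z \<in> I" if "z * (?x i - ?x j) \<in> I" for z
        using cancel[OF _ _ _ that] by blast
      then show "z \<in> I"
        using z cancel_power[of "?x i - ?x j" I z N'] by (simp add: ij)
    qed
    then have "(\<Prod>\<gamma>\<in>\<Gamma>. vand ?x (B \<gamma>)) \<in> I"
      by (simp add: \<Gamma>_def B_def prod.cartesian_product case_prod_beta)
    moreover have "(\<Prod>\<gamma>\<in>\<Gamma>. vand ?x (B \<gamma>)) = (\<Prod>\<gamma>\<in>\<Gamma>. \<Prod>a\<in>K. vand ?x {i\<in>B \<gamma>. \<kappa> i = a}) *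
        (\<Prod>\<gamma>\<in>\<Gamma>. \<Prod>(i, j)\<in>{(i, j). i \<in> B \<gamma> \<and> j \<in> B \<gamma> \<and> i < j \<and> \<kappa> i \<noteq> \<kappa> j}. ?x i - ?x j)"
      unfolding prod.distrib[symmetric]
      by (intro prod.cong refl vand_split_types finK) (use BM(2) BM'(3) in blast)+
    ultimately have "(\<Prod>\<gamma>\<in>\<Gamma>. \<Prod>a\<in>K. vand ?x {i\<in>B \<gamma>. \<kappa> i = a}) *
        (\<Prod>\<gamma>\<in>\<Gamma>. \<Prod>(i, j)\<in>{(i, j). i \<in> B \<gamma> \<and> j \<in> B \<gamma> \<and> i < j \<and> \<kappa> i \<noteq> \<kappa> j}. ?x i - ?x j) \<in> I"
      by simp
    \<comment> \<open>Cancelling mixed factors inside the sub-blocks leaves one Vandermonde product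
      for each sub-block and type, to which the socle argument applies.\<close>
    then have "(\<Prod>\<gamma>\<in>\<Gamma>. \<Prod>a\<in>K. vand ?x {i\<in>B \<gamma>. \<kappa> i = a}) \<in> I"
    proof (rule cancel_prod[rotated])
      fix \<gamma> z assume \<gamma>: "\<gamma> \<in> \<Gamma>"
        and z: "z * (\<Prod>(i, j)\<in>{(i, j). i \<in> B \<gamma> \<and> j \<in> B \<gamma> \<and> i < j \<and> \<kappa> i \<noteq> \<kappa> j}. ?x i - ?x j) \<in> I"
      from z show "z \<in> I"
      proof (rule cancel_prod[rotated])
        fix f :: "nat \<times> nat" and z
        assume f: "f \<in> {(i, j). i \<in> B \<gamma> \<and> j \<in> B \<gamma> \<and> i < j \<and> \<kappa> i \<noteq> \<kappa> j}"
          and z: "z * (case f of (i, j) \<Rightarrow> ?x i - ?x j) \<in> I"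
        then show "z \<in> I"
          using cancel[of "fst f" "snd f" z] BM'(2)[OF \<gamma>] by (simp add: case_prod_beta)
      qed
    qed
    moreover have "vand ?x {i\<in>B \<gamma>. \<kappa> i = a} = vand \<epsilon> {i\<in>B \<gamma>. \<kappa> i = a}" for \<gamma> a
      by (rule vand_cong) (auto simp: \<epsilon>_def)
    ultimately have "1 * (\<Prod>f\<in>\<Gamma> \<times> K. vand \<epsilon> {i\<in>B (fst f). \<kappa> i = snd f}) \<in> I"
      by (simp add: prod.cartesian_product case_prod_beta)
    then have "1 * (\<Prod>f\<in>\<Gamma> \<times> K. \<Prod>i\<in>{i\<in>B (fst f). \<kappa> i = snd f}. \<epsilon> i ^ (cwt (snd f) - 1)) \<in> I"
    proof (rule vand_socle_family[OF I, rotated 3])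
      show "finite (\<Gamma> \<times> K)"
        using fin\<Gamma> finK by simp
      show "finite {i\<in>B (fst f). \<kappa> i = snd f} \<and> card {i\<in>B (fst f). \<kappa> i = snd f} \<le> cwt (snd f)"
        if "f \<in> \<Gamma> \<times> K" for f
        using that BM(2)[of "fst f"] fibV by (auto simp: \<Gamma>_def B_def)
      show "\<epsilon> i ^ cwt (snd f) \<in> I" if "f \<in> \<Gamma> \<times> K" "i \<in> {i\<in>B (fst f). \<kappa> i = snd f}" for f i
        using that eps_pow[of i] BM'(1)[of "fst f" i] by (simp add: mem_Times_iff)
    qed
    \<comment> \<open>The pieces are disjoint subsets of \<open>M'\<close>, and their exponents are
      the socle exponents.\<close>
    moreover have "(\<Prod>f\<in>\<Gamma> \<times> K. \<Prod>i\<in>{i\<in>B (fst f). \<kappa> i = snd f}. \<epsilon> i ^ (cwt (snd f) - 1)) dvd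
        (\<Prod>i\<in>M'. \<epsilon> i ^ (cwt (\<kappa> i) - 1))"
    proof -
      let ?S = "\<lambda>f. {i\<in>B (fst f). \<kappa> i = snd f}"
      have "(\<Prod>f\<in>\<Gamma> \<times> K. \<Prod>i\<in>?S f. \<epsilon> i ^ (cwt (snd f) - 1)) = (\<Prod>f\<in>\<Gamma> \<times> K. \<Prod>i\<in>?S f. \<epsilon> i ^ (cwt (\<kappa> i) - 1))"
        by (intro prod.cong refl) auto
      also have "\<dots> = (\<Prod>i\<in>(\<Union>f\<in>\<Gamma> \<times> K. ?S f). \<epsilon> i ^ (cwt (\<kappa> i) - 1))"
      proof (rule prod.UNION_disjoint[symmetric])
        show "finite (\<Gamma> \<times> K)"
          using fin\<Gamma> finK by simp
        show "\<forall>f\<in>\<Gamma> \<times> K. finite (?S f)"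
          using BM(2) by auto
        show "\<forall>f\<in>\<Gamma> \<times> K. \<forall>f'\<in>\<Gamma> \<times> K. f \<noteq> f' \<longrightarrow> ?S f \<inter> ?S f' = {}"
          using Bdisj by (fastforce simp: prod_eq_iff)
      qed
      also have "\<dots> dvd (\<Prod>i\<in>M'. \<epsilon> i ^ (cwt (\<kappa> i) - 1))"
        by (intro prod_dvd_prod_subset finM') (use BM'(1) in \<open>auto simp: mem_Times_iff\<close>)
      finally show ?thesis .
    qed
    ultimately have "(\<Prod>i\<in>M'. \<epsilon> i ^ (cwt (\<kappa> i) - 1)) \<in> I"
      using ideal_dvd[OF I] by simp
    then show False
      using socle by (simp add: I_def)
  qed
qed

end

section \<open>Newton expansions\<close>

text \<open>Polynomials in the \<open>\<xi>\<^sub>i\<close> are expanded in products of factors \<open>\<xi>\<^sub>i - t\<^sub>\<alpha>\<close>, where \<open>\<alpha>\<close> runs through the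
  sequence \<open>r i\<close>. In contrast to Taylor coefficients at distinct points, the coefficients of such an expansion
  specialise when the points \<open>t\<^sub>\<alpha>\<close> collide.\<close>

type_synonym ('i, 'a) tR = "(nat, ('i, 'a) mpoly) mpoly"

definition newton_factor :: "(nat \<Rightarrow> 'i) \<Rightarrow> nat \<Rightarrow> nat \<Rightarrow> ('i, 'a::comm_ring_1) tR" where
  "newton_factor \<rho> i k = (\<Prod>j<k. Var i - Const (Var (\<rho> j)))"

definition newton_basis :: "(nat \<Rightarrow> nat \<Rightarrow> 'i) \<Rightarrow> (nat \<Rightarrow>\<^sub>0 nat) \<Rightarrow> ('i, 'a::comm_ring_1) tR" where
  "newton_basis r m = (\<Prod>i\<in>kys m. newton_factor (r i) i (lkp m i))"

definition newton_sum :: "(nat \<Rightarrow> nat \<Rightarrow> 'i) \<Rightarrow> ('i, 'a::comm_ring_1) tR \<Rightarrow> ('i, 'a) tR" where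
  "newton_sum r c = (\<Sum>m\<in>kys c. Const (lkp c m) * newton_basis r m)"

lemma newton_basis_superset:
  "finite T \<Longrightarrow> kys m \<subseteq> T \<Longrightarrow> newton_basis r m = (\<Prod>i\<in>T. newton_factor (r i) i (lkp m i))"
  unfolding newton_basis_def by (rule prod.mono_neutral_left) (auto simp: in_keys_iff newton_factor_def)

lemma newton_basis_add_single:
  fixes r :: "nat \<Rightarrow> nat \<Rightarrow> 'i"
  shows "(newton_basis r (m + Poly_Mapping.single i 1) :: ('i, 'a::comm_ring_1) tR) =
     newton_basis r m * (Var i - Const (Var (r i (lkp m i))))"
proof -
  let ?T = "insert i (kys m)"
  have T: "finite ?T" "kys m \<subseteq> ?T" "kys (m + Poly_Mapping.single i 1) \<subseteq> ?T"
    using keys_add[of m "Poly_Mapping.single i 1"] by auto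
  have "(\<Prod>j\<in>?T - {i}. newton_factor (r j) j (lkp (m + Poly_Mapping.single i 1) j)) =
      (\<Prod>j\<in>?T - {i}. newton_factor (r j) j (lkp m j) :: ('i, 'a) tR)"
    by (intro prod.cong) (auto simp: lookup_add lookup_single)
  then show ?thesis
    unfolding newton_basis_superset[OF T(1,2)] newton_basis_superset[OF T(1,3)]
    using T(1) unfolding prod.remove[OF T(1) insertI1]
    by (simp only:) (simp add: lookup_add newton_factor_def mult_ac)
qed

lemma newton_sum_superset:
  "finite S \<Longrightarrow> kys c \<subseteq> S \<Longrightarrow> newton_sum r c = (\<Sum>m\<in>S. Const (lkp c m) * newton_basis r m)"
  unfolding newton_sum_def by (rule sum.mono_neutral_left) (auto simp: in_keys_iff Const_0)

lemma newton_sum_add: "newton_sum r (c + c') = newton_sum r c + newton_sum r c'"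
  using keys_add[of c c']
  by (simp add: newton_sum_superset[of "kys c \<union> kys c'"] lookup_add Const_add distrib_right sum.distrib)

lemma newton_sum_single: "newton_sum r (Poly_Mapping.single m a) = Const a * newton_basis r m"
  by (subst newton_sum_superset[of "{m}"]) auto

definition newton_span :: "(nat \<Rightarrow> nat \<Rightarrow> 'i) \<Rightarrow> nat set \<Rightarrow> ('i, 'a::comm_ring_1) tR set" where
  "newton_span r T = {newton_sum r c |c. vars c \<subseteq> T}"

lemma newton_span_add: "g \<in> newton_span r T \<Longrightarrow> g' \<in> newton_span r T \<Longrightarrow> g + g' \<in> newton_span r T"
proof -
  assume "g \<in> newton_span r T" "g' \<in> newton_span r T"
  then obtain c c' where "g = newton_sum r c" "g' = newton_sum r c'" "vars c \<subseteq> T" "vars c' \<subseteq> T"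
    by (auto simp: newton_span_def)
  then show ?thesis
    unfolding newton_span_def using vars_add[of c c']
    by (intro CollectI exI[of _ "c + c'"]) (auto simp: newton_sum_add)
qed

lemma newton_span_single: "kys m \<subseteq> T \<Longrightarrow> Const a * newton_basis r m \<in> newton_span r T"
  unfolding newton_span_def
  by (intro CollectI exI[of _ "Poly_Mapping.single m a"]) (auto simp: newton_sum_single vars_def)

lemma newton_span_0: "0 \<in> newton_span r T"
  unfolding newton_span_def by (intro CollectI exI[of _ 0]) (auto simp: newton_sum_def vars_def)

lemma newton_span_sum: "(\<And>x. x \<in> S \<Longrightarrow> g x \<in> newton_span r T) \<Longrightarrow> sum g S \<in> newton_span r T"
  by (induction S rule: infinite_finite_induct) (auto intro: newton_span_0 newton_span_add)

lemma newton_span_E: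
  assumes "g \<in> newton_span r T"
  obtains c where "g = (\<Sum>m\<in>kys c. Const (lkp c m) * newton_basis r m)" "\<And>m. m \<in> kys c \<Longrightarrow> kys m \<subseteq> T"
  using assms unfolding newton_span_def newton_sum_def vars_def by auto

lemma newton_span_Const:
  assumes "g \<in> newton_span r T"
  shows "Const a * g \<in> newton_span r T"
proof -
  obtain c where c: "g = (\<Sum>m\<in>kys c. Const (lkp c m) * newton_basis r m)" "\<And>m. m \<in> kys c \<Longrightarrow> kys m \<subseteq> T"
    using assms by (rule newton_span_E) blast
  have "Const a * g = (\<Sum>m\<in>kys c. Const (a * lkp c m) * newton_basis r m)"
    by (simp add: c(1) sum_distrib_left Const_mult mult.assoc)
  then show ?thesis
    using c(2) by (auto intro!: newton_span_sum newton_span_single)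
qed

text \<open>\<open>Var i\<close> is the next Newton factor plus a scalar, so every polynomial has an
  expansion and no division occurs.\<close>

lemma newton_span_Var:
  assumes "g \<in> newton_span r T" and i: "i \<in> T"
  shows "Var i * g \<in> newton_span r T"
proof -
  obtain c where c: "g = (\<Sum>m\<in>kys c. Const (lkp c m) * newton_basis r m)" "\<And>m. m \<in> kys c \<Longrightarrow> kys m \<subseteq> T"
    using assms(1) by (rule newton_span_E) blast
  have "Var i * (Const a * newton_basis r m) \<in> newton_span r T" if m: "kys m \<subseteq> T" for a m
  proof -
    have "Var i * (Const a * newton_basis r m) =
        Const a * newton_basis r (m + Poly_Mapping.single i 1) + Const (a * Var (r i (lkp m i))) * newton_basis r m"
      unfolding newton_basis_add_single by (simp add: Const_mult algebra_simps)
    moreover have "kys (m + Poly_Mapping.single i 1) \<subseteq> T"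
      using keys_add[of m "Poly_Mapping.single i 1"] m i by auto
    ultimately show ?thesis
      using m by (auto intro!: newton_span_add newton_span_single)
  qed
  then show ?thesis
    unfolding c(1) sum_distrib_left using c(2) by (intro newton_span_sum) auto
qed

definition embed :: "'a::comm_ring_1 R \<Rightarrow> ('i, 'a) tR" where
  "embed = poly_hom (\<lambda>a. Const (Const a)) Var"

lemma rhom_embed_const: "rhom (\<lambda>a. Const (Const a))"
  by (rule rhom_comp[OF rhom_Const rhom_Const])

lemma embed_in_newton_span: "embed f \<in> newton_span r (vars f)"
  unfolding embed_def poly_hom_def
proof (rule newton_span_sum)
  fix m assume m: "m \<in> kys f"
  have one: "1 \<in> newton_span r (vars f)"
    using newton_span_single[of 0 "vars f" 1 r] by (simp add: newton_basis_def Const_1)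
  have pow: "Var i ^ k * g \<in> newton_span r (vars f)" if "i \<in> vars f" "g \<in> newton_span r (vars f)" for i k g
    using that by (induction k) (auto simp: mult.assoc intro: newton_span_Var)
  have "(\<Prod>x\<in>S. Var x ^ lkp m x) \<in> newton_span r (vars f)" if "S \<subseteq> vars f" for S
    using that by (induction S rule: infinite_finite_induct) (auto intro: one pow)
  moreover have "kys m \<subseteq> vars f"
    using m by (auto simp: vars_def)
  ultimately show "Const (Const (lkp f m)) * (\<Prod>x\<in>kys m. Var x ^ lkp m x) \<in> newton_span r (vars f)"
    by (intro newton_span_Const) auto
qed

lemma rhom_newton_factor:
  assumes "rhom \<Theta>"
  shows "\<Theta> (newton_factor \<rho> i k) = (\<Prod>j<k. \<Theta> (Var i) - \<Theta> (Const (Var (\<rho> j))))"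
  unfolding newton_factor_def using assms by (simp add: rhom_prod rhom_diff)

text \<open>Writing \<open>u\<close> as \<open>(u + v) - v\<close> puts a power of this unit into
  the ideal of elements that multiply \<open>z\<close> into \<open>D\<close>.\<close>

lemma ideal_cancel_unit_plus_nilpotent:
  assumes D: "is_ideal D" and u: "u * u' = 1" and v: "v ^ k \<in> D" and z: "z * (u + v) \<in> D"
  shows "z \<in> (D :: 'r::comm_ring_1 set)"
proof -
  have I: "is_ideal {y. y * z \<in> D}"
    by (rule is_ideal_colon[OF D])
  have 1: "(u + v) ^ 1 \<in> {y. y * z \<in> D}"
    using z by (simp add: mult.commute)
  have 2: "v ^ k \<in> {y. y * z \<in> D}"
    using v ideal_mult_right[OF D] by blast
  have "((u + v) - v) ^ (1 + k) \<in> {y. y * z \<in> D}"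
    by (rule ideal_power_diff[OF I 1 2]) simp
  then have "u' ^ (1 + k) * (u ^ (1 + k) * z) \<in> D"
    using ideal_mult_left[OF D] by simp
  moreover have "u' ^ (1 + k) * (u ^ (1 + k) * z) = (u * u') ^ (1 + k) * z"
    by (simp add: power_mult_distrib mult_ac)
  ultimately show ?thesis
    by (simp add: u)
qed

lemma block_index_Sym_inf:
  assumes U: "partition_of_type l U" and T: "finite T"
    and card: "\<And>\<alpha>. enat (card {i\<in>T. g i = \<alpha>}) \<le> l \<alpha>"
  shows "\<exists>\<sigma>\<in>Sym_inf. \<forall>i\<in>T. block_index U (\<sigma> i) = g i"
proof -
  have "\<exists>h. inj_on h T \<and> (\<forall>i\<in>T. h i \<in> U (g i))"
  proof (rule exists_placement[where g = g and X = U])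
    show "enat (card {i\<in>T. g i = b}) \<le> esize (U b)" for b
      using card U by (simp add: partition_of_type_def)
    show "U b \<inter> U c = {}" if "b \<noteq> c" for b c
      using U that by (auto simp: partition_of_type_def disjoint_family_on_def)
  qed (rule T)
  then obtain h where h: "inj_on h T" "\<And>i. i \<in> T \<Longrightarrow> h i \<in> U (g i)"
    by blast
  obtain \<sigma> where "\<sigma> \<in> Sym_inf" "\<And>i. i \<in> T \<Longrightarrow> \<sigma> i = h i"
    using Sym_inf_extend[OF T h(1)] by blast
  then show ?thesis
    using h(2) block_index_eq[OF U] by (intro bexI[of _ \<sigma>]) auto
qed

text \<open>The bounds \<open>E i\<close> count the roots that matter. For a multi-index \<open>m < E\<close>, substituting
  \<open>t\<^sub>\<alpha> + \<epsilon>\<close> with \<open>\<alpha> = r i (m i)\<close> for \<open>\<xi>\<^sub>i\<close> isolates the coefficient of \<open>m\<close>.\<close>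

lemma newton_coeff_in_prime:
  fixes f :: "'a::comm_ring_1 R" and U :: "'i \<Rightarrow> nat set" and P :: "('i, 'a) S0 set"
  assumes e: "weighting UNIV e" and U: "partition_of_type l U"
    and f: "f \<in> frakP U e Spec" and P: "is_prime_ideal P"
    and c: "embed f = newton_sum r c" "vars c \<subseteq> vars f"
    and mult: "\<And>i k. i \<in> vars f \<Longrightarrow> k < E i \<Longrightarrow> card {k'. k' < E i \<and> r i k' = r i k} \<le> e (r i k)"
    and place: "\<And>g \<alpha>. (\<And>i. i \<in> vars f \<Longrightarrow> g i < E i) \<Longrightarrow> enat (card {i\<in>vars f. r i (g i) = \<alpha>}) \<le> l \<alpha>"
  shows "\<And>m. (\<And>i. i \<in> vars f \<Longrightarrow> lkp m i < E i) \<Longrightarrow> m \<in> kys c \<Longrightarrow> to_S0 (lkp c m) \<in> P"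
proof -
  let ?T = "vars f"
  have IP: "is_ideal P"
    using P by (simp add: is_prime_ideal_def)
  fix m assume "\<And>i. i \<in> ?T \<Longrightarrow> lkp m i < E i" "m \<in> kys c"
  then show "to_S0 (lkp c m) \<in> P"
  proof (induction "\<Sum>i\<in>?T. lkp m i" arbitrary: m rule: less_induct)
    case less
    note mE = less.prems(1)
    have supp: "kys n \<subseteq> ?T" if "n \<in> kys c" for n
      using c(2) that by (auto simp: vars_def)
    define \<alpha> where "\<alpha> i = r i (lkp m i)" for i
    obtain \<sigma> where \<sigma>: "\<sigma> \<in> Sym_inf" "\<And>i. i \<in> ?T \<Longrightarrow> block_index U (\<sigma> i) = \<alpha> i"
      using block_index_Sym_inf[OF U finite_vars, of f \<alpha>] place[OF mE] unfolding \<alpha>_def by blast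
    have inj: "inj \<sigma>"
      using \<sigma>(1) by (rule Sym_inf_inj)
    \<comment> \<open>How often this root was used before, that is, the order in \<epsilon> of the
      basis element of \<open>m\<close>.\<close>
    define Q where "Q i = card {k. k < lkp m i \<and> r i k = \<alpha> i}" for i
    have Qe: "Q i < e (\<alpha> i)" if i: "i \<in> ?T" for i
    proof -
      have "Suc (Q i) = card (insert (lkp m i) {k. k < lkp m i \<and> r i k = \<alpha> i})"
        by (simp add: Q_def)
      also have "\<dots> \<le> card {k'. k' < E i \<and> r i k' = \<alpha> i}"
        using mE[OF i] by (intro card_mono) (auto simp: \<alpha>_def)
      also have "\<dots> \<le> e (\<alpha> i)"
        using mult[OF i mE[OF i]] by (simp add: \<alpha>_def)
      finally show ?thesis by simp
    qed
    \<comment> \<open>The cut-off is just above that order: anything of higher order in some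
      variable lies in \<open>D\<close>, and \<open>D\<close> still contains \<open>frakQ\<close>
      because the order is below the weight.\<close>
    define E' where "E' j = (if j \<in> \<sigma> ` ?T then Suc (Q (inv \<sigma> j)) else 1)" for j
    have E'\<sigma>: "E' (\<sigma> i) = Suc (Q i)" if "i \<in> ?T" for i
      using that inj by (simp add: E'_def)
    define D where "D = pow_ideal E' P"
    have D: "is_ideal D"
      unfolding D_def by (rule is_ideal_pow_ideal)
    have VarD: "Var (\<sigma> i) ^ Suc (Q i) \<in> D" if "i \<in> ?T" for i
      unfolding D_def pow_ideal_def E'\<sigma>[OF that, symmetric] by (intro ideal_gen_base) blast
    have ConstD: "Const x \<in> D" if "x \<in> P" for x
      unfolding D_def pow_ideal_def using that by (intro ideal_gen_base) blast
    have E'_le: "E' j \<le> e (block_index U j)" for j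
    proof (cases "j \<in> \<sigma> ` ?T")
      case True
      then show ?thesis
        using E'\<sigma> \<sigma>(2) Qe by (auto simp: Suc_le_eq)
    next
      case False
      then show ?thesis
        using e by (simp add: E'_def weighting_def)
    qed
    have I0: "is_ideal (I0 Spec :: ('i, 'a) S0 set)" "I0 Spec \<subseteq> P"
      unfolding I0_def using P by (auto intro!: is_ideal_Inter simp: Spec_def is_prime_ideal_def)
    have "frakQ U e Spec \<subseteq> D"
    proof
      fix g :: "('i, 'a) Stilde" assume "g \<in> frakQ U e Spec"
      then have "lkp g n \<in> P" if "\<forall>j. lkp n j < E' j" for n
        using that E'_le I0 by (auto simp: frakQ_eq_pow_ideal pow_ideal_iff intro: less_le_trans)
      then show "g \<in> D"
        unfolding D_def pow_ideal_iff[OF IP] by blast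
    qed
    then have fD: "iota U (act \<sigma> f) \<in> D"
      using f \<sigma>(1) by (auto simp: frakP_def)
    define \<Theta> :: "('i, 'a) tR \<Rightarrow> ('i, 'a) Stilde" where
      "\<Theta> = poly_hom (\<lambda>x. Const (to_S0 x)) (\<lambda>i. Const (to_S0 (Var (\<alpha> i))) + Var (\<sigma> i))"
    have hom: "rhom (\<lambda>x. Const (to_S0 x))"
      by (rule rhom_comp[OF rhom_Const rhom_to_S0])
    have \<Theta>: "rhom \<Theta>"
      unfolding \<Theta>_def by (rule rhom_poly_hom[OF hom])
    have \<Theta>_Const: "\<Theta> (Const x) = Const (to_S0 x)" and \<Theta>_Var: "\<Theta> (Var i) = Const (to_S0 (Var (\<alpha> i))) + Var (\<sigma> i)" for x i
      unfolding \<Theta>_def by (simp_all add: poly_hom_Const[OF hom] poly_hom_Var[OF hom])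
    have "\<Theta> (embed f) = poly_hom (\<lambda>a. Const (to_S0 (Const a))) (\<lambda>i. Const (to_S0 (Var (\<alpha> i))) + Var (\<sigma> i)) f"
      unfolding embed_def
      by (rule rhom_eqI[OF rhom_comp[OF \<Theta> rhom_poly_hom[OF rhom_embed_const]] rhom_poly_hom[OF rhom_iota_const]])
        (simp_all add: poly_hom_Const[OF rhom_embed_const] poly_hom_Var[OF rhom_embed_const]
          poly_hom_Const[OF rhom_iota_const] poly_hom_Var[OF rhom_iota_const] \<Theta>_Const \<Theta>_Var)
    also have "\<dots> = poly_hom (\<lambda>a. Const (to_S0 (Const a))) (\<lambda>i. Const (to_S0 (Var (block_index U (\<sigma> i)))) + Var (\<sigma> i)) f"
      using \<sigma>(2) by (intro poly_hom_cong) simp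
    also have "\<dots> = iota U (act \<sigma> f)"
      by (rule rhom_eqI[OF rhom_poly_hom[OF rhom_iota_const] rhom_comp[OF rhom_iota rhom_act]])
        (simp_all add: iota_Const iota_Var poly_hom_Const[OF rhom_iota_const] poly_hom_Var[OF rhom_iota_const])
    finally have sumD: "(\<Sum>n\<in>kys c. Const (to_S0 (lkp c n)) * \<Theta> (newton_basis r n)) \<in> D"
      using fD by (simp add: c(1) newton_sum_def rhom_sum[OF \<Theta>] rhom_mult[OF \<Theta>] \<Theta>_Const)
    have fac: "\<Theta> (newton_factor (r i) i k) =
        (\<Prod>j<k. Const (to_S0 (Var (\<alpha> i) - Var (r i j))) + Var (\<sigma> i))" for i k
      by (simp add: rhom_newton_factor[OF \<Theta>] \<Theta>_Const \<Theta>_Var rhom_diff[OF hom] algebra_simps)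
    have fac_split: "\<Theta> (newton_factor (r i) i k) =
        (\<Prod>j\<in>{j. j < k \<and> r i j \<noteq> \<alpha> i}. Const (to_S0 (Var (\<alpha> i) - Var (r i j))) + Var (\<sigma> i)) *
        Var (\<sigma> i) ^ card {j. j < k \<and> r i j = \<alpha> i}" for i k
    proof -
      have "{..<k} = {j. j < k \<and> r i j \<noteq> \<alpha> i} \<union> {j. j < k \<and> r i j = \<alpha> i}"
        by auto
      then have "\<Theta> (newton_factor (r i) i k) =
          (\<Prod>j\<in>{j. j < k \<and> r i j \<noteq> \<alpha> i}. Const (to_S0 (Var (\<alpha> i) - Var (r i j))) + Var (\<sigma> i)) *
          (\<Prod>j\<in>{j. j < k \<and> r i j = \<alpha> i}. Const (to_S0 (Var (\<alpha> i) - Var (r i j))) + Var (\<sigma> i))"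
        unfolding fac by (subst prod.union_disjoint[symmetric]) auto
      also have "(\<Prod>j\<in>{j. j < k \<and> r i j = \<alpha> i}. Const (to_S0 (Var (\<alpha> i) - Var (r i j))) + Var (\<sigma> i)) =
          (\<Prod>j\<in>{j. j < k \<and> r i j = \<alpha> i}. Var (\<sigma> i) :: ('i, 'a) Stilde)"
        by (intro prod.cong) (auto simp: rhom_0[OF hom])
      finally show ?thesis
        by simp
    qed
    have basis: "\<Theta> (newton_basis r n) = (\<Prod>i\<in>?T. \<Theta> (newton_factor (r i) i (lkp n i)))" if "n \<in> kys c" for n
      by (simp add: newton_basis_superset[OF finite_vars supp[OF that]] rhom_prod[OF \<Theta>])
    \<comment> \<open>If \<open>n\<close> is componentwise at most \<open>m\<close>, its coefficient
      is in \<open>P\<close> by induction. Otherwise, in some variable, its basis element contains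
      the root \<open>\<alpha> i\<close> once more than that of \<open>m\<close>.\<close>
    have other: "Const (to_S0 (lkp c n)) * \<Theta> (newton_basis r n) \<in> D" if n: "n \<in> kys c" "n \<noteq> m" for n
    proof (cases "\<forall>i\<in>?T. lkp n i \<le> lkp m i")
      case True
      have "\<exists>i\<in>?T. lkp n i \<noteq> lkp m i"
      proof (rule ccontr)
        assume no: "\<not> ?thesis"
        have "lkp n i = lkp m i" for i
          using no supp[OF n(1)] supp[OF less.prems(2)] by (metis in_keys_iff subsetD)
        then show False
          using n(2) by (metis poly_mapping_eqI)
      qed
      then have "\<exists>i\<in>?T. lkp n i < lkp m i"
        using True le_neq_implies_less by blast
      then have "(\<Sum>i\<in>?T. lkp n i) < (\<Sum>i\<in>?T. lkp m i)"
        using True by (intro sum_strict_mono_ex1) auto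
      moreover have "\<And>i. i \<in> ?T \<Longrightarrow> lkp n i < E i"
        using True mE le_less_trans by blast
      ultimately have "to_S0 (lkp c n) \<in> P"
        using less.hyps n(1) by blast
      then show ?thesis
        using ConstD ideal_mult_right[OF D] by blast
    next
      case False
      then obtain i where i: "i \<in> ?T" "lkp m i < lkp n i"
        by (auto simp: not_le)
      have "Suc (Q i) = card (insert (lkp m i) {k. k < lkp m i \<and> r i k = \<alpha> i})"
        by (simp add: Q_def)
      also have "\<dots> \<le> card {k. k < lkp n i \<and> r i k = \<alpha> i}"
        using i by (intro card_mono) (auto simp: \<alpha>_def)
      finally have "Var (\<sigma> i) ^ card {k. k < lkp n i \<and> r i k = \<alpha> i} \<in> D"
        using VarD[OF i(1)] ideal_dvd[OF D] le_imp_power_dvd by blast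
      then have "\<Theta> (newton_factor (r i) i (lkp n i)) \<in> D"
        unfolding fac_split by (rule ideal_mult_left[OF D])
      moreover have "\<Theta> (newton_factor (r i) i (lkp n i)) dvd \<Theta> (newton_basis r n)"
        unfolding basis[OF n(1)] using i(1) by (intro dvd_prodI) auto
      ultimately show ?thesis
        using ideal_dvd[OF D] ideal_mult_left[OF D] by blast
    qed
    let ?term = "\<lambda>n. Const (to_S0 (lkp c n)) * \<Theta> (newton_basis r n)"
    have "(\<Sum>n\<in>kys c - {m}. ?term n) \<in> D"
      using other by (intro ideal_sum[OF D]) auto
    then have "(\<Sum>n\<in>kys c. ?term n) - (\<Sum>n\<in>kys c - {m}. ?term n) \<in> D"
      by (rule ideal_diff[OF D sumD])
    moreover have "(\<Sum>n\<in>kys c. ?term n) = ?term m + (\<Sum>n\<in>kys c - {m}. ?term n)"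
      using less.prems(2) by (intro sum.remove) auto
    ultimately have "?term m \<in> D"
      by simp
    \<comment> \<open>Roots other than \<open>\<alpha> i\<close> contribute an invertible difference
      plus an \<epsilon>. Cancelling them leaves the coefficient times a monomial below the
      cut-off.\<close>
    then have "(Const (to_S0 (lkp c m)) * (\<Prod>i\<in>?T. Var (\<sigma> i) ^ Q i)) *
        (\<Prod>i\<in>?T. \<Prod>j\<in>{j. j < lkp m i \<and> r i j \<noteq> \<alpha> i}. Const (to_S0 (Var (\<alpha> i) - Var (r i j))) + Var (\<sigma> i)) \<in> D"
      unfolding basis[OF less.prems(2)] fac_split prod.distrib Q_def[symmetric] by (simp only: mult_ac)
    then have "Const (to_S0 (lkp c m)) * (\<Prod>i\<in>?T. Var (\<sigma> i) ^ Q i) \<in> D"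
    proof (rule cancel_prod[rotated])
      fix i z assume i: "i \<in> ?T"
        and z: "z * (\<Prod>j\<in>{j. j < lkp m i \<and> r i j \<noteq> \<alpha> i}. Const (to_S0 (Var (\<alpha> i) - Var (r i j))) + Var (\<sigma> i)) \<in> D"
      from z show "z \<in> D"
      proof (rule cancel_prod[rotated])
        fix j z assume j: "j \<in> {j. j < lkp m i \<and> r i j \<noteq> \<alpha> i}"
          and z: "z * (Const (to_S0 (Var (\<alpha> i) - Var (r i j))) + Var (\<sigma> i)) \<in> D"
        obtain u :: "('i, 'a) S0" where "to_S0 (Var (\<alpha> i) - Var (r i j)) * u = 1"
          using to_S0_unit[of "\<alpha> i" "r i j"] j by auto
        then have "Const (to_S0 (Var (\<alpha> i) - Var (r i j))) * Const u = (1 :: ('i, 'a) Stilde)"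
          by (simp add: Const_mult[symmetric] Const_1)
        then show "z \<in> D"
          using ideal_cancel_unit_plus_nilpotent[OF D _ VarD[OF i] z] by blast
      qed
    qed
    moreover define n where "n = (\<Sum>i\<in>?T. Poly_Mapping.single (\<sigma> i) (Q i))"
    have "(\<Prod>i\<in>S. Var (\<sigma> i) ^ Q i :: ('i, 'a) Stilde) = mono_val Var (\<Sum>i\<in>S. Poly_Mapping.single (\<sigma> i) (Q i))" for S
      by (induction S rule: infinite_finite_induct) (auto simp: mono_val_add mono_val_single)
    ultimately have nD: "Poly_Mapping.single n (to_S0 (lkp c m)) \<in> D"
      by (simp add: single_eq_mono_val n_def)
    have "lkp n j < E' j" for j
    proof (cases "j \<in> \<sigma> ` ?T")
      case True
      then obtain i where i: "i \<in> ?T" "j = \<sigma> i"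
        by blast
      have "lkp n j = (\<Sum>i'\<in>?T. if i' = i then Q i' else 0)"
        using inj by (auto simp: n_def lookup_sum lookup_single when_def i(2) inj_eq intro!: sum.cong)
      also have "\<dots> = Q i"
        using i(1) by simp
      finally show ?thesis
        using E'\<sigma>[OF i(1)] i(2) by simp
    next
      case False
      then have "lkp n j = 0"
        by (auto simp: n_def lookup_sum lookup_single when_def intro!: sum.neutral)
      then show ?thesis
        using False by (simp add: E'_def)
    qed
    then have "lkp (Poly_Mapping.single n (to_S0 (lkp c m))) n \<in> P"
      using nD unfolding D_def pow_ideal_iff[OF IP] by blast
    then show ?case
      by simp
  qed
qed

text \<open>A coefficient in all primes of \<open>S0\<close> is nilpotent there, hence already in
  the polynomial ring in the t's, where the points are still allowed to collide.\<close>

lemma newton_coeff_nilpotent: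
  fixes f :: "'a::comm_ring_1 R" and U :: "'i \<Rightarrow> nat set"
  assumes e: "weighting UNIV e" and U: "partition_of_type l U"
    and f: "f \<in> frakP U e Spec"
    and c: "embed f = newton_sum r c" "vars c \<subseteq> vars f"
    and mult: "\<And>i k. i \<in> vars f \<Longrightarrow> k < E i \<Longrightarrow> card {k'. k' < E i \<and> r i k' = r i k} \<le> e (r i k)"
    and place: "\<And>g \<alpha>. (\<And>i. i \<in> vars f \<Longrightarrow> g i < E i) \<Longrightarrow> enat (card {i\<in>vars f. r i (g i) = \<alpha>}) \<le> l \<alpha>"
    and m: "\<And>i. i \<in> vars f \<Longrightarrow> lkp m i < E i"
  shows "\<exists>k. lkp c m ^ k = 0"
proof (cases "m \<in> kys c")
  case True
  have "to_S0 (lkp c m) \<in> P" if "is_prime_ideal P" for P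
    by (rule newton_coeff_in_prime[OF e U f that c mult place m True]) blast+
  then obtain k where "to_S0 (lkp c m) ^ k = 0"
    using nilpotent_if_in_all_primes by blast
  then have "to_S0 (lkp c m ^ k) = 0"
    by (simp add: rhom_power[OF rhom_to_S0])
  then show ?thesis
    using to_S0_eq_0 by blast
next
  case False
  then show ?thesis
    by (intro exI[of _ 1]) (simp add: in_keys_iff)
qed

section \<open>Vanishing of \<open>\<PP>(\<lambda>, e)\<close> on a configuration\<close>

context sat_config
begin

lemma away_cover_family:
  assumes "finite S"
  shows "(\<And>\<pi>. (\<And>i. i \<in> S \<Longrightarrow> \<pi> i \<in> K) \<Longrightarrow> x * (\<Prod>i\<in>S. away K N (\<pi> i) i) \<in> q) \<Longrightarrow> x \<in> q"
  using assms
proof (induction S arbitrary: x rule: finite_induct)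
  case empty
  then show ?case
    by simp
next
  case (insert j S)
  show ?case
  proof (rule away_cover)
    fix a assume a: "a \<in> K"
    show "x * away K N a j \<in> q"
    proof (rule insert.IH)
      fix \<pi> assume \<pi>: "\<And>i. i \<in> S \<Longrightarrow> \<pi> i \<in> K"
      have "x * (\<Prod>i\<in>insert j S. away K N ((\<pi>(j := a)) i) i) \<in> q"
        using \<pi> a by (intro insert.prems) auto
      moreover have "(\<Prod>i\<in>S. away K N ((\<pi>(j := a)) i) i :: 'a R) = (\<Prod>i\<in>S. away K N (\<pi> i) i)"
        using insert.hyps by (intro prod.cong) auto
      ultimately show "x * away K N a j * (\<Prod>i\<in>S. away K N (\<pi> i) i) \<in> q"
        using insert.hyps by (simp add: mult.assoc)
    qed
  qed
qed

lemma nilpotent_fixed_in_q: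
  assumes "x ^ k = 0" "\<And>s. s \<in> fixing W \<Longrightarrow> s x = x"
  shows "x \<in> q"
proof (rule ccontr)
  assume "x \<notin> q"
  moreover have "1 * x ^ k \<in> q"
    using assms(1) ideal_0[OF Iq] by simp
  ultimately show False
    using equi_prime_power[OF q, of x 1 k] assms(2) one by blast
qed

text \<open>At an active point every infinite \<open>\<alpha>\<close> matched to it serves as a root
  \<open>e \<alpha>\<close> times, which gives at least \<open>cwt\<close> roots. At an inactive
  point each variable gets a single root, assigned within the capacities \<open>l \<alpha>\<close>,
  so that any choice of one root per variable can be realised by a permutation.\<close>

lemma exists_roots:
  fixes l :: "'i::finite \<Rightarrow> enat"
  assumes e: "weighting UNIV e" and le: "(K, ctype, cwt) \<preceq> (UNIV, l, e)"
    and T: "finite T" and \<kappa>: "\<And>i. i \<in> T \<Longrightarrow> \<kappa> i \<in> K"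
    and inactive: "\<And>i. i \<in> T \<Longrightarrow> \<not> active (\<kappa> i) \<Longrightarrow> i \<in> cls (\<kappa> i)"
  shows "\<exists>(r :: nat \<Rightarrow> nat \<Rightarrow> 'i) E \<phi>. (\<forall>\<alpha>. \<phi> \<alpha> \<in> K) \<and>
    (\<forall>i\<in>T. cwt (\<kappa> i) \<le> E i \<and>
      (\<forall>k<E i. \<phi> (r i k) = \<kappa> i \<and> card {k'. k' < E i \<and> r i k' = r i k} \<le> e (r i k))) \<and>
    (\<forall>g \<alpha>. (\<forall>i\<in>T. g i < E i) \<longrightarrow> enat (card {i\<in>T. r i (g i) = \<alpha>}) \<le> l \<alpha>)"
proof -
  obtain F \<phi> where F: "\<phi> ` F \<subseteq> K"
    "\<And>a. a \<in> K \<Longrightarrow> ctype a \<le> (\<Sum>\<alpha>\<in>{\<alpha>\<in>F. \<phi> \<alpha> = a}. l \<alpha>)"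
    "\<And>a. a \<in> K \<Longrightarrow> ctype a = \<infinity> \<Longrightarrow> cwt a \<le> (\<Sum>\<alpha>\<in>{\<alpha>\<in>F. \<phi> \<alpha> = a \<and> l \<alpha> = \<infinity>}. e \<alpha>)"
    using le unfolding wcomp_le_iff by blast
  define n where "n a = (\<Sum>\<alpha>\<in>{\<alpha>\<in>F. \<phi> \<alpha> = a \<and> l \<alpha> = \<infinity>}. e \<alpha>)" for a
  define good_t where "good_t a t \<longleftrightarrow> (\<forall>k\<in>{..<n a}. t k \<in> {\<alpha>\<in>F. \<phi> \<alpha> = a \<and> l \<alpha> = \<infinity>}) \<and>
      (\<forall>\<alpha>\<in>{\<alpha>\<in>F. \<phi> \<alpha> = a \<and> l \<alpha> = \<infinity>}. enat (card {k\<in>{..<n a}. t k = \<alpha>}) \<le> enat (e \<alpha>))" for a t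
  have "\<exists>t. good_t a t" for a
    unfolding good_t_def by (rule exists_assignment) (auto simp: n_def enat_sum[symmetric])
  then obtain t' where "\<And>a. good_t a (t' a)"
    by metis
  note t' = this[unfolded good_t_def]
  obtain t where t: "\<And>a k. k < n a \<Longrightarrow> t a k \<in> {\<alpha>\<in>F. \<phi> \<alpha> = a \<and> l \<alpha> = \<infinity>}"
    "\<And>a \<alpha>. \<alpha> \<in> {\<alpha>\<in>F. \<phi> \<alpha> = a \<and> l \<alpha> = \<infinity>} \<Longrightarrow> card {k\<in>{..<n a}. t a k = \<alpha>} \<le> e \<alpha>"
    using t' by (intro that[of t']) auto
  define good_s where "good_s a s \<longleftrightarrow> (a \<in> K \<longrightarrow> \<not> active a \<longrightarrow> (\<forall>i\<in>{i\<in>T. \<kappa> i = a}. s i \<in> {\<alpha>\<in>F. \<phi> \<alpha> = a}) \<and>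
      (\<forall>\<alpha>\<in>{\<alpha>\<in>F. \<phi> \<alpha> = a}. enat (card {i\<in>{i\<in>T. \<kappa> i = a}. s i = \<alpha>}) \<le> l \<alpha>))" for a s
  have "\<exists>s. good_s a s" for a
  proof (cases "a \<in> K \<and> \<not> active a")
    case True
    have "card {i\<in>T. \<kappa> i = a} \<le> card (cls a)"
      using inactive True finW by (intro card_mono) (auto simp: cls_def)
    then have "enat (card {i\<in>T. \<kappa> i = a}) \<le> ctype a"
      using True by (simp add: ctype_def)
    also have "\<dots> \<le> (\<Sum>\<alpha>\<in>{\<alpha>\<in>F. \<phi> \<alpha> = a}. l \<alpha>)"
      using F(2) True by blast
    finally show ?thesis
      using exists_assignment[of "{\<alpha>\<in>F. \<phi> \<alpha> = a}" "{i\<in>T. \<kappa> i = a}" l] T unfolding good_s_def by simp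
  qed (auto simp: good_s_def)
  then obtain s where "\<And>a. good_s a (s a)"
    by metis
  note s = this[unfolded good_s_def]
  have s1: "s a i \<in> F \<and> \<phi> (s a i) = a" if "a \<in> K" "\<not> active a" "i \<in> T" "\<kappa> i = a" for a i
    using s[of a] that by auto
  have s2: "enat (card {i\<in>{i\<in>T. \<kappa> i = \<phi> \<alpha>}. s (\<phi> \<alpha>) i = \<alpha>}) \<le> l \<alpha>"
    if "\<phi> \<alpha> \<in> K" "\<not> active (\<phi> \<alpha>)" "\<alpha> \<in> F" for \<alpha>
    using s[of "\<phi> \<alpha>"] that by blast
  define E where "E i = (if active (\<kappa> i) then n (\<kappa> i) else 1)" for i
  define r where "r i k = (if active (\<kappa> i) then t (\<kappa> i) k else s (\<kappa> i) i)" for i k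
  obtain a0 where a0: "a0 \<in> K"
    using K_nonempty by blast
  \<comment> \<open>Indices outside \<open>F\<close> are sent to an arbitrary point, since the
    specialisation must be defined on all t's.\<close>
  define \<psi> where "\<psi> \<alpha> = (if \<alpha> \<in> F then \<phi> \<alpha> else a0)" for \<alpha>
  have rF: "r i k \<in> F" "\<phi> (r i k) = \<kappa> i" if "i \<in> T" "k < E i" for i k
    using that t(1)[of k "\<kappa> i"] s1[of "\<kappa> i" i] \<kappa>[of i] by (auto simp: r_def E_def split: if_splits)
  show ?thesis
  proof (intro exI conjI allI ballI impI)
    show "\<psi> \<alpha> \<in> K" for \<alpha>
      using F(1) a0 by (auto simp: \<psi>_def)
    show "\<psi> (r i k) = \<kappa> i" if "i \<in> T" "k < E i" for i k
      using rF[OF that] by (simp add: \<psi>_def)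
    show "cwt (\<kappa> i) \<le> E i" if "i \<in> T" for i
      using F(3)[OF \<kappa>[OF that]] by (auto simp: E_def n_def ctype_infinity cwt_def)
    show "card {k'. k' < E i \<and> r i k' = r i k} \<le> e (r i k)" if ik: "i \<in> T" "k < E i" for i k
    proof (cases "active (\<kappa> i)")
      case True
      then have "t (\<kappa> i) k \<in> {\<alpha>\<in>F. \<phi> \<alpha> = \<kappa> i \<and> l \<alpha> = \<infinity>}"
        using ik t(1) by (simp add: E_def)
      then show ?thesis
        using t(2)[of "t (\<kappa> i) k" "\<kappa> i"] True by (simp add: r_def E_def)
    next
      case False
      have "1 \<le> e (r i k)"
        using e by (simp add: weighting_def)
      then show ?thesis
        using False by (simp add: E_def r_def)
    qed
    show "enat (card {i\<in>T. r i (g i) = \<alpha>}) \<le> l \<alpha>" if "\<forall>i\<in>T. g i < E i" for g \<alpha>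
    proof (cases "l \<alpha> = \<infinity> \<or> {i\<in>T. r i (g i) = \<alpha>} = {}")
      note g = bspec[OF that]
      case True
      show ?thesis
        using True
      proof
        assume e: "{i\<in>T. r i (g i) = \<alpha>} = {}"
        show ?thesis
          unfolding e by (simp add: zero_enat_def[symmetric])
      qed simp
    next
      note g = bspec[OF that]
      case False
      have sub: "\<not> active (\<kappa> i) \<and> \<kappa> i = \<phi> \<alpha> \<and> s (\<phi> \<alpha>) i = \<alpha> \<and> \<alpha> \<in> F" if i: "i \<in> T" "r i (g i) = \<alpha>" for i
      proof -
        have "\<not> active (\<kappa> i)"
        proof
          assume "active (\<kappa> i)"
          then have "l \<alpha> = \<infinity>"
            using t(1)[of "g i" "\<kappa> i"] g[OF i(1)] i by (auto simp: r_def E_def)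
          then show False
            using False by blast
        qed
        then show ?thesis
          using rF[OF i(1) g[OF i(1)]] i(2) by (auto simp: r_def)
      qed
      obtain j where j: "j \<in> T" "r j (g j) = \<alpha>"
        using False by blast
      have "{i\<in>T. r i (g i) = \<alpha>} \<subseteq> {i\<in>{i\<in>T. \<kappa> i = \<phi> \<alpha>}. s (\<phi> \<alpha>) i = \<alpha>}"
        using sub by blast
      then have "enat (card {i\<in>T. r i (g i) = \<alpha>}) \<le> enat (card {i\<in>{i\<in>T. \<kappa> i = \<phi> \<alpha>}. s (\<phi> \<alpha>) i = \<alpha>})"
        using T by (simp add: card_mono)
      also have "\<dots> \<le> l \<alpha>"
        using s2[of \<alpha>] sub[OF j] \<kappa>[OF j(1)] by metis
      finally show ?thesis .
    qed
  qed
qed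

text \<open>After localising each outside variable at a point, a suitable Newton expansion has two
  kinds of terms: coefficients that are nilpotent, and basis elements with enough equal factors to
  vanish modulo \<open>q\<close>.\<close>

lemma frakP_subset_q:
  fixes l :: "'i::finite \<Rightarrow> enat"
  assumes e: "weighting UNIV e" and U: "partition_of_type l U"
    and le: "(K, ctype, cwt) \<preceq> (UNIV, l, e)" and f: "f \<in> frakP U e Spec"
  shows "f \<in> q"
proof (rule away_cover_family)
  show "finite (vars f - W)"
    by simp
  fix \<pi> assume \<pi>: "\<And>i. i \<in> vars f - W \<Longrightarrow> \<pi> i \<in> K"
  let ?T = "vars f"
  define L :: "'a R" where "L = (\<Prod>i\<in>?T - W. away K N (\<pi> i) i)"
  have away_dvd: "away K N (\<pi> i) i dvd L" if "i \<in> ?T - W" for i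
    unfolding L_def using that by (intro dvd_prodI) auto
  show "f * (\<Prod>i\<in>?T - W. away K N (\<pi> i) i) \<in> q"
    unfolding L_def[symmetric]
  proof (cases "\<forall>i\<in>?T - W. active (\<pi> i)")
    case False
    then obtain i where i: "i \<in> ?T - W" "\<not> active (\<pi> i)"
      by blast
    then have "away K N (\<pi> i) i \<in> q"
      using active_iff[of "\<pi> i" i] \<pi> by auto
    then show "f * L \<in> q"
      using away_dvd[OF i(1)] ideal_dvd[OF Iq] ideal_mult_left[OF Iq] by blast
  next
    case True
    obtain \<rho> where \<rho>: "\<And>w. w \<in> W \<Longrightarrow> \<rho> w \<in> K \<and> Var w - Var (\<rho> w) \<in> q"
      using rep by metis
    define \<kappa> where "\<kappa> i = (if i \<in> W then \<rho> i else \<pi> i)" for i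
    have \<kappa>: "\<kappa> i \<in> K" if "i \<in> ?T" for i
      using that \<pi> \<rho> by (auto simp: \<kappa>_def)
    have inactive: "i \<in> cls (\<kappa> i)" if "i \<in> ?T" "\<not> active (\<kappa> i)" for i
      using that True \<rho> by (auto simp: \<kappa>_def cls_def split: if_splits)
    obtain r :: "nat \<Rightarrow> nat \<Rightarrow> 'i" and E \<phi> where roots: "\<forall>\<alpha>. \<phi> \<alpha> \<in> K"
      "\<forall>i\<in>?T. cwt (\<kappa> i) \<le> E i \<and>
        (\<forall>k<E i. \<phi> (r i k) = \<kappa> i \<and> card {k'. k' < E i \<and> r i k' = r i k} \<le> e (r i k))"
      "\<forall>g \<alpha>. (\<forall>i\<in>?T. g i < E i) \<longrightarrow> enat (card {i\<in>?T. r i (g i) = \<alpha>}) \<le> l \<alpha>"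
      using exists_roots[OF e le finite_vars[of f] \<kappa> inactive] by blast
    then have \<phi>: "\<And>\<alpha>. \<phi> \<alpha> \<in> K" "\<And>i k. i \<in> ?T \<Longrightarrow> k < E i \<Longrightarrow> \<phi> (r i k) = \<kappa> i"
      and E: "\<And>i. i \<in> ?T \<Longrightarrow> cwt (\<kappa> i) \<le> E i"
      and mult: "\<And>i k. i \<in> ?T \<Longrightarrow> k < E i \<Longrightarrow> card {k'. k' < E i \<and> r i k' = r i k} \<le> e (r i k)"
      and place: "\<And>g \<alpha>. (\<And>i. i \<in> ?T \<Longrightarrow> g i < E i) \<Longrightarrow> enat (card {i\<in>?T. r i (g i) = \<alpha>}) \<le> l \<alpha>"
      by auto
    have E1: "1 \<le> E i" if "i \<in> ?T" for i
      using E[OF that] depth_pos[OF \<kappa>[OF that]] by (auto simp: cwt_def split: if_splits)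
    obtain c :: "('i, 'a) tR" where c: "embed f = newton_sum r c" "vars c \<subseteq> ?T"
      using embed_in_newton_span[of f r] unfolding newton_span_def by blast
    \<comment> \<open>The specialisation of t_\<alpha> to its matched point. It need not be
      injective on points, so it is defined on polynomials and not on \<open>S0\<close>.\<close>
    define \<theta> :: "('i, 'a) mpoly \<Rightarrow> 'a R" where "\<theta> = poly_hom Const (\<lambda>\<alpha>. Var (\<phi> \<alpha>))"
    have \<theta>: "rhom \<theta>"
      unfolding \<theta>_def by (rule rhom_poly_hom[OF rhom_Const])
    have \<theta>_simps: "\<theta> (Const a) = Const a" "\<theta> (Var \<alpha>) = Var (\<phi> \<alpha>)" for a \<alpha>
      unfolding \<theta>_def by (simp_all add: poly_hom_Const poly_hom_Var rhom_Const)
    define \<Lambda> :: "('i, 'a) tR \<Rightarrow> 'a R" where "\<Lambda> = poly_hom \<theta> Var"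
    have \<Lambda>: "rhom \<Lambda>"
      unfolding \<Lambda>_def by (rule rhom_poly_hom[OF \<theta>])
    have \<Lambda>_simps: "\<Lambda> (Const y) = \<theta> y" "\<Lambda> (Var i) = Var i" for y i
      unfolding \<Lambda>_def by (simp_all add: poly_hom_Const[OF \<theta>] poly_hom_Var[OF \<theta>])
    have "\<Lambda> (embed f) = f"
      unfolding embed_def
      by (rule rhom_eqI[OF rhom_comp[OF \<Lambda> rhom_poly_hom[OF rhom_embed_const]] rhom_id])
        (simp_all add: poly_hom_Const[OF rhom_embed_const] poly_hom_Var[OF rhom_embed_const] \<Lambda>_simps \<theta>_simps)
    then have "(\<Sum>m\<in>kys c. \<theta> (lkp c m) * \<Lambda> (newton_basis r m)) = f"
      by (simp add: c(1) newton_sum_def rhom_sum[OF \<Lambda>] rhom_mult[OF \<Lambda>] \<Lambda>_simps)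
    then have fL: "f * L = (\<Sum>m\<in>kys c. \<theta> (lkp c m) * \<Lambda> (newton_basis r m) * L)"
      by (simp add: sum_distrib_right[symmetric])
    have fixed: "s (\<theta> y) = \<theta> y" if sW: "s \<in> fixing W" for s y
    proof -
      obtain \<sigma> where \<sigma>: "s = act \<sigma>" "\<And>w. w \<in> W \<Longrightarrow> \<sigma> w = w"
        using sW by (rule fixingE) blast
      have \<sigma>\<phi>: "\<sigma> (\<phi> \<alpha>) = \<phi> \<alpha>" for \<alpha>
        using \<phi>(1) KW \<sigma>(2) by blast
      show ?thesis
        unfolding \<sigma>(1) by (rule rhom_eqI[OF rhom_comp[OF rhom_act \<theta>] \<theta>]) (simp_all add: \<theta>_simps \<sigma>\<phi>)
    qed
    have "\<theta> (lkp c m) * \<Lambda> (newton_basis r m) * L \<in> q" for m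
    proof (cases "\<forall>i\<in>?T. lkp m i < E i")
      case True
      then obtain k where "lkp c m ^ k = 0"
        using newton_coeff_nilpotent[OF e U f c mult place, of m] by blast
      then have "\<theta> (lkp c m) ^ k = 0"
        using rhom_power[OF \<theta>, of "lkp c m" k] rhom_0[OF \<theta>] by simp
      \<comment> \<open>The specialised coefficient involves only variables of \<open>K\<close>;
        being fixed and nilpotent, it lies in \<open>q\<close>.\<close>
      then have "\<theta> (lkp c m) \<in> q"
        by (rule nilpotent_fixed_in_q) (rule fixed)
      then show ?thesis
        using ideal_mult_right[OF Iq] by blast
    next
      case False
      then obtain i where i: "i \<in> ?T" "E i \<le> lkp m i"
        by (auto simp: not_less)
      have "i \<in> kys m"
        using i E1[OF i(1)] by (auto simp: in_keys_iff)
      \<comment> \<open>The first \<open>E i\<close> roots of the \<open>i\<close>-th variable all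
        specialise to \<open>\<kappa> i\<close>, so the basis element contains a power reaching the
        nilpotency order.\<close>
      have "(Var i - Var (\<kappa> i)) ^ cwt (\<kappa> i) dvd (Var i - Var (\<kappa> i) :: 'a R) ^ E i"
        by (rule le_imp_power_dvd[OF E[OF i(1)]])
      also have "\<dots> = (\<Prod>j<E i. Var i - Var (\<phi> (r i j)))"
        using \<phi>(2)[OF i(1)] by simp
      also have "\<dots> dvd \<Lambda> (newton_factor (r i) i (lkp m i))"
        unfolding rhom_newton_factor[OF \<Lambda>] \<Lambda>_simps \<theta>_simps using i(2) by (intro prod_dvd_prod_subset) auto
      also have "\<dots> dvd \<Lambda> (newton_basis r m)"
        unfolding newton_basis_def rhom_prod[OF \<Lambda>] using \<open>i \<in> kys m\<close> by (intro dvd_prodI) auto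
      finally have dvd: "(Var i - Var (\<kappa> i)) ^ cwt (\<kappa> i) dvd \<Lambda> (newton_basis r m)" .
      have "(Var i - Var (\<kappa> i)) ^ cwt (\<kappa> i) * L \<in> q"
      proof (cases "i \<in> W")
        case True
        then have "Var i - Var (\<kappa> i) \<in> q"
          using \<rho> by (simp add: \<kappa>_def)
        moreover have "cwt (\<kappa> i) \<noteq> 0"
          using depth_pos[OF \<kappa>[OF i(1)]] by (auto simp: cwt_def)
        ultimately have "(Var i - Var (\<kappa> i)) ^ cwt (\<kappa> i) \<in> q"
          using ideal_dvd[OF Iq] by (metis dvd_power neq0_conv)
        then show ?thesis
          by (rule ideal_mult_right[OF Iq])
      next
        case False
        then have iT: "i \<in> ?T - W" and \<kappa>i: "\<kappa> i = \<pi> i"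
          using i(1) by (auto simp: \<kappa>_def)
        have "(Var i - Var (\<kappa> i)) ^ cwt (\<kappa> i) * away K N (\<kappa> i) i \<in> q"
          using pow_depth_away[OF \<kappa>[OF i(1)] False] \<open>\<forall>i\<in>?T - W. active (\<pi> i)\<close> iT
          by (simp add: cwt_def \<kappa>i)
        then show ?thesis
          using ideal_dvd[OF Iq] mult_dvd_mono[OF dvd_refl away_dvd[OF iT]] unfolding \<kappa>i by blast
      qed
      then have "\<Lambda> (newton_basis r m) * L \<in> q"
        using ideal_dvd[OF Iq] mult_dvd_mono[OF dvd dvd_refl] by blast
      then show ?thesis
        using ideal_mult_left[OF Iq] by (simp add: mult.assoc)
    qed
    then show "f * L \<in> q"
      unfolding fL by (rule ideal_sum[OF Iq])
  qed
qed

end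

section \<open>The \<open>\<SS>\<close>-radical\<close>

text \<open>All factors are differences of distinct variables among the first \<open>m\<close>. This
  yields the power of a discriminant demanded by \<open>exists_config\<close>.\<close>

lemma h_elem_dvd_vand:
  assumes bc: "block_choice n (K, \<mu>, d) W V"
  shows "\<exists>m M. (h_elem n N (K, \<mu>, d) W V :: 'a::comm_ring_1 R) dvd vand Var {..<m} ^ M"
proof -
  define m where "m = (\<Sum>\<beta>\<in>K. par_tau n \<mu> d \<beta>)"
  let ?v = "vand Var {..<m} :: 'a R"
  let ?Inf = "{\<beta>\<in>K. \<mu> \<beta> = \<infinity>}"
  have W: "W \<beta> \<subseteq> {..<m}" if "\<beta> \<in> K" for \<beta>
    using block_choiceD(2)[OF bc] that unfolding m_def by blast
  have V: "V \<beta> k \<subseteq> {..<m}" if "\<beta> \<in> K" "\<mu> \<beta> = \<infinity>" "k \<in> {1..n}" for \<beta> k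
    using block_choiceD(6)[OF bc that] W[OF that(1)] by blast
  have "(\<Prod>\<beta>\<in>?Inf. \<Prod>k\<in>{1..n}. vand Var (V \<beta> k)) dvd (\<Prod>\<beta>\<in>?Inf. \<Prod>k\<in>{1..n}. ?v)"
    using V by (intro prod_dvd_prod vand_subset_dvd) auto
  also have "\<dots> = ?v ^ (n * card ?Inf)"
    by (simp add: power_mult)
  finally have 1: "(\<Prod>\<beta>\<in>?Inf. \<Prod>k\<in>{1..n}. vand Var (V \<beta> k)) dvd ?v ^ (n * card ?Inf)" .
  have "(\<Prod>(i, j)\<in>cross_pairs K W. Var i - Var j) dvd ?v"
    unfolding vand_def
    by (intro prod_dvd_prod_subset finite_pairs finite_lessThan) (use W in \<open>auto simp: cross_pairs_def\<close>)
  then have "(\<Prod>(i, j)\<in>cross_pairs K W. Var i - Var j) ^ N dvd ?v ^ N"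
    by (rule dvd_power_same)
  moreover have "(\<Prod>(i, j)\<in>cross_pairs K W. (Var i - Var j) ^ N) = (\<Prod>(i, j)\<in>cross_pairs K W. Var i - Var j :: 'a R) ^ N"
    by (simp add: prod_power_distrib case_prod_beta)
  ultimately have "(\<Prod>(i, j)\<in>cross_pairs K W. (Var i - Var j) ^ N) dvd ?v ^ N"
    by simp
  with 1 have "h_elem n N (K, \<mu>, d) W V dvd ?v ^ (n * card ?Inf) * ?v ^ N"
    unfolding h_elem_eq by (rule mult_dvd_mono)
  then show ?thesis
    unfolding power_add[symmetric] by blast
qed

lemma Psi0_Xi: "c \<in> Psi0 y \<Longrightarrow> c \<in> Xi"
  by (simp add: Psi0_def Psi_def)

theorem theorem7p5:
  fixes l :: "'i::finite \<Rightarrow> enat"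
    and e :: "'i \<Rightarrow> nat"
    and U :: "'i \<Rightarrow> nat set"
    and h :: "nat wcomp set \<Rightarrow> 'a::comm_ring_1 R"
    and G :: "'a R set"
  assumes "infinity_composition UNIV l"
    and "weighting UNIV e"
    and "reduced UNIV l e"
    and "partition_of_type l U"
    and "\<forall>c \<in> Psi0 (UNIV, l, e). h c \<in> h_values (UNIV, l, e) c"
    and "G = h ` Psi0 (UNIV, l, e)"
  shows "S_radical (S_ideal_gen G) = frakP U e Spec"
proof
  let ?y = "(UNIV, l, e)"
  note e = assms(2,3) and U = assms(4)
  have h: "\<exists>K \<mu> d W V. (K, \<mu>, d) \<in> c \<and> (K, \<mu>, d) \<in> wcomps \<and> block_choice (par_n ?y) (K, \<mu>, d) W V \<and>
      h c = h_elem (par_n ?y) (par_N ?y) (K, \<mu>, d) W V" if c: "c \<in> Psi0 ?y" for c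
  proof -
    obtain x W V where x: "x \<in> c" "block_choice (par_n ?y) x W V" "h c = h_elem (par_n ?y) (par_N ?y) x W V"
      using assms(5) c unfolding h_values_def by blast
    then show ?thesis
      using Xi_wcomps[OF Psi0_Xi[OF c] x(1)] by (metis prod_cases3)
  qed
  have "G \<subseteq> frakP U e Spec"
  proof
    fix g assume "g \<in> G"
    then obtain c where c: "c \<in> Psi0 ?y" "g = h c"
      using assms(6) by blast
    then obtain K \<mu> d W V where x: "(K, \<mu>, d) \<in> c" "(K, \<mu>, d) \<in> wcomps"
      "block_choice (par_n ?y) (K, \<mu>, d) W V" "g = h_elem (par_n ?y) (par_N ?y) (K, \<mu>, d) W V"
      using h by metis
    have "\<not> (K, \<mu>, d) \<preceq> ?y"
      using c(1) x(1) by (auto simp: Psi0_def Psi_def)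
    then show "g \<in> frakP U e Spec"
      unfolding x(4) by (rule h_elem_in_frakP[OF e U x(2) _ x(3)])
  qed
  then have "S_ideal_gen G \<subseteq> frakP U e Spec"
    unfolding S_ideal_gen_def using inv_ideal_frakP[of U e Spec]
    by (intro ideal_gen_least) (auto simp: inv_ideal_def intro!: fixingI)
  then show "S_radical (S_ideal_gen G) \<subseteq> frakP U e Spec"
    by (rule S_radical_subset_frakP[OF e U])
  show "frakP U e Spec \<subseteq> S_radical (S_ideal_gen G)"
  proof (rule subsetI, rule ccontr)
    fix f assume f: "f \<in> frakP U e Spec" and "f \<notin> S_radical (S_ideal_gen G)"
    then obtain p where p: "equi_prime (fixing {}) p" "S_ideal_gen G \<subseteq> p" "f \<notin> p"
      using exists_S_prime[OF inv_ideal_S_ideal_gen] by blast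
    have hp: "h c \<in> p" if "c \<in> Psi0 ?y" for c
    proof -
      have "act id (h c) \<in> S_ideal_gen G"
        unfolding S_ideal_gen_def using that assms(6) Sym_inf_id by (intro ideal_gen_base) blast
      then show ?thesis
        using p(2) by (auto simp: act_id)
    qed
    \<comment> \<open>At least one h must exist for \<open>p\<close> to contain a power of a
      discriminant.\<close>
    obtain c where "c \<in> Psi0 ?y"
      using Psi_nonempty[of l e] exists_Psi0_below[of _ ?y] by blast
    then obtain m M where "vand Var {..<m} ^ M \<in> p"
      using h[of c] hp[of c] h_elem_dvd_vand ideal_dvd[OF equi_prime_ideal[OF p(1)]] by metis
    then obtain W0 K N q0 where "config p W0 K N q0"
      using exists_config[OF p(1)] by blast
    then obtain W q where "saturated_config p W K N q"
      using exists_saturated_config by blast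
    then interpret sat_config p W K N q
      by unfold_locales
    show False
    proof (cases "(K, ctype, cwt) \<preceq> ?y")
      case True
      obtain \<sigma> where "\<sigma> \<in> Sym_inf" "act \<sigma> f \<notin> q"
        using core[OF p(3)] by blast
      moreover have "act \<sigma> f \<in> frakP U e Spec"
        using inv_ideal_frakP[of U e Spec] f \<open>\<sigma> \<in> Sym_inf\<close> unfolding inv_ideal_def
        by (auto intro: fixingI)
      ultimately show False
        using frakP_subset_q[OF e(1) U True] by blast
    next
      case False
      let ?x = "(K, ctype, cwt)"
      have "\<not> z \<preceq> ?y" if z: "z \<in> wcomp_iso `` {?x}" for z
      proof
        assume "z \<preceq> ?y"
        moreover obtain L \<nu> b where eq: "z = (L, \<nu>, b)"
          by (metis prod_cases3)
        moreover have "?x \<preceq> z" "finite L"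
          using z wcomp_iso_le[of ?x z] wcomp_iso_wcomps[of ?x z] finite_wcomps eq by auto
        ultimately show False
          using False wcomp_le_trans[of L UNIV K ctype cwt \<nu> b l e] by simp
      qed
      then have "wcomp_iso `` {?x} \<in> Psi ?y"
        unfolding Psi_def Xi_def using quotientI[OF ctype_wcomps] by blast
      \<comment> \<open>A minimal class below the type of the configuration has its h in
        \<open>p\<close>, whereas the matching makes some conjugate of it nonzero modulo
        \<open>q\<close>.\<close>
      then obtain c where c: "c \<in> Psi0 ?y" "\<And>z. z \<in> c \<Longrightarrow> z \<preceq> ?x"
        using exists_Psi0_below[OF ctype_wcomps] by blast
      obtain K' \<mu> d W' V where x: "(K', \<mu>, d) \<in> c" "(K', \<mu>, d) \<in> wcomps"
        "block_choice (par_n ?y) (K', \<mu>, d) W' V" "h c = h_elem (par_n ?y) (par_N ?y) (K', \<mu>, d) W' V"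
        using h[OF c(1)] by blast
      obtain \<tau> where "\<tau> \<in> Sym_inf" "act \<tau> (h c) \<notin> q"
        using h_elem_notin[OF x(2) c(2)[OF x(1)] x(3)] unfolding x(4) by blast
      moreover have "act \<tau> (h c) \<in> p"
        using equi_prime_inv[OF p(1) _ hp[OF c(1)]] \<open>\<tau> \<in> Sym_inf\<close> by (auto intro: fixingI)
      ultimately show False
        using pq by blast
    qed
  qed
qed

end
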